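(* Let $\mu\in\mathcal{B}$, i.e. let $\mu$ be a Borel probability measure on $\mathbb{C}$ with compact non-polar support $S(\mu)$. For $n\ge 2$ let $\omega_n$ be the measure of maximal entropy (equivalently, the equilibrium measure of the Julia set $J_n$) of the degree $n$ orthonormal polynomial $P_n$ of $\mu$. Then the sequence $\{\omega_n\}_{n\ge 2}$ is pre-compact for the weak-* topology, and for any limit measure $\nu$ of a weak-* convergent sub-sequence $\{\omega_{n_k}\}_k$, the support $S(\nu)$ of $\nu$ satisfies $$S(\nu)\subseteq K(\mu).$$ Moreover, if $\mu$ is $n$-th root regular, i.e. $\lim_{n\to\infty}\gamma_n^{1/n}=1/\operatorname{Cap}(S(\mu))$, then $$\omega_n \longrightarrow \omega_{S(\mu)}\quad\text{in the weak-* topology as } n\to\infty,$$ where $\omega_{S(\mu)}$ is the equilibrium measure of $S(\mu)$.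
   Context: Potential theory: for a Borel probability measure $\sigma$ on $\mathbb{C}$ with compact support, its energy is $I(\sigma)=\int\int\log|z-w|\,d\sigma(w)\,d\sigma(z)\in[-\infty,\infty)$. For a Borel set $B\subset\mathbb{C}$, $I(B)=\sup\{I(\sigma)\}$ over Borel probability measures $\sigma$ with compact support contained in $B$, and the logarithmic capacity is $\operatorname{Cap}(B)=e^{I(B)}$. $B$ is polar if $\operatorname{Cap}(B)=0$, and non-polar otherwise. For a compact non-polar set $S$, the equilibrium measure $\omega_S$ is the unique Borel probability measure supported in $S$ with $I(\omega_S)=I(S)$. $\mathcal{B}$ denotes the set of Borel probability measures on $\mathbb{C}$ with compact non-polar support. For $\mu\in\mathcal{B}$ with support $S(\mu)$, let $\Omega(\mu)$ be the unbounded connected component of $\mathbb{C}\setminus S(\mu)$ and $K(\mu)=\mathbb{C}\setminus\Omega(\mu)$ (the filled-in support). Orthonormal polynomials: $\{P_n\}_{n\ge0}$ is the unique sequence of polynomials orthonormal in $L^2(\mu)$ with $P_n(z)=\gamma_n z^n+\text{lower order terms}$, $\gamma_n>0$. Dynamics: for $n\ge2$, $\Omega_n=\{z\in\mathbb{C}: P_n^k(z)\to\infty \text{ as } k\to\infty\}$, where $P_n^k$ is the $k$-fold composition of $P_n$ with itself; $K_n=\mathbb{C}\setminus\Omega_n$ is the filled Julia set and $J_n=\partial K_n=\partial\Omega_n$ the Julia set of $P_n$ (both compact and non-polar). $\omega_n$ denotes the equilibrium measure of $J_n$ (equivalently of $K_n$), which by a theorem of Brolin is the unique measure of maximal entropy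 of $P_n$. Weak-* convergence of probability measures on $\mathbb{C}$ means convergence of integrals of all compactly supported continuous functions. A sequence of Borel probability measures is pre-compact for the weak-* topology if every sub-sequence has a further sub-sequence converging weak-* to a Borel probability measure on $\mathbb{C}$. *)

theory Defs
  imports
    "HOL-Analysis.Analysis"
    "HOL-Probability.Probability"
    "HOL-Computational_Algebra.Polynomial"
begin

definition borel_prob :: "complex measure \<Rightarrow> bool" where
  "borel_prob \<sigma> \<longleftrightarrow> prob_space \<sigma> \<and> sets \<sigma> = sets borel"

definition msupport :: "complex measure \<Rightarrow> complex set" where
  "msupport \<sigma> = {z. \<forall>U. open U \<longrightarrow> z \<in> U \<longrightarrow> 0 < emeasure \<sigma> U}"

definition log_ereal :: "real \<Rightarrow> ereal" where
  "log_ereal x = (if x = 0 then -\<infinity> else ereal (ln x))"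

text \<open>
  The Lebesgue integral of an extended-real function as the difference of the integrals of its
  positive and negative parts; the map \<^const>\<open>e2ennreal\<close> truncates negative values to 0.
  It has the intended meaning when one of the two parts is finite. This is the case in \<open>energy \<sigma>\<close>
  for \<open>\<sigma>\<close> of compact support, since the logarithm is then bounded above.
\<close>
definition eintegral :: "'a measure \<Rightarrow> ('a \<Rightarrow> ereal) \<Rightarrow> ereal" where
  "eintegral M f =
     enn2ereal (\<integral>\<^sup>+ x. e2ennreal (f x) \<partial>M) - enn2ereal (\<integral>\<^sup>+ x. e2ennreal (- f x) \<partial>M)"

definition energy :: "complex measure \<Rightarrow> ereal" where
  "energy \<sigma> = eintegral \<sigma> (\<lambda>z. eintegral \<sigma> (\<lambda>w. log_ereal (cmod (z - w))))"

text \<open>The supremum over the empty family, i.e. for \<open>B = {}\<close>, is \<open>-\<infinity>\<close>.\<close>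
definition set_energy :: "complex set \<Rightarrow> ereal" where
  "set_energy B =
     Sup {energy \<sigma> | \<sigma>. borel_prob \<sigma> \<and> compact (msupport \<sigma>) \<and> msupport \<sigma> \<subseteq> B}"

fun exp_ereal :: "ereal \<Rightarrow> ereal" where
  "exp_ereal (ereal r) = ereal (exp r)"
| "exp_ereal PInfty = \<infinity>"
| "exp_ereal MInfty = 0"

definition log_capacity :: "complex set \<Rightarrow> ereal" where
  "log_capacity B = exp_ereal (set_energy B)"

definition polar :: "complex set \<Rightarrow> bool" where
  "polar B \<longleftrightarrow> log_capacity B = 0"

text \<open>Meaningful for compact non-polar \<open>S\<close>, where such a measure exists and is unique.\<close>
definition equilibrium_measure :: "complex set \<Rightarrow> complex measure" where
  "equilibrium_measure S =
     (THE \<sigma>. borel_prob \<sigma> \<and> msupport \<sigma> \<subseteq> S \<and> energy \<sigma> = set_energy S)"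

definition nonpolar_measures :: "complex measure set" where
  "nonpolar_measures =
     {\<mu>. borel_prob \<mu> \<and> compact (msupport \<mu>) \<and> \<not> polar (msupport \<mu>)}"

text \<open>
  The library's \<^const>\<open>outside\<close> is the union of all unbounded components of the complement.
  For a compact subset of the plane there is exactly one such component.
\<close>
definition filled_support :: "complex measure \<Rightarrow> complex set" where
  "filled_support \<mu> = - outside (msupport \<mu>)"

text \<open>Unique for measures with compact, infinite support, in particular for non-polar support.\<close>
definition orthonormal_poly :: "complex measure \<Rightarrow> nat \<Rightarrow> complex poly" where
  "orthonormal_poly \<mu> =
     (THE P. (\<forall>n. degree (P n) = n \<and> (\<exists>\<gamma>>0. lead_coeff (P n) = complex_of_real \<gamma>)) \<and>
             (\<forall>m n. (LINT z|\<mu>. poly (P m) z * cnj (poly (P n) z)) = (if m = n then 1 else 0)))"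

definition orthonormal_lead :: "complex measure \<Rightarrow> nat \<Rightarrow> real" where
  "orthonormal_lead \<mu> n = Re (lead_coeff (orthonormal_poly \<mu> n))"

definition escape_set :: "complex poly \<Rightarrow> complex set" where
  "escape_set p = {z. filterlim (\<lambda>k. (poly p ^^ k) z) at_infinity sequentially}"

definition filled_julia :: "complex poly \<Rightarrow> complex set" where
  "filled_julia p = - escape_set p"

definition julia :: "complex poly \<Rightarrow> complex set" where
  "julia p = frontier (filled_julia p)"

definition julia_measure :: "complex measure \<Rightarrow> nat \<Rightarrow> complex measure" where
  "julia_measure \<mu> n = equilibrium_measure (julia (orthonormal_poly \<mu> n))"

text \<open>Test functions are continuous with compact support (not merely bounded).\<close>
definition weak_star_conv :: "(nat \<Rightarrow> complex measure) \<Rightarrow> complex measure \<Rightarrow> bool" where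
  "weak_star_conv \<sigma> \<nu> \<longleftrightarrow>
     (\<forall>f :: complex \<Rightarrow> real. continuous_on UNIV f \<longrightarrow> compact (closure {z. f z \<noteq> 0}) \<longrightarrow>
        (\<lambda>k. LINT z|\<sigma> k. f z) \<longlonglongrightarrow> (LINT z|\<nu>. f z))"

definition weak_star_precompact :: "(nat \<Rightarrow> complex measure) \<Rightarrow> bool" where
  "weak_star_precompact \<sigma> \<longleftrightarrow>
     (\<forall>r :: nat \<Rightarrow> nat. strict_mono r \<longrightarrow>
        (\<exists>(s :: nat \<Rightarrow> nat) \<nu>. strict_mono s \<and> borel_prob \<nu> \<and> weak_star_conv (\<lambda>k. \<sigma> (r (s k))) \<nu>))"

definition nth_root_regular :: "complex measure \<Rightarrow> bool" where
  "nth_root_regular \<mu> \<longleftrightarrow>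
     (\<lambda>n. ereal (root n (orthonormal_lead \<mu> n))) \<longlonglongrightarrow> 1 / log_capacity (msupport \<mu>)"

end

theory Submission
  imports Defs "HOL-Complex_Analysis.Complex_Analysis" "HOL-Computational_Algebra.Fundamental_Theorem_Algebra"
begin

text \<open>
  Let \<open>S\<close> be the support of \<open>\<mu>\<close>, let \<open>K\<close> be its filling and let \<open>I\<close> denote the logarithmic
  energy. Replacing zeros of \<open>P\<^sub>n\<close> by other points keeps the leading coefficient, and \<open>P\<^sub>n\<close> has
  minimal norm for its leading coefficient. This keeps the zeros in a disc around \<open>S\<close>
  (\<open>OP_zeros\<close>) and bounds \<open>\<gamma>\<^sub>n\<close> from below, so that every \<open>P\<^sub>n\<close> with \<open>n \<ge> 2\<close> at least doubles the modulus
  outside one fixed disc (\<open>OP_escape\<close>). Hence all Julia sets lie in this disc, and pre-compactness is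
  the weak compactness of the probability measures on a disc (\<open>weak_star_compact\<close>).

  The measures \<open>\<omega>\<^sub>n\<close> are controlled by iterated preimages, as in Brolin's theorem. Start from a measure
  of finite energy in an annulus far outside, and pull it back under \<open>P\<^sub>n\<close> repeatedly, giving equal weight to
  the \<open>n\<close> preimages of each point. A pullback changes energies by an affine map of slope \<open>1/n\<close>
  (\<open>neg_energy_push_pull\<close>) with fixed point \<open>- ln \<gamma>\<^sub>n / (n - 1)\<close>. The energies of the iterated pullbacks
  converge to this fixed point, and so do their mutual energies with any measure on the filled Julia set.
  Positive definiteness of the energy then makes it the maximal energy on the Julia set, and upper
  semicontinuity shows that weak limits of the pullbacks, which live on the Julia set, attain it. So \<open>\<omega>\<^sub>n\<close> is
  such a limit, \<open>I(\<omega>\<^sub>n) = - ln \<gamma>\<^sub>n / (n - 1)\<close>, and the mass that \<open>\<omega>\<^sub>n\<close> gives to an open set is at most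
  \<open>1/n\<close> times the maximal number of zeros that \<open>P\<^sub>n - w\<close> has there (\<open>julia_equilibrium\<close>).

  A limit measure is carried by \<open>K\<close> because this number stays bounded near each point \<open>\<zeta>\<close> of the
  unbounded component (\<open>few_preimages\<close>). Pushing the pole of \<open>1 / (z - a)\<close> from a distant \<open>a\<close> to \<open>\<zeta>\<close> yields
  a monic polynomial \<open>q\<close> with \<open>|q(z)| \<le> q\<^sub>0 |z - \<zeta>| ^ deg q\<close> on \<open>S\<close> and \<open>q\<^sub>0 < 1\<close>
  (\<open>relatively_small_monic\<close>). If \<open>P\<^sub>n - w\<close> had many zeros near \<open>\<zeta>\<close>, replacing them by a power of
  \<open>q\<close> would produce a polynomial with leading coefficient \<open>\<gamma>\<^sub>n\<close> and norm below 1, against the minimality of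
  \<open>P\<^sub>n\<close>.

  In the regular case \<open>I(\<omega>\<^sub>n)\<close> tends to \<open>I(S)\<close>, so by upper semicontinuity every limit measure has energy at
  least \<open>I(S)\<close>; it is carried by \<open>K\<close>. The only such measure is the equilibrium measure of \<open>S\<close>
  (\<open>filled_equilibrium\<close>): smearing the part of a measure that sits in the holes of \<open>S\<close> over small annuli
  does not decrease the energy but increases the second moment, so the unique maximiser on \<open>K\<close> is carried
  by \<open>S\<close>. All limit measures coincide, which with pre-compactness is convergence.

  The energy itself is treated through the representation of \<open>ln (D / |z - w|)\<close> as an integral of Gaussian
  kernels with a positive weight, up to subtracted constants (\<open>log_kernel_gauss_mix\<close>). A Gaussian kernel is
  an overlap of two Gaussians, hence positive definite and weakly continuous; this gives positive
  definiteness with its case of equality (\<open>neg_energy_pos_def\<close>, \<open>neg_energy_eq_imp_eq\<close>) and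
  semicontinuity (\<open>neg_energy_lsc\<close>), and from these existence and uniqueness of equilibrium measures
  (\<open>equilibrium_measure_props\<close>).
\<close>

section \<open>Supports and test functions\<close>

definition prob_on :: "complex set \<Rightarrow> complex measure \<Rightarrow> bool" where
  "prob_on S \<sigma> \<longleftrightarrow> borel_prob \<sigma> \<and> (AE z in \<sigma>. z \<in> S)"

lemma borel_prob_simps:
  assumes "borel_prob \<sigma>"
  shows "prob_space \<sigma>" "sets \<sigma> = sets borel" "space \<sigma> = UNIV"
  using assms sets_eq_imp_space_eq[of \<sigma> borel] by (auto simp: borel_prob_def)

lemma closed_msupport: "closed (msupport \<sigma>)"
proof -
  have "- msupport \<sigma> = \<Union>{U. open U \<and> emeasure \<sigma> U = 0}"
    by (auto simp: msupport_def zero_less_iff_neq_zero)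
  then have "open (- msupport \<sigma>)"
    by auto
  then show ?thesis by (simp add: closed_def)
qed

text \<open>The complement of the support is a union of open null sets, and by the Lindelof property
  countably many of them suffice.\<close>
lemma AE_msupport:
  assumes "borel_prob \<sigma>"
  shows "AE z in \<sigma>. z \<in> msupport \<sigma>"
proof -
  note \<sigma> = borel_prob_simps[OF assms]
  let ?F = "{U. open U \<and> emeasure \<sigma> U = 0}"
  obtain F' where F': "F' \<subseteq> ?F" "countable F'" "\<Union>F' = \<Union>?F"
    using Lindelof[of ?F] by auto
  have eq: "- msupport \<sigma> = \<Union>?F"
    by (auto simp: msupport_def zero_less_iff_neq_zero)
  have "\<Union>F' \<in> null_sets \<sigma>"
    using F' \<sigma> by (intro null_sets_UN'[of F' "\<lambda>x. x", simplified]) (auto simp: null_sets_def)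
  then show ?thesis
    using eq F'(3) by (intro AE_I'[of "\<Union>F'"]) auto
qed

lemma msupport_subset_iff:
  assumes "borel_prob \<sigma>" "closed S"
  shows "msupport \<sigma> \<subseteq> S \<longleftrightarrow> (AE z in \<sigma>. z \<in> S)"
proof
  assume "msupport \<sigma> \<subseteq> S"
  then show "AE z in \<sigma>. z \<in> S"
    using AE_msupport[OF assms(1)] by auto
next
  note \<sigma> = borel_prob_simps[OF assms(1)]
  assume "AE z in \<sigma>. z \<in> S"
  then have "emeasure \<sigma> (- S) = 0"
    using assms \<sigma> by (subst (asm) AE_iff_measurable[of "- S"]) auto
  moreover have "open (- S)" using assms(2) by (rule open_Compl)
  ultimately have "z \<notin> msupport \<sigma>" if "z \<in> - S" for z
    using that \<open>open (- S)\<close> \<open>emeasure \<sigma> (- S) = 0\<close>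
    by (auto simp: msupport_def intro!: exI[of _ "- S"])
  then show "msupport \<sigma> \<subseteq> S" by blast
qed

lemma prob_on_iff_msupport: "closed S \<Longrightarrow> prob_on S \<sigma> \<longleftrightarrow> borel_prob \<sigma> \<and> msupport \<sigma> \<subseteq> S"
  using msupport_subset_iff by (auto simp: prob_on_def)

lemma prob_on_mono: "prob_on S \<sigma> \<Longrightarrow> S \<subseteq> T \<Longrightarrow> prob_on T \<sigma>"
  unfolding prob_on_def by (auto elim: eventually_mono)

lemma prob_onD:
  assumes "prob_on S \<sigma>"
  shows "borel_prob \<sigma>" "prob_space \<sigma>" "sets \<sigma> = sets borel" "space \<sigma> = UNIV"
    "AE z in \<sigma>. z \<in> S"
  using assms borel_prob_simps by (auto simp: prob_on_def)

lemma prob_on_distr: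
  assumes "prob_space M" "f \<in> borel_measurable M" "AE x in M. f x \<in> S" "S \<in> sets borel"
  shows "prob_on S (distr M borel f)"
  unfolding prob_on_def borel_prob_def
  using assms by (auto simp: prob_space.prob_space_distr AE_distr_iff)

definition test_fun :: "(complex \<Rightarrow> real) \<Rightarrow> bool" where
  "test_fun f \<longleftrightarrow> continuous_on UNIV f \<and> compact (closure {z. f z \<noteq> 0})"

lemma weak_star_convD:
  "weak_star_conv \<sigma> \<nu> \<Longrightarrow> test_fun f \<Longrightarrow> (\<lambda>k. LINT z|\<sigma> k. f z) \<longlonglongrightarrow> (LINT z|\<nu>. f z)"
  by (auto simp: weak_star_conv_def test_fun_def)

lemma weak_star_conv_test_fun:
  "weak_star_conv \<sigma> \<nu> \<longleftrightarrow> (\<forall>f. test_fun f \<longrightarrow> (\<lambda>k. LINT z|\<sigma> k. f z) \<longlonglongrightarrow> (LINT z|\<nu>. f z))"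
  by (auto simp: weak_star_conv_def test_fun_def)

lemma weak_star_conv_subseq:
  "weak_star_conv \<sigma> \<nu> \<Longrightarrow> strict_mono r \<Longrightarrow> weak_star_conv (\<lambda>k. \<sigma> (r k)) \<nu>"
  unfolding weak_star_conv_def using LIMSEQ_subseq_LIMSEQ[of _ _ r] by (force simp: o_def)

lemma test_funI:
  assumes "continuous_on UNIV f" "bounded S" "\<And>z. z \<notin> S \<Longrightarrow> f z = 0"
  shows "test_fun f"
proof -
  have "{z. f z \<noteq> 0} \<subseteq> S" using assms(3) by auto
  then have "bounded {z. f z \<noteq> 0}" using assms(2) bounded_subset by blast
  then show ?thesis using assms(1) by (simp add: test_fun_def)
qed

lemma test_fun_bounded:
  assumes "test_fun f"
  obtains B where "\<And>z. \<bar>f z\<bar> \<le> B" "B > 0"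
proof -
  have "compact (f ` closure {z. f z \<noteq> 0})"
    using assms continuous_on_subset[of UNIV f]
    by (intro compact_continuous_image) (auto simp: test_fun_def)
  then obtain B where B: "B > 0" "\<And>y. y \<in> f ` closure {z. f z \<noteq> 0} \<Longrightarrow> norm y \<le> B"
    by (metis bounded_pos compact_imp_bounded)
  have "\<bar>f z\<bar> \<le> B" for z
  proof (cases "f z = 0")
    case False
    then have "z \<in> closure {z. f z \<noteq> 0}"
      using closure_subset[of "{z. f z \<noteq> 0}"] by auto
    then show ?thesis using B by auto
  qed (use B in auto)
  with B show ?thesis using that by blast
qed

lemma test_fun_measurable: "test_fun f \<Longrightarrow> f \<in> borel_measurable borel"
  by (auto simp: test_fun_def intro: borel_measurable_continuous_onI)

lemma test_fun_integrable:
  assumes "test_fun f" "borel_prob \<sigma>"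
  shows "integrable \<sigma> f"
proof -
  interpret prob_space \<sigma> using assms borel_prob_simps by auto
  obtain B where "\<And>z. \<bar>f z\<bar> \<le> B" using test_fun_bounded assms by metis
  then show ?thesis
    using test_fun_measurable[OF assms(1)] borel_prob_simps[OF assms(2)]
    by (intro integrable_const_bound[of _ B]) (auto cong: measurable_cong_sets)
qed

definition bump :: "complex \<Rightarrow> real \<Rightarrow> complex \<Rightarrow> real" where
  "bump z r x = max 0 (1 - dist x z / r)"

lemma test_fun_bump:
  assumes "r > 0"
  shows "test_fun (bump z r)"
proof (rule test_funI[of _ "cball z r"])
  show "continuous_on UNIV (bump z r)"
    unfolding bump_def[abs_def] using assms by (intro continuous_intros) auto
qed (use assms in \<open>auto simp: bump_def field_simps dist_commute\<close>)

lemma bump_bounds: "r > 0 \<Longrightarrow> 0 \<le> bump z r x" "r > 0 \<Longrightarrow> bump z r x \<le> indicator (ball z r) x"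
  by (auto simp: bump_def indicator_def field_simps max_def dist_commute)

lemma bump_ge_half: "r > 0 \<Longrightarrow> indicator (ball z (r/2)) x \<le> 2 * bump z r x"
  by (auto simp: bump_def indicator_def field_simps max_def dist_commute)

lemma not_in_msupport_bump:
  assumes "borel_prob \<nu>" "r > 0" "(LINT x|\<nu>. bump z r x) = 0"
  shows "z \<notin> msupport \<nu>"
proof -
  note \<nu> = borel_prob_simps[OF assms(1)]
  interpret prob_space \<nu> by fact
  have "(LINT x|\<nu>. indicator (ball z (r/2)) x) \<le> (LINT x|\<nu>. 2 * bump z r x)"
  proof (rule integral_mono)
    show "integrable \<nu> (indicator (ball z (r/2)) :: complex \<Rightarrow> real)"
      using \<nu> by (intro integrable_real_indicator) (auto simp: emeasure_eq_measure)
    show "integrable \<nu> (\<lambda>x. 2 * bump z r x)"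
      by (intro integrable_mult_right test_fun_integrable test_fun_bump assms)
  qed (rule bump_ge_half[OF assms(2)])
  then have "measure \<nu> (ball z (r/2)) = 0"
    using assms \<nu> measure_nonneg[of \<nu> "ball z (r/2)"] by simp
  then have "emeasure \<nu> (ball z (r/2)) = 0"
    by (simp add: emeasure_eq_measure)
  then show ?thesis
    using assms(2) by (auto simp: msupport_def intro!: exI[of _ "ball z (r/2)"])
qed

text \<open>A bump function around a point off \<open>S\<close> has integral 0 along the sequence, hence also for the
  limit.\<close>
lemma prob_on_weak_limit:
  assumes "weak_star_conv \<sigma> \<nu>" "\<And>k. prob_on S (\<sigma> k)" "closed S" "borel_prob \<nu>"
  shows "prob_on S \<nu>"
  unfolding prob_on_iff_msupport[OF assms(3)]
proof (safe intro!: assms)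
  fix z assume z: "z \<in> msupport \<nu>"
  show "z \<in> S"
  proof (rule ccontr)
    assume "z \<notin> S"
    then obtain r where r: "r > 0" "ball z r \<subseteq> - S"
      using assms(3) by (auto simp: closed_def elim!: openE)
    have "(LINT x|\<sigma> k. bump z r x) = 0" for k
    proof -
      have "AE x in \<sigma> k. bump z r x = 0"
        using prob_onD(5)[OF assms(2)[of k]]
      proof eventually_elim
        case (elim x)
        then have "x \<notin> ball z r" using r by auto
        then show ?case using r by (auto simp: bump_def field_simps dist_commute)
      qed
      then show ?thesis by (rule integral_eq_zero_AE)
    qed
    then have "(LINT x|\<nu>. bump z r x) = 0"
      using weak_star_convD[OF assms(1) test_fun_bump[OF r(1), of z]] by (simp add: LIMSEQ_const_iff)
    then show False
      using not_in_msupport_bump assms r z by blast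
  qed
qed

lemma test_fun_infdist:
  assumes "compact C" "C \<noteq> {}"
  shows "test_fun (\<lambda>x. max 0 (1 - real (Suc k) * infdist x C))"
proof (rule test_funI)
  show "continuous_on UNIV (\<lambda>x. max 0 (1 - real (Suc k) * infdist x C))"
    by (intro continuous_intros)
  have "compact {x. infdist x C \<le> 1}"
    using assms by (intro compact_infdist_le) auto
  then show "bounded {x. infdist x C \<le> 1}"
    by (rule compact_imp_bounded)
  fix x assume "x \<notin> {x. infdist x C \<le> 1}"
  then have "1 * 1 \<le> real (Suc k) * infdist x C"
    by (intro mult_mono) auto
  then show "max 0 (1 - real (Suc k) * infdist x C) = 0"
    by simp
qed

text \<open>The test functions decrease to the indicator of \<open>C\<close>; this recovers the measure of compact sets
  from integrals of test functions.\<close>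
lemma test_fun_tendsto_compact:
  assumes "borel_prob \<sigma>" "compact C" "C \<noteq> {}"
  shows "(\<lambda>k. LINT x|\<sigma>. max 0 (1 - real (Suc k) * infdist x C)) \<longlonglongrightarrow> measure \<sigma> C"
proof -
  note \<sigma> = borel_prob_simps[OF assms(1)]
  interpret prob_space \<sigma> by fact
  have "(\<lambda>k. LINT x|\<sigma>. max 0 (1 - real (Suc k) * infdist x C)) \<longlonglongrightarrow> (LINT x|\<sigma>. indicator C x)"
  proof (rule integral_dominated_convergence[where w="\<lambda>_. 1"])
    show "(\<lambda>x. indicator C x :: real) \<in> borel_measurable \<sigma>"
      using assms \<sigma> by (auto intro!: borel_measurable_indicator simp: borel_compact)
    show "(\<lambda>x. max 0 (1 - real (Suc k) * infdist x C)) \<in> borel_measurable \<sigma>" for k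
      using test_fun_integrable[OF test_fun_infdist[OF assms(2,3)] assms(1)] by blast
    show "AE x in \<sigma>. norm (max 0 (1 - real (Suc k) * infdist x C)) \<le> 1" for k
      by (auto simp: infdist_nonneg)
    show "AE x in \<sigma>. (\<lambda>k. max 0 (1 - real (Suc k) * infdist x C)) \<longlonglongrightarrow> indicator C x"
    proof (rule AE_I2)
      fix x
      show "(\<lambda>k. max 0 (1 - real (Suc k) * infdist x C)) \<longlonglongrightarrow> indicator C x"
      proof (cases "x \<in> C")
        case False
        then have pos: "infdist x C > 0"
          using assms in_closed_iff_infdist_zero[of C x] infdist_nonneg[of x C]
          by (auto simp: compact_imp_closed order_less_le)
        obtain N where N: "1 < real N * infdist x C"
          using reals_Archimedean3[OF pos] by auto
        have "eventually (\<lambda>k. max 0 (1 - real (Suc k) * infdist x C) = indicator C x) sequentially"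
          using eventually_ge_at_top[of N]
        proof eventually_elim
          case (elim k)
          have "real N * infdist x C \<le> real (Suc k) * infdist x C"
            using elim pos by (intro mult_right_mono) auto
          then show ?case using N False by simp
        qed
        then show ?thesis by (rule tendsto_eventually)
      qed auto
    qed
  qed auto
  then show ?thesis using \<sigma> by simp
qed

lemma borel_prob_eqI_test_fun:
  assumes "borel_prob \<sigma>" "borel_prob \<tau>"
    "\<And>f. test_fun f \<Longrightarrow> (\<And>x. 0 \<le> f x) \<Longrightarrow> (LINT x|\<sigma>. f x) = (LINT x|\<tau>. f x)"
  shows "\<sigma> = \<tau>"
proof -
  note \<sigma> = borel_prob_simps[OF assms(1)] and \<tau> = borel_prob_simps[OF assms(2)]
  interpret S: prob_space \<sigma> by fact
  interpret T: prob_space \<tau> by fact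
  have compact_eq: "emeasure \<sigma> C = emeasure \<tau> C" if "compact C" for C
  proof (cases "C = {}")
    case False
    have "measure \<sigma> C = measure \<tau> C"
      using test_fun_tendsto_compact[OF assms(1) that False]
        test_fun_tendsto_compact[OF assms(2) that False]
        assms(3)[OF test_fun_infdist[OF that False]] LIMSEQ_unique by simp
    then show ?thesis by (simp add: S.emeasure_eq_measure T.emeasure_eq_measure)
  qed auto
  show ?thesis
  proof (rule measure_eqI_generator_eq[where E="{C. closed C}" and \<Omega>=UNIV and A="\<lambda>_. UNIV"])
    show "sets \<sigma> = sigma_sets UNIV {C. closed C}" "sets \<tau> = sigma_sets UNIV {C. closed C}"
      using \<sigma> \<tau> by (auto simp: borel_eq_closed)
    fix C :: "complex set" assume "C \<in> {C. closed C}"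
    then have C: "closed C" by simp
    let ?A = "\<lambda>n. C \<inter> cball 0 (real n)"
    have inc: "incseq ?A" by (auto simp: incseq_def)
    have "x \<in> (\<Union>n. ?A n)" if "x \<in> C" for x
      using that real_arch_simple[of "cmod x"] by auto
    then have U: "(\<Union>n. ?A n) = C" by auto
    have comp: "compact (?A n)" for n using C by (simp add: closed_Int_compact)
    have meas: "range ?A \<subseteq> sets borel"
      using comp by (auto simp: borel_compact)
    have "(\<lambda>n. emeasure \<sigma> (?A n)) \<longlonglongrightarrow> emeasure \<sigma> C"
      using Lim_emeasure_incseq[of ?A \<sigma>] meas inc \<sigma> U by simp
    moreover have "(\<lambda>n. emeasure \<tau> (?A n)) \<longlonglongrightarrow> emeasure \<tau> C"
      using Lim_emeasure_incseq[of ?A \<tau>] meas inc \<tau> U by simp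
    ultimately show "emeasure \<sigma> C = emeasure \<tau> C"
      using compact_eq[OF comp] LIMSEQ_unique by simp
  qed (auto simp: Int_stable_def)
qed
text \<open>On measures carried by one fixed ball the compact support of test functions is immaterial:
  a cutoff turns every continuous function into a test function without changing its integrals.\<close>

lemma cutoff_test_fun:
  assumes "continuous_on UNIV (f :: complex \<Rightarrow> real)"
  shows "test_fun (\<lambda>z. f z * max 0 (min 1 (R + 1 - cmod z)))"
  by (rule test_funI[of _ "cball 0 (R + 1)"]) (auto intro!: continuous_intros assms)

lemma cutoff_integral:
  fixes f :: "complex \<Rightarrow> real"
  assumes "prob_on (cball 0 R) \<sigma>" "continuous_on UNIV f"
  shows "(LINT z|\<sigma>. f z) = (LINT z|\<sigma>. f z * max 0 (min 1 (R + 1 - cmod z)))"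
    and "integrable \<sigma> f"
proof -
  note \<sigma> = prob_onD[OF assms(1)]
  have m: "f \<in> borel_measurable \<sigma>"
    using borel_measurable_continuous_onI[OF assms(2)] \<sigma> by (auto cong: measurable_cong_sets)
  have ae: "AE z in \<sigma>. f z * max 0 (min 1 (R + 1 - cmod z)) = f z"
    using \<sigma>(5) by eventually_elim auto
  have i: "integrable \<sigma> (\<lambda>z. f z * max 0 (min 1 (R + 1 - cmod z)))"
    by (intro test_fun_integrable cutoff_test_fun assms \<sigma>)
  show "(LINT z|\<sigma>. f z) = (LINT z|\<sigma>. f z * max 0 (min 1 (R + 1 - cmod z)))"
    using ae i m by (intro integral_cong_AE) auto
  show "integrable \<sigma> f"
    using integrable_cong_AE_imp[OF i m] ae by auto
qed

lemma weak_star_conv_continuous: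
  fixes f :: "complex \<Rightarrow> real"
  assumes "weak_star_conv \<sigma> \<nu>" "\<And>k. prob_on (cball 0 R) (\<sigma> k)" "borel_prob \<nu>"
    "continuous_on UNIV f"
  shows "(\<lambda>k. LINT z|\<sigma> k. f z) \<longlonglongrightarrow> (LINT z|\<nu>. f z)"
proof -
  have "prob_on (cball 0 R) \<nu>"
    using prob_on_weak_limit[OF assms(1,2)] assms(3) by auto
  then show ?thesis
    using weak_star_convD[OF assms(1) cutoff_test_fun[OF assms(4), of R]]
      cutoff_integral(1)[OF assms(2) assms(4)] cutoff_integral(1)[OF _ assms(4), of R \<nu>] by simp
qed

section \<open>A space-filling curve and measurable selection of zeros\<close>

text \<open>In the space-filling curve of Schoenberg, this even function of period 2 is 0 on \<open>[0, 1/3]\<close> and 1 on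
  \<open>[2/3, 1]\<close>: it reads off whether a ternary digit is 0 or 2.\<close>
definition schoenberg_wave :: "real \<Rightarrow> real" where
  "schoenberg_wave t = max 0 (min 1 (1/2 - cos (pi * t)))"

definition schoenberg_coord :: "real \<Rightarrow> real" where
  "schoenberg_coord t = (\<Sum>k. schoenberg_wave (9 ^ k * t) * (1/2) ^ Suc k)"

lemma schoenberg_wave_bounds: "0 \<le> schoenberg_wave t" "schoenberg_wave t \<le> 1"
  by (auto simp: schoenberg_wave_def)

lemma continuous_schoenberg_coord: "continuous_on UNIV schoenberg_coord"
proof -
  have "uniform_limit UNIV (\<lambda>n t. \<Sum>k<n. schoenberg_wave (9 ^ k * t) * (1/2) ^ Suc k)
      (\<lambda>t. \<Sum>k. schoenberg_wave (9 ^ k * t) * (1/2) ^ Suc k) sequentially"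
  proof (rule Weierstrass_m_test[where M="\<lambda>k. (1/2) ^ Suc k"])
    show "summable (\<lambda>k. (1/2) ^ Suc k :: real)"
      by (simp add: summable_geometric)
  qed (use schoenberg_wave_bounds in \<open>auto simp: abs_mult mult_left_le_one_le\<close>)
  moreover have "continuous_on UNIV (\<lambda>t. \<Sum>k<n. schoenberg_wave (9 ^ k * t) * (1/2) ^ Suc k)" for n
    unfolding schoenberg_wave_def by (intro continuous_intros)
  ultimately show ?thesis
    unfolding schoenberg_coord_def[abs_def] by (intro uniform_limit_theorem) auto
qed

lemma binary_digits:
  fixes x :: real
  assumes "0 \<le> x" "x < 1"
  obtains b :: "nat \<Rightarrow> real" where "\<And>k. b k \<in> {0, 1}" "(\<lambda>k. b k * (1/2) ^ Suc k) sums x"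
proof -
  define f where "f n = real_of_int \<lfloor>2 ^ n * x\<rfloor> / 2 ^ n" for n
  define b where "b k = real_of_int (\<lfloor>2 ^ Suc k * x\<rfloor> - 2 * \<lfloor>2 ^ k * x\<rfloor>)" for k
  have "b k \<in> {0, 1}" for k
  proof -
    have "2 * \<lfloor>2 ^ k * x\<rfloor> \<le> \<lfloor>2 ^ Suc k * x\<rfloor>" "\<lfloor>2 ^ Suc k * x\<rfloor> < 2 * \<lfloor>2 ^ k * x\<rfloor> + 2"
      by (simp_all add: le_floor_iff floor_less_iff) linarith+
    then show ?thesis unfolding b_def by force
  qed
  moreover have "(\<lambda>k. b k * (1/2) ^ Suc k) sums x"
  proof -
    have "f \<longlonglongrightarrow> x"
    proof (rule tendsto_sandwich[of "\<lambda>n. x - (1/2) ^ n" _ _ "\<lambda>_. x"])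
      have "x - (1/2) ^ n \<le> f n \<and> f n \<le> x" for n
      proof -
        have "2 ^ n * x - 1 \<le> \<lfloor>2 ^ n * x\<rfloor>" "\<lfloor>2 ^ n * x\<rfloor> \<le> 2 ^ n * x" by linarith+
        then have "(2 ^ n * x - 1) / 2 ^ n \<le> f n" "f n \<le> (2 ^ n * x) / 2 ^ n"
          unfolding f_def by (intro divide_right_mono; simp)+
        then show ?thesis by (simp add: diff_divide_distrib power_one_over)
      qed
      then show "\<forall>\<^sub>F n in sequentially. x - (1/2) ^ n \<le> f n" "\<forall>\<^sub>F n in sequentially. f n \<le> x"
        by auto
      show "(\<lambda>n. x - (1/2) ^ n) \<longlonglongrightarrow> x"
        using tendsto_diff[OF tendsto_const LIMSEQ_realpow_zero[of "1/2::real"], of x] by simp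
    qed auto
    then have "(\<lambda>k. f (Suc k) - f k) sums (x - f 0)"
      by (rule telescope_sums)
    moreover have "f 0 = 0"
      using assms by (simp add: f_def floor_eq_iff)
    moreover have "f (Suc k) - f k = b k * (1/2) ^ Suc k" for k
      by (simp add: f_def b_def field_simps)
    ultimately show ?thesis by simp
  qed
  ultimately show ?thesis using that by blast
qed

lemma summable_ternary_digits:
  assumes "\<And>j. a j \<in> {0, 1 :: real}"
  shows "summable (\<lambda>j. 2 * a j * (1/3) ^ Suc j)"
proof (rule summable_comparison_test')
  show "summable (\<lambda>j. 2 * (1/3) ^ Suc j :: real)"
    by (intro summable_mult) (simp add: summable_geometric)
  show "norm (2 * a j * (1/3) ^ Suc j) \<le> 2 * (1/3) ^ Suc j" if "j \<ge> 0" for j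
    using assms[of j] by auto
qed

lemma ternary_digits_bounds:
  assumes "\<And>j. a j \<in> {0, 1 :: real}"
  shows "0 \<le> (\<Sum>j. 2 * a j * (1/3) ^ Suc j)" "(\<Sum>j. 2 * a j * (1/3) ^ Suc j) \<le> 1"
proof -
  have le: "0 \<le> 2 * a j * (1/3) ^ Suc j \<and> 2 * a j * (1/3) ^ Suc j \<le> 2 * 1 * (1/3) ^ Suc j" for j
    using assms[of j] by auto
  then show "0 \<le> (\<Sum>j. 2 * a j * (1/3) ^ Suc j)"
    by (intro suminf_nonneg summable_ternary_digits assms) auto
  have "(\<Sum>j. 2 * a j * (1/3) ^ Suc j) \<le> (\<Sum>j. 2 * 1 * (1/3) ^ Suc j)"
    using le by (intro suminf_le summable_ternary_digits assms) auto
  also have "\<dots> = 1"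
    using sums_unique[OF sums_mult[OF geometric_sums[of "1/3::real"], of "2/3"]] by simp
  finally show "(\<Sum>j. 2 * a j * (1/3) ^ Suc j) \<le> 1" .
qed

text \<open>Multiplication by \<open>3 ^ k\<close> moves the digit in position \<open>k\<close> to the front; the digits before it
  contribute an even integer, which is a period of the wave.\<close>
lemma schoenberg_wave_digit:
  assumes "\<And>j. a j \<in> {0, 1 :: real}"
  shows "schoenberg_wave (3 ^ k * (\<Sum>j. 2 * a j * (1/3) ^ Suc j)) = a k"
proof -
  let ?s = "\<lambda>j. 2 * a j * (1/3) ^ Suc j"
  note summ = summable_ternary_digits
  define r where "r = (\<Sum>j. 2 * a (j + Suc k) * (1/3) ^ Suc j)"
  have r: "0 \<le> r" "r \<le> 1"
    unfolding r_def using ternary_digits_bounds[of "\<lambda>j. a (j + Suc k)"] assms by simp_all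
  have "\<exists>m::int. 3 ^ k * (\<Sum>j<k. ?s j) = 2 * of_int m"
  proof
    have "3 ^ k * ?s j = 2 * of_int (\<lfloor>a j\<rfloor> * 3 ^ (k - Suc j))" if "j < k" for j
    proof -
      have "(3::real) ^ k = 3 ^ (k - Suc j) * 3 ^ Suc j"
        using that by (simp only: power_add[symmetric]) simp
      moreover have "real_of_int \<lfloor>a j\<rfloor> = a j" using assms[of j] by auto
      ultimately show ?thesis
        by (simp add: power_one_over field_simps del: of_int_floor_cancel)
    qed
    then have "(\<Sum>j<k. 3 ^ k * ?s j) = (\<Sum>j<k. 2 * of_int (\<lfloor>a j\<rfloor> * 3 ^ (k - Suc j)))"
      by (intro sum.cong) auto
    then show "3 ^ k * (\<Sum>j<k. ?s j) = 2 * of_int (\<Sum>j<k. \<lfloor>a j\<rfloor> * 3 ^ (k - Suc j))"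
      by (simp only: sum_distrib_left of_int_sum)
  qed
  then obtain m :: int where m: "3 ^ k * (\<Sum>j<k. ?s j) = 2 * of_int m" ..
  have "(\<Sum>j. ?s j) = (\<Sum>j. ?s (j + Suc k)) + (\<Sum>j<Suc k. ?s j)"
    by (rule suminf_split_initial_segment[OF summ[OF assms]])
  moreover have "(\<Sum>j. ?s (j + Suc k)) = r / 3 ^ Suc k"
  proof -
    have "(\<Sum>j. ?s (j + Suc k)) = (\<Sum>j. (1/3) ^ Suc k * (2 * a (j + Suc k) * (1/3) ^ Suc j))"
      by (simp add: power_add mult_ac)
    also have "\<dots> = (1/3) ^ Suc k * r"
      unfolding r_def using assms by (intro suminf_mult summ)
    finally show ?thesis by (simp add: power_one_over field_simps)
  qed
  ultimately have "3 ^ k * (\<Sum>j. ?s j) = 2 * of_int m + (2 * a k + r) / 3"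
    using m by (simp add: algebra_simps power_one_over)
  moreover have "cos (pi * (2 * of_int m + u)) = cos (pi * u)" for u
    using cos.plus_of_int[of "pi * u" m] by (simp add: algebra_simps)
  ultimately have eq: "schoenberg_wave (3 ^ k * (\<Sum>j. ?s j)) = schoenberg_wave ((2 * a k + r) / 3)"
    by (simp add: schoenberg_wave_def)
  show ?thesis
  proof (cases "a k = 0")
    case True
    have "cos (pi/3) \<le> cos (pi * (r / 3))"
      using r by (intro cos_monotone_0_pi_le) auto
    then show ?thesis using True eq by (simp add: schoenberg_wave_def cos_60)
  next
    case False
    then have a: "a k = 1" using assms[of k] by auto
    have "cos (pi * ((2 + r) / 3)) \<le> cos (2 * pi / 3)"
      using r by (intro cos_monotone_0_pi_le) (auto simp: field_simps)
    then show ?thesis using a eq by (simp add: schoenberg_wave_def cos_120)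
  qed
qed

text \<open>The binary digits of the two coordinates are interleaved as ternary digits of the parameter. The first
  coordinate reads the even positions, and the factor 3 shifts the odd positions into their place.\<close>
lemma schoenberg_surjective:
  assumes "0 \<le> x" "x < 1" "0 \<le> y" "y < 1"
  obtains t where "0 \<le> t" "t \<le> 1" "schoenberg_coord t = x" "schoenberg_coord (3 * t) = y"
proof -
  obtain b where b: "\<And>k. b k \<in> {0, 1 :: real}" "(\<lambda>k. b k * (1/2) ^ Suc k) sums x"
    using binary_digits assms by blast
  obtain c where c: "\<And>k. c k \<in> {0, 1 :: real}" "(\<lambda>k. c k * (1/2) ^ Suc k) sums y"
    using binary_digits assms by blast
  define a where "a j = (if even j then b (j div 2) else c (j div 2))" for j
  have a: "a j \<in> {0, 1}" for j using b c by (simp add: a_def)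
  define t where "t = (\<Sum>j. 2 * a j * (1/3) ^ Suc j)"
  have wave: "schoenberg_wave (3 ^ k * t) = a k" for k
    unfolding t_def by (rule schoenberg_wave_digit[OF a])
  have "(9::real) ^ k = 3 ^ (2 * k)" for k
    by (simp add: power_mult)
  then have "schoenberg_wave (9 ^ k * t) = b k" "schoenberg_wave (9 ^ k * (3 * t)) = c k" for k
    using wave[of "2 * k"] wave[of "2 * k + 1"]
    by (simp_all add: a_def mult_ac)
  then have "schoenberg_coord t = x" "schoenberg_coord (3 * t) = y"
    using b c by (simp_all add: schoenberg_coord_def sums_iff)
  moreover have "0 \<le> t" "t \<le> 1"
    unfolding t_def using ternary_digits_bounds[OF a] by auto
  ultimately show ?thesis using that by simp
qed

lemma curve_onto_disc:
  assumes "R > 0"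
  obtains h :: "real \<Rightarrow> complex" where "continuous_on UNIV h" "cball 0 R \<subseteq> h ` {0..1}"
proof -
  \<comment> \<open>The side length \<open>4 R\<close> puts the disc into the interior of the image square, so no coordinate has to reach 1.\<close>
  define h where "h t = of_real (4 * R) * (Complex (schoenberg_coord t) (schoenberg_coord (3 * t)) - Complex (1/2) (1/2))" for t
  have "continuous_on UNIV (\<lambda>t. schoenberg_coord (3 * t))"
    by (rule continuous_on_compose2[OF continuous_schoenberg_coord]) (auto intro!: continuous_intros)
  then have "continuous_on UNIV h"
    unfolding h_def[abs_def] Complex_eq
    using continuous_schoenberg_coord by (intro continuous_intros) auto
  moreover have "z \<in> h ` {0..1}" if z: "z \<in> cball 0 R" for z
  proof -
    have "\<bar>Re z\<bar> \<le> R" "\<bar>Im z\<bar> \<le> R"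
      using z abs_Re_le_cmod[of z] abs_Im_le_cmod[of z] by auto
    then have "0 \<le> 1/2 + Re z / (4 * R)" "1/2 + Re z / (4 * R) < 1"
        "0 \<le> 1/2 + Im z / (4 * R)" "1/2 + Im z / (4 * R) < 1"
      using assms by (auto simp: field_simps)
    then obtain t where "0 \<le> t" "t \<le> 1" "schoenberg_coord t = 1/2 + Re z / (4 * R)"
      "schoenberg_coord (3 * t) = 1/2 + Im z / (4 * R)"
      using schoenberg_surjective by metis
    then show ?thesis
      using assms by (intro image_eqI[of _ _ t]) (auto simp: h_def complex_eq_iff)
  qed
  ultimately show ?thesis using that by blast
qed

text \<open>The first zero is a measurable choice: by compactness there is a zero in \<open>[0, a]\<close> iff the function
  takes arbitrarily small values at the points \<open>a q\<close> with \<open>q\<close> rational, which is a countable condition.\<close>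
lemma measurable_first_zero:
  fixes G :: "'a \<Rightarrow> real \<Rightarrow> real"
  assumes cont: "\<And>w. w \<in> space M \<Longrightarrow> continuous_on {0..1} (G w)"
    and meas: "\<And>t. (\<lambda>w. G w t) \<in> borel_measurable M"
    and nonneg: "\<And>w t. 0 \<le> G w t"
    and zero: "\<And>w. w \<in> space M \<Longrightarrow> \<exists>t\<in>{0..1}. G w t = 0"
  obtains \<tau> where "\<tau> \<in> borel_measurable M" "\<And>w. w \<in> space M \<Longrightarrow> \<tau> w \<in> {0..1} \<and> G w (\<tau> w) = 0"
proof -
  define \<tau> where "\<tau> w = Inf {t\<in>{0..1}. G w t = 0}" for w
  have comp: "compact {t\<in>{0..a}. G w t = 0}" if "w \<in> space M" "a \<le> 1" for w a
  proof -
    have "closed {t\<in>{0..a}. G w t = 0}"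
      using continuous_on_subset[OF cont[OF that(1)], of "{0..a}"] that
      by (intro continuous_closed_preimage_constant) auto
    moreover have "bounded {t\<in>{0..a}. G w t = 0}"
      by (rule bounded_subset[of "{0..a}"]) auto
    ultimately show ?thesis by (simp add: compact_eq_bounded_closed)
  qed
  have \<tau>: "\<tau> w \<in> {t\<in>{0..1}. G w t = 0}" if "w \<in> space M" for w
    unfolding \<tau>_def using comp[OF that, of 1] zero[OF that]
    by (intro closed_contains_Inf) (auto simp: compact_imp_closed intro!: bdd_belowI[of _ 0])
  have \<tau>_le: "\<tau> w \<le> t" if "t \<in> {0..1}" "G w t = 0" for w t
    unfolding \<tau>_def using that by (intro cInf_lower) (auto intro!: bdd_belowI[of _ 0])
  have "{w \<in> space M. \<tau> w \<le> a} \<in> sets M" for a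
  proof -
    consider "a < 0" | "0 \<le> a" "a \<le> 1" | "a > 1" by linarith
    then show ?thesis
    proof cases
      case 1
      then have "{w \<in> space M. \<tau> w \<le> a} = {}" using \<tau> by force
      then show ?thesis by (simp only: sets.empty_sets)
    next
      case 3
      then have "{w \<in> space M. \<tau> w \<le> a} = space M" using \<tau> by force
      then show ?thesis by (simp only: sets.top)
    next
      case 2
      let ?Q = "{q\<in>\<rat>. 0 \<le> q \<and> q \<le> 1}"
      \<comment> \<open>Scaling by \<open>a\<close> provides a countable dense subset of \<open>[0, a]\<close> that contains both endpoints.\<close>
      have iff: "\<tau> w \<le> a \<longleftrightarrow> (\<forall>n. \<exists>q\<in>?Q. G w (a * q) < 1 / Suc n)" if w: "w \<in> space M" for w
      proof
        assume le: "\<tau> w \<le> a"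
        show "\<forall>n. \<exists>q\<in>?Q. G w (a * q) < 1 / Suc n"
        proof
          fix n
          obtain u where u: "0 \<le> u" "u \<le> 1" "\<tau> w = a * u"
          proof (cases "a = 0")
            case True then show ?thesis using that[of 0] \<tau>[OF w] le by auto
          next
            case False then show ?thesis using that[of "\<tau> w / a"] \<tau>[OF w] le 2 by (auto simp: field_simps)
          qed
          have "continuous_on {0..1} (\<lambda>q. G w (a * q))"
            by (rule continuous_on_compose2[OF cont[OF w]])
               (use 2 in \<open>auto intro!: continuous_intros simp: mult_le_one\<close>)
          then obtain d where d: "d > 0" "\<And>q. q \<in> {0..1} \<Longrightarrow> dist q u < d \<Longrightarrow> dist (G w (a * q)) (G w (a * u)) < 1 / Suc n"
            using u unfolding continuous_on_iff by (metis atLeastAtMost_iff of_nat_0_less_iff zero_less_Suc zero_less_divide_1_iff)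
          obtain q where q: "q \<in> \<rat>" "0 \<le> q" "q \<le> 1" "dist q u < d"
          proof (cases "u = 0")
            case True then show ?thesis using that[of 0] d by auto
          next
            case False
            then have "max 0 (u - d) < u" using u d by auto
            then obtain q where "q \<in> \<rat>" "max 0 (u - d) < q" "q < u" using Rats_dense_in_real by blast
            then show ?thesis using that[of q] u by (auto simp: dist_real_def)
          qed
          have "G w (a * u) = 0" using u \<tau>[OF w] by auto
          then show "\<exists>q\<in>?Q. G w (a * q) < 1 / Suc n"
            using d(2)[of q] q by (auto simp: dist_real_def)
        qed
      next
        assume *: "\<forall>n. \<exists>q\<in>?Q. G w (a * q) < 1 / Suc n"
        have "continuous_on {0..a} (G w)"
          using continuous_on_subset[OF cont[OF w]] 2 by auto
        then obtain t where t: "t \<in> {0..a}" "\<And>s. s \<in> {0..a} \<Longrightarrow> G w t \<le> G w s"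
          using continuous_attains_inf[of "{0..a}" "G w"] 2 by auto
        have "G w t < 1 / Suc n" for n
        proof -
          obtain q where "q \<in> ?Q" "G w (a * q) < 1 / Suc n" using * by blast
          moreover have "a * q \<in> {0..a}" using calculation 2 by (auto simp: mult_left_le)
          ultimately show ?thesis using t(2)[of "a * q"] by linarith
        qed
        then have "G w t = 0"
          using nonneg[of w t] nat_approx_posE[of "G w t"] by (metis less_eq_real_def less_le_not_le order_less_trans)
        then show "\<tau> w \<le> a" using \<tau>_le[of t w] t 2 by auto
      qed
      have "countable ?Q" by (rule countable_subset[OF _ countable_rat]) auto
      moreover have [measurable]: "\<And>q. (\<lambda>w. G w (a * q)) \<in> borel_measurable M" using meas by simp
      ultimately have "{w \<in> space M. \<forall>n. \<exists>q\<in>?Q. G w (a * q) < 1 / Suc n} \<in> sets M"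
        by (intro sets.sets_Collect_countable_All sets.sets_Collect_countable_Ex') auto
      moreover have "{w \<in> space M. \<tau> w \<le> a} = {w \<in> space M. \<forall>n. \<exists>q\<in>?Q. G w (a * q) < 1 / Suc n}"
        using iff by blast
      ultimately show ?thesis by simp
    qed
  qed
  then have "\<tau> \<in> borel_measurable M"
    by (simp add: borel_measurable_iff_le)
  then show ?thesis using that \<tau> by blast
qed

text \<open>Running through the disc along a curve reduces the selection of a complex zero to that of a first real
  parameter.\<close>
lemma measurable_zero_coding:
  fixes F :: "'a \<Rightarrow> complex \<Rightarrow> complex" and h :: "real \<Rightarrow> complex"
  assumes "\<And>w. w \<in> space M \<Longrightarrow> continuous_on UNIV (F w)"
    and "\<And>z. (\<lambda>w. F w z) \<in> borel_measurable M"
    and "continuous_on UNIV h" "cball 0 R \<subseteq> h ` {0..1}"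
    and "\<And>w. w \<in> space M \<Longrightarrow> \<exists>z\<in>cball 0 R. F w z = 0"
  obtains \<tau> where "\<tau> \<in> borel_measurable M"
    "\<And>w. w \<in> space M \<Longrightarrow> \<tau> w \<in> {0..1} \<and> F w (h (\<tau> w)) = 0"
proof (rule measurable_first_zero[of M "\<lambda>w t. cmod (F w (h t))"])
  show "continuous_on {0..1} (\<lambda>t. cmod (F w (h t)))" if "w \<in> space M" for w
    by (intro continuous_on_norm continuous_on_compose2[OF assms(1)[OF that]]
        continuous_on_subset[OF assms(3)]) auto
  show "(\<lambda>w. cmod (F w (h t))) \<in> borel_measurable M" for t
    using assms(2) by measurable
  show "\<exists>t\<in>{0..1}. cmod (F w (h t)) = 0" if "w \<in> space M" for w
    using assms(5)[OF that] assms(4) by force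
qed (use that in auto)

section \<open>Weak compactness of measures on a disc\<close>

text \<open>The curve \<open>h\<close> has a Borel right inverse \<open>\<tau>\<close> on the disc. Transporting the measures to \<open>[0, 1]\<close>
  by \<open>\<tau>\<close> makes them tight on the line, so that Helly's selection theorem applies; the limit is transported back by
  the continuous map \<open>h\<close>.\<close>
theorem weak_star_compact:
  assumes "\<And>k. prob_on (cball 0 R) (\<sigma> k)"
  obtains s \<nu> where "strict_mono (s :: nat \<Rightarrow> nat)" "borel_prob \<nu>" "weak_star_conv (\<lambda>k. \<sigma> (s k)) \<nu>"
proof -
  define R' where "R' = max R 1"
  have R': "R' > 0" by (simp add: R'_def)
  have on: "prob_on (cball 0 R') (\<sigma> k)" for k
    by (rule prob_on_mono[OF assms]) (auto simp: R'_def)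
  obtain h :: "real \<Rightarrow> complex" where h: "continuous_on UNIV h" "cball 0 R' \<subseteq> h ` {0..1}"
    using curve_onto_disc[OF R'] by blast
  define N where "N = restrict_space (borel :: complex measure) (cball 0 R')"
  obtain \<tau>0 where \<tau>0: "\<tau>0 \<in> borel_measurable N"
    "\<And>w. w \<in> space N \<Longrightarrow> \<tau>0 w \<in> {0..1} \<and> h (\<tau>0 w) - w = 0"
  proof (rule measurable_zero_coding[of N "\<lambda>w z. z - w" h R'])
    show "(\<lambda>w. z - w) \<in> borel_measurable N" for z
      unfolding N_def by (intro measurable_restrict_space1) measurable
    show "\<exists>z\<in>cball 0 R'. z - w = 0" if "w \<in> space N" for w
      using that by (auto simp: N_def space_restrict_space)
  qed (use h in \<open>auto intro!: continuous_intros\<close>)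
  define \<tau> where "\<tau> w = (if w \<in> cball 0 R' then \<tau>0 w else 0)" for w
  have \<tau>_meas: "\<tau> \<in> borel_measurable borel"
    unfolding \<tau>_def[abs_def] using \<tau>0(1) unfolding N_def
    by (subst measurable_If_restrict_space_iff) (auto simp: cball_def)
  have \<tau>: "\<tau> w \<in> {0..1}" "w \<in> cball 0 R' \<Longrightarrow> h (\<tau> w) = w" for w
    using \<tau>0(2)[of w] by (auto simp: \<tau>_def N_def space_restrict_space)
  define m where "m k = distr (\<sigma> k) borel \<tau>" for k
  have m_meas: "\<tau> \<in> borel_measurable (\<sigma> k)" for k
    using \<tau>_meas prob_onD[OF on[of k]] by (auto cong: measurable_cong_sets)
  have rd: "real_distribution (m k)" for k
    using prob_space.prob_space_distr[OF prob_onD(2)[OF on[of k]] m_meas]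
    by (auto simp: real_distribution_def real_distribution_axioms_def m_def)
  have "tight m"
    unfolding tight_def
  proof (intro conjI allI impI rd)
    fix \<epsilon> :: real assume "\<epsilon> > 0"
    have "measure (m k) {-1<..1} = 1" for k
    proof -
      interpret prob_space "\<sigma> k" by (rule prob_onD(2)[OF on[of k]])
      have "\<tau> -` {-1<..1} \<inter> space (\<sigma> k) = space (\<sigma> k)"
      proof -
        have "\<tau> z \<in> {-1<..1}" for z using \<tau>(1)[of z] by auto
        then show ?thesis by blast
      qed
      then show ?thesis
        using m_meas[of k] prob_space by (simp add: m_def measure_distr)
    qed
    then show "\<exists>a b. a < b \<and> (\<forall>n. 1 - \<epsilon> < measure (m n) {a<..b})"
      using \<open>\<epsilon> > 0\<close> by (intro exI[of _ "-1"] exI[of _ 1]) auto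
  qed
  then obtain s M where s: "strict_mono (s :: nat \<Rightarrow> nat)" "real_distribution M" "weak_conv_m (m \<circ> s) M"
    using tight_imp_convergent_subsubsequence[of m id] by (auto simp: strict_mono_id comp_def)
  interpret M: real_distribution M by fact
  have h_meas: "h \<in> borel_measurable M"
    using borel_measurable_continuous_onI[OF h(1)] by simp
  define \<nu> where "\<nu> = distr M borel h"
  have "borel_prob \<nu>"
    using M.prob_space_distr[OF h_meas] by (simp add: borel_prob_def \<nu>_def)
  moreover have "weak_star_conv (\<lambda>k. \<sigma> (s k)) \<nu>"
    unfolding weak_star_conv_test_fun
  proof safe
    fix f assume f: "test_fun f"
    obtain B where B: "\<And>z. \<bar>f z\<bar> \<le> B" using test_fun_bounded[OF f] by blast
    have fc: "continuous_on UNIV f" using f by (simp add: test_fun_def)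
    have fm: "f \<in> borel_measurable borel" by (rule test_fun_measurable[OF f])
    have "isCont (\<lambda>t. f (h t)) t" for t
      using continuous_on_compose2[OF fc h(1)] by (simp add: continuous_on_eq_continuous_at)
    then have "(\<lambda>k. LINT t|(m \<circ> s) k. f (h t)) \<longlonglongrightarrow> (LINT t|M. f (h t))"
      using s rd B
      by (intro weak_conv_imp_integral_bdd_continuous_conv[where B=B]) (auto simp: comp_def)
    moreover have "(LINT t|m k. f (h t)) = (LINT z|\<sigma> k. f z)" for k
    proof -
      have hb: "(\<lambda>t. f (h t)) \<in> borel_measurable borel"
        using borel_measurable_continuous_onI[OF continuous_on_compose2[OF fc h(1)]] by simp
      have "(LINT t|m k. f (h t)) = (LINT z|\<sigma> k. f (h (\<tau> z)))"
        unfolding m_def using m_meas hb by (intro integral_distr) auto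
      also have "\<dots> = (LINT z|\<sigma> k. f z)"
      proof (rule integral_cong_AE)
        show "(\<lambda>z. f (h (\<tau> z))) \<in> borel_measurable (\<sigma> k)"
          using measurable_compose[OF m_meas hb] .
        show "f \<in> borel_measurable (\<sigma> k)"
          using fm prob_onD[OF on[of k]] by (auto cong: measurable_cong_sets)
        show "AE z in \<sigma> k. f (h (\<tau> z)) = f z"
          using prob_onD(5)[OF on[of k]] \<tau>(2) by (auto elim: eventually_mono)
      qed
      finally show ?thesis .
    qed
    moreover have "(LINT t|M. f (h t)) = (LINT z|\<nu>. f z)"
      unfolding \<nu>_def using h_meas fm by (intro integral_distr[symmetric]) auto
    ultimately show "(\<lambda>k. LINT z|\<sigma> (s k). f z) \<longlonglongrightarrow> (LINT z|\<nu>. f z)"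
      by (simp add: comp_def)
  qed
  ultimately show ?thesis using that s by blast
qed

section \<open>The logarithmic kernel as a mixture of Gaussians\<close>

text \<open>The sign is chosen so that the kernel is nonnegative at points of distance at most \<open>D\<close>; truncation of
  the real logarithm at 0 then has no effect, and all integrals are those of nonnegative functions.\<close>
definition log_kernel :: "real \<Rightarrow> complex \<Rightarrow> complex \<Rightarrow> ennreal" where
  "log_kernel D z w = (if z = w then \<infinity> else ennreal (ln (D / cmod (z - w))))"

lemma borel_measurable_log_kernel [measurable]:
  assumes "f \<in> borel_measurable M" "g \<in> borel_measurable M"
  shows "(\<lambda>x. log_kernel D (f x) (g x)) \<in> borel_measurable M"
  using assms unfolding log_kernel_def by measurable

lemma nn_integral_exp_decay:
  assumes "t > 0"
  shows "(\<integral>\<^sup>+v. ennreal (exp (- t * v)) * indicator {a..b} v \<partial>lborel) = ennreal ((exp (- t * a) - exp (- t * b)) / t)"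
proof (cases "a \<le> b")
  case True
  have "(\<integral>\<^sup>+v. ennreal (exp (- t * v)) * indicator {a..b} v \<partial>lborel) = ennreal (- exp (- t * b) / t - - exp (- t * a) / t)"
    using assms True
    by (intro nn_integral_FTC_Icc) (auto intro!: derivative_eq_intros)
  then show ?thesis by (simp add: diff_divide_distrib)
next
  case False
  then have "(exp (- t * a) - exp (- t * b)) / t \<le> 0"
    using assms by (simp add: divide_le_0_iff)
  then show ?thesis using False by (simp add: ennreal_neg)
qed

lemma nn_integral_laplace_one:
  assumes "v > 0"
  shows "(\<integral>\<^sup>+t. ennreal (exp (- t * v)) * indicator {0<..} t \<partial>lborel) = ennreal (1 / v)"
proof -
  have "(\<integral>\<^sup>+t. ennreal (exp (- t * v)) * indicator {0<..} t \<partial>lborel)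
      = (\<integral>\<^sup>+t. ennreal (exp (- t * v)) * indicator {0..} t \<partial>lborel)"
    using AE_lborel_singleton[of 0] by (intro nn_integral_cong_AE) (auto simp: indicator_def elim!: eventually_mono)
  also have "\<dots> = ennreal (0 - - exp (- 0 * v) / v)"
  proof (rule nn_integral_FTC_atLeast)
    have "((\<lambda>t. exp (- t * v)) \<longlongrightarrow> 0) at_top"
      using assms by real_asymp
    from tendsto_divide[OF tendsto_minus[OF this] tendsto_const[of v]] assms
    show "((\<lambda>t. - exp (- t * v) / v) \<longlongrightarrow> 0) at_top" by simp
  qed (use assms in \<open>auto intro!: derivative_eq_intros\<close>)
  finally show ?thesis by simp
qed

lemma nn_integral_reciprocal:
  assumes "0 \<le> a" "0 < b"
  shows "(\<integral>\<^sup>+v. ennreal (1 / v) * indicator {a..b} v \<partial>lborel) = (if a = 0 then \<infinity> else ennreal (ln (b / a)))"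
proof -
  have pos: "(\<integral>\<^sup>+v. ennreal (1 / v) * indicator {a..b} v \<partial>lborel) = ennreal (ln (b / a))"
    if "0 < a" "a \<le> b" for a
  proof -
    have "(\<integral>\<^sup>+v. ennreal (1 / v) * indicator {a..b} v \<partial>lborel) = ennreal (ln b - ln a)"
      using that by (intro nn_integral_FTC_Icc) (auto intro!: derivative_eq_intros)
    then show ?thesis using that by (simp add: ln_div)
  qed
  consider "a = 0" | "0 < a" "a \<le> b" | "a > b" using assms by linarith
  then show ?thesis
  proof cases
    case 1
    \<comment> \<open>The part of the integral over \<open>[b exp(-n), b]\<close> is already \<open>n\<close>.\<close>
    have "ennreal (real n) \<le> (\<integral>\<^sup>+v. ennreal (1 / v) * indicator {0..b} v \<partial>lborel)" for n
    proof -
      have "ennreal (real n) = ennreal (ln (b / (b * exp (- real n))))"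
      proof -
        have "b / (b * exp (- real n)) = exp (real n)"
          using assms by (simp add: exp_minus field_simps)
        then show ?thesis by simp
      qed
      also have "\<dots> = (\<integral>\<^sup>+v. ennreal (1 / v) * indicator {b * exp (- real n)..b} v \<partial>lborel)"
        using assms by (intro pos[symmetric]) (auto simp: mult_le_cancel_left1)
      also have "\<dots> \<le> (\<integral>\<^sup>+v. ennreal (1 / v) * indicator {0..b} v \<partial>lborel)"
        using assms by (intro nn_integral_mono mult_left_mono) (auto simp: indicator_def intro: order_trans[rotated])
      finally show ?thesis .
    qed
    then have "(\<integral>\<^sup>+v. ennreal (1 / v) * indicator {0..b} v \<partial>lborel) = \<infinity>"
      by (metis ennreal_of_nat_eq_real_of_nat infinity_ennreal_def ennreal_Ex_less_of_nat leD top.not_eq_extremum)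
    then show ?thesis using 1 by simp
  next
    case 2 then show ?thesis using pos by simp
  next
    case 3
    then have "ln (b / a) \<le> 0" using assms by (simp add: ln_le_zero_iff)
    then show ?thesis using 3 assms by (simp add: ennreal_neg)
  qed
qed

definition gauss_mix_weight :: "real \<Rightarrow> ennreal" where
  "gauss_mix_weight t = ennreal (1 / (2 * t)) * indicator {0<..} t"

lemma borel_measurable_gauss_mix_weight [measurable]: "gauss_mix_weight \<in> borel_measurable borel"
  unfolding gauss_mix_weight_def[abs_def] by measurable

text \<open>Frullani's integral. Both \<open>\<integral> exp(-t v) dv\<close> over \<open>[|z - w|\<^sup>2, D\<^sup>2]\<close> and \<open>\<integral> exp(-t v) dt\<close> over
  \<open>(0, \<infinity>)\<close> are elementary, and Tonelli's theorem exchanges them; the factor 2 in the weight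
  compensates for the squares.\<close>
lemma log_kernel_gauss_mix:
  assumes "D > 0"
  shows "log_kernel D z w =
    (\<integral>\<^sup>+t. gauss_mix_weight t * ennreal (exp (- t * (cmod (z - w))\<^sup>2) - exp (- t * D\<^sup>2)) \<partial>lborel)"
proof -
  let ?a = "(cmod (z - w))\<^sup>2"
  have "(\<integral>\<^sup>+t. gauss_mix_weight t * ennreal (exp (- t * ?a) - exp (- t * D\<^sup>2)) \<partial>lborel)
    = (\<integral>\<^sup>+t. \<integral>\<^sup>+v. ennreal (1/2) * indicator {0<..} t * (ennreal (exp (- t * v)) * indicator {?a..D\<^sup>2} v) \<partial>lborel \<partial>lborel)"
  proof (rule nn_integral_cong)
    fix t :: real
    show "gauss_mix_weight t * ennreal (exp (- t * ?a) - exp (- t * D\<^sup>2))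
      = (\<integral>\<^sup>+v. ennreal (1/2) * indicator {0<..} t * (ennreal (exp (- t * v)) * indicator {?a..D\<^sup>2} v) \<partial>lborel)"
    proof (cases "t > 0")
      case True
      have "ennreal (1 / (2 * t)) * ennreal (exp (- t * ?a) - exp (- t * D\<^sup>2))
        = ennreal (1/2) * ennreal ((exp (- t * ?a) - exp (- t * D\<^sup>2)) / t)"
        by (subst (1 2) ennreal_mult'[symmetric]) (use True in \<open>auto simp: field_simps\<close>)
      then show ?thesis
        using True nn_integral_exp_decay[OF True, of ?a "D\<^sup>2"]
        by (simp add: gauss_mix_weight_def nn_integral_cmult)
    qed (simp add: gauss_mix_weight_def)
  qed
  also have "\<dots> = (\<integral>\<^sup>+v. \<integral>\<^sup>+t. ennreal (1/2) * indicator {0<..} t * (ennreal (exp (- t * v)) * indicator {?a..D\<^sup>2} v) \<partial>lborel \<partial>lborel)"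
    by (rule lborel_pair.Fubini') measurable
  also have "\<dots> = (\<integral>\<^sup>+v. ennreal (1/2) * (ennreal (1 / v) * indicator {?a..D\<^sup>2} v) \<partial>lborel)"
  proof (rule nn_integral_cong_AE)
    show "AE v in lborel. (\<integral>\<^sup>+t. ennreal (1/2) * indicator {0<..} t * (ennreal (exp (- t * v)) * indicator {?a..D\<^sup>2} v) \<partial>lborel)
      = ennreal (1/2) * (ennreal (1 / v) * indicator {?a..D\<^sup>2} v)"
      using AE_lborel_singleton[of 0]
    proof eventually_elim
      case (elim v)
      show ?case
      proof (cases "v \<in> {?a..D\<^sup>2}")
        case True
        then have "0 \<le> v" by (auto intro: order_trans[rotated])
        then have "v > 0" using elim by simp
        have "(\<integral>\<^sup>+t. ennreal (1/2) * indicator {0<..} t * (ennreal (exp (- t * v)) * indicator {?a..D\<^sup>2} v) \<partial>lborel)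
          = (\<integral>\<^sup>+t. ennreal (1/2) * (ennreal (exp (- t * v)) * indicator {0<..} t) \<partial>lborel)"
          using True by (intro nn_integral_cong) (simp add: mult_ac)
        then show ?thesis using True \<open>v > 0\<close> nn_integral_laplace_one[of v] by (simp add: nn_integral_cmult)
      qed simp
    qed
  qed
  also have "\<dots> = ennreal (1/2) * (if ?a = 0 then \<infinity> else ennreal (ln (D\<^sup>2 / ?a)))"
    using assms by (subst nn_integral_cmult) (auto simp: nn_integral_reciprocal)
  also have "\<dots> = log_kernel D z w"
  proof (cases "z = w")
    case False
    have "ln (D\<^sup>2 / ?a) = 2 * ln (D / cmod (z - w))"
      using assms False by (simp add: ln_div ln_realpow)
    moreover have "ennreal (1/2) * ennreal (2 * L) = ennreal L" for L
      by (subst ennreal_mult'[symmetric]) auto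
    ultimately show ?thesis
      using False by (simp add: log_kernel_def del: ennreal_half)
  qed (simp add: log_kernel_def ennreal_mult_top)
  finally show ?thesis by simp
qed

section \<open>Energies and Gaussian energies\<close>

text \<open>The negated mutual energy, shifted by \<open>ln D\<close> for measures in a disc of diameter \<open>D\<close>.\<close>
definition neg_energy :: "real \<Rightarrow> complex measure \<Rightarrow> complex measure \<Rightarrow> ennreal" where
  "neg_energy D \<sigma> \<tau> = (\<integral>\<^sup>+p. log_kernel D (fst p) (snd p) \<partial>(\<sigma> \<Otimes>\<^sub>M \<tau>))"

definition gauss_energy :: "real \<Rightarrow> complex measure \<Rightarrow> complex measure \<Rightarrow> ennreal" where
  "gauss_energy t \<sigma> \<tau> = (\<integral>\<^sup>+p. ennreal (exp (- t * (cmod (fst p - snd p))\<^sup>2)) \<partial>(\<sigma> \<Otimes>\<^sub>M \<tau>))"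

text \<open>Gaussians are centred at points of \<open>real \<times> real\<close>, whose Lebesgue measure is a product.\<close>
definition plane_point :: "real \<times> real \<Rightarrow> complex" where
  "plane_point u = Complex (fst u) (snd u)"

text \<open>The factor 2 is chosen so that the overlap of two such Gaussians is \<open>exp (- t |x - y|\<^sup>2)\<close> up to a
  constant.\<close>
definition gauss :: "real \<Rightarrow> real \<times> real \<Rightarrow> complex \<Rightarrow> real" where
  "gauss t u x = exp (- (2 * t) * (cmod (plane_point u - x))\<^sup>2)"

definition gauss_pot :: "real \<Rightarrow> complex measure \<Rightarrow> real \<times> real \<Rightarrow> ennreal" where
  "gauss_pot t \<sigma> u = (\<integral>\<^sup>+x. ennreal (gauss t u x) \<partial>\<sigma>)"

text \<open>The normalising constant in the overlap formula \<open>gauss_overlap\<close>.\<close>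
definition gauss_mass :: "real \<Rightarrow> ennreal" where
  "gauss_mass t = (\<integral>\<^sup>+u. ennreal (exp (- (4 * t) * (cmod (plane_point u))\<^sup>2)) \<partial>lborel)"

lemma plane_point_eq: "plane_point u = of_real (fst u) + \<i> * of_real (snd u)"
  by (simp add: plane_point_def Complex_eq)

lemma borel_measurable_plane_point [measurable]: "plane_point \<in> borel_measurable borel"
  unfolding plane_point_eq[abs_def]
  by (intro borel_measurable_continuous_onI continuous_intros)

lemma borel_measurable_gauss [measurable]:
  assumes "f \<in> borel_measurable M" "g \<in> borel_measurable M"
  shows "(\<lambda>x. gauss t (f x) (g x)) \<in> borel_measurable M"
proof -
  have "(\<lambda>x. plane_point (f x)) \<in> borel_measurable M"
    using measurable_compose[OF assms(1) borel_measurable_plane_point] .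
  then show ?thesis using assms unfolding gauss_def by measurable
qed

lemma gauss_bounds: "t \<ge> 0 \<Longrightarrow> gauss t u x \<le> 1" "0 < gauss t u x"
  by (auto simp: gauss_def mult_nonneg_nonneg)

lemma gauss_mass_bounds:
  assumes "t > 0"
  shows "0 < gauss_mass t" "gauss_mass t < \<infinity>"
proof -
  \<comment> \<open>The standard deviation for which the integrand is a multiple of a normal density.\<close>
  define s where "s = sqrt (1 / (8 * t))"
  have s2: "s\<^sup>2 = 1 / (8 * t)" using assms by (simp add: s_def)
  have s_pos: "s > 0" using assms by (simp add: s_def)
  let ?I = "\<integral>\<^sup>+a. ennreal (exp (- (4 * t) * a\<^sup>2)) \<partial>lborel"
  have "exp (- (4 * t) * a\<^sup>2) = sqrt (2 * pi * s\<^sup>2) * normal_density 0 s a" for a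
    using assms by (simp add: normal_density_def s2 field_simps)
  then have "?I = (\<integral>\<^sup>+a. ennreal (sqrt (2 * pi * s\<^sup>2)) * ennreal (normal_density 0 s a) \<partial>lborel)"
    by (simp add: ennreal_mult' normal_density_nonneg)
  also have "\<dots> = ennreal (sqrt (2 * pi * s\<^sup>2)) * (\<integral>\<^sup>+a. ennreal (normal_density 0 s a) \<partial>lborel)"
    by (rule nn_integral_cmult) measurable
  also have "(\<integral>\<^sup>+a. ennreal (normal_density 0 s a) \<partial>lborel) = 1"
    using prob_space.emeasure_space_1[OF prob_space_normal_density[OF s_pos, of 0]]
    by (simp add: emeasure_density)
  finally have I: "?I = ennreal (sqrt (2 * pi * s\<^sup>2))" by simp
  have "gauss_mass t = (\<integral>\<^sup>+u. ennreal (exp (- (4 * t) * (cmod (plane_point u))\<^sup>2)) \<partial>(lborel \<Otimes>\<^sub>M lborel))"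
    unfolding gauss_mass_def lborel_prod by simp
  also have "\<dots> = (\<integral>\<^sup>+a. \<integral>\<^sup>+b. ennreal (exp (- (4 * t) * a\<^sup>2)) * ennreal (exp (- (4 * t) * b\<^sup>2)) \<partial>lborel \<partial>lborel)"
    by (subst lborel.nn_integral_fst[symmetric])
       (auto simp: plane_point_def cmod_def distrib_left exp_add ring_distribs mult_exp_exp simp flip: ennreal_mult' cong: measurable_cong_sets)
  also have "\<dots> = ?I * ?I"
    by (simp add: nn_integral_cmult nn_integral_multc)
  finally have "gauss_mass t = ennreal (2 * pi * s\<^sup>2)"
    using I by (simp flip: ennreal_mult')
  then show "0 < gauss_mass t" "gauss_mass t < \<infinity>"
    using s_pos by auto
qed

lemma nn_integral_plane_translate:
  assumes [measurable]: "f \<in> borel_measurable borel"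
  shows "(\<integral>\<^sup>+u. f (plane_point u - m) \<partial>lborel) = (\<integral>\<^sup>+u. f (plane_point u) \<partial>lborel)"
proof -
  let ?c = "(Re m, Im m)"
  have "(\<integral>\<^sup>+u. f (plane_point u - m) \<partial>lborel) = (\<integral>\<^sup>+u. f (plane_point u - m) \<partial>(distr lborel borel ((+) ?c)))"
    by (simp add: lborel_distr_plus)
  also have "\<dots> = (\<integral>\<^sup>+u. f (plane_point (?c + u) - m) \<partial>lborel)"
    by (subst nn_integral_distr) measurable
  also have "\<dots> = (\<integral>\<^sup>+u. f (plane_point u) \<partial>lborel)"
    by (intro nn_integral_cong arg_cong[of _ _ f]) (simp add: plane_point_def complex_eq_iff)
  finally show ?thesis .
qed

text \<open>By the parallelogram identity, the product of the Gaussians centred at \<open>x\<close> and \<open>y\<close> is a multiple of the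
  Gaussian centred at their midpoint.\<close>
lemma gauss_overlap:
  "(\<integral>\<^sup>+u. ennreal (gauss t u x) * ennreal (gauss t u y) \<partial>lborel) = ennreal (exp (- t * (cmod (x - y))\<^sup>2)) * gauss_mass t"
proof -
  let ?m = "(x + y) / 2"
  have parallelogram: "2 * (cmod (p - x))\<^sup>2 + 2 * (cmod (p - y))\<^sup>2 = 4 * (cmod (p - ?m))\<^sup>2 + (cmod (x - y))\<^sup>2" for p
    by (simp only: cmod_power2) (simp add: power2_eq_square field_simps)
  have "gauss t u x * gauss t u y
      = exp (- t * (cmod (x - y))\<^sup>2) * exp (- (4 * t) * (cmod (plane_point u - ?m))\<^sup>2)" for u
  proof -
    have "gauss t u x * gauss t u y = exp (- t * (2 * (cmod (plane_point u - x))\<^sup>2 + 2 * (cmod (plane_point u - y))\<^sup>2))"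
      by (simp add: gauss_def mult_exp_exp algebra_simps)
    also have "\<dots> = exp (- t * (cmod (x - y))\<^sup>2) * exp (- (4 * t) * (cmod (plane_point u - ?m))\<^sup>2)"
      unfolding parallelogram by (simp add: mult_exp_exp algebra_simps)
    finally show ?thesis .
  qed
  then have "(\<integral>\<^sup>+u. ennreal (gauss t u x) * ennreal (gauss t u y) \<partial>lborel)
     = (\<integral>\<^sup>+u. ennreal (exp (- t * (cmod (x - y))\<^sup>2)) * ennreal (exp (- (4 * t) * (cmod (plane_point u - ?m))\<^sup>2)) \<partial>lborel)"
    by (simp flip: ennreal_mult' add: gauss_bounds less_imp_le)
  also have "\<dots> = ennreal (exp (- t * (cmod (x - y))\<^sup>2)) * (\<integral>\<^sup>+u. ennreal (exp (- (4 * t) * (cmod (plane_point u - ?m))\<^sup>2)) \<partial>lborel)"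
    by (rule nn_integral_cmult) measurable
  also have "(\<integral>\<^sup>+u. ennreal (exp (- (4 * t) * (cmod (plane_point u - ?m))\<^sup>2)) \<partial>lborel) = gauss_mass t"
    unfolding gauss_mass_def
    by (rule nn_integral_plane_translate[where f="\<lambda>z. ennreal (exp (- (4 * t) * (cmod z)\<^sup>2))"]) measurable
  finally show ?thesis .
qed

lemma sets_pair_borel:
  assumes "borel_prob \<sigma>" "borel_prob \<tau>"
  shows "sets (\<sigma> \<Otimes>\<^sub>M \<tau>) = sets (borel \<Otimes>\<^sub>M borel)"
  using assms by (intro sets_pair_measure_cong) (auto simp: borel_prob_def)

lemma pair_prob_space_borel_prob:
  assumes "borel_prob \<sigma>" "borel_prob \<tau>"
  shows "pair_prob_space \<sigma> \<tau>"
  using assms by (simp add: borel_prob_def pair_prob_space_def pair_sigma_finite_def prob_space_imp_sigma_finite)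

lemma measurable_pair_borel_prob:
  assumes "borel_prob \<sigma>" "borel_prob \<tau>"
  shows "measurable (\<sigma> \<Otimes>\<^sub>M \<tau>) N = measurable (borel \<Otimes>\<^sub>M borel) N"
  using sets_pair_borel[OF assms] by (intro measurable_cong_sets) auto

lemma gauss_pot_measurable [measurable]:
  assumes "borel_prob \<sigma>"
  shows "gauss_pot t \<sigma> \<in> borel_measurable borel"
proof -
  interpret prob_space \<sigma> using assms borel_prob_simps by auto
  have "(\<lambda>(u, x). ennreal (gauss t u x)) \<in> borel_measurable (borel \<Otimes>\<^sub>M borel)"
    unfolding split_beta by measurable
  then have "(\<lambda>(u, x). ennreal (gauss t u x)) \<in> borel_measurable (borel \<Otimes>\<^sub>M \<sigma>)"
    using borel_prob_simps[OF assms] by (subst measurable_cong_sets[OF sets_pair_measure_cong]) auto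
  then show ?thesis
    unfolding gauss_pot_def[abs_def] by (rule borel_measurable_nn_integral)
qed

text \<open>The Gaussian energy is an inner product of the potentials in \<open>L\<^sup>2\<close> of the plane; this is the source of
  positive definiteness.\<close>
lemma gauss_energy_pot:
  assumes "borel_prob \<sigma>" "borel_prob \<tau>"
  shows "gauss_energy t \<sigma> \<tau> * gauss_mass t = (\<integral>\<^sup>+u. gauss_pot t \<sigma> u * gauss_pot t \<tau> u \<partial>lborel)"
proof -
  note \<sigma> = borel_prob_simps[OF assms(1)] and \<tau> = borel_prob_simps[OF assms(2)]
  interpret S: prob_space \<sigma> by fact
  interpret T: prob_space \<tau> by fact
  interpret ST: pair_prob_space \<sigma> \<tau> by (rule pair_prob_space_borel_prob[OF assms])
  interpret STL: pair_sigma_finite "\<sigma> \<Otimes>\<^sub>M \<tau>" "lborel :: (real \<times> real) measure" ..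
  have meas: "borel_measurable (\<sigma> \<Otimes>\<^sub>M \<tau>) = borel_measurable (borel \<Otimes>\<^sub>M borel)"
    by (rule measurable_pair_borel_prob[OF assms])
  have "(\<integral>\<^sup>+u. gauss_pot t \<sigma> u * gauss_pot t \<tau> u \<partial>lborel)
    = (\<integral>\<^sup>+u. \<integral>\<^sup>+p. ennreal (gauss t u (fst p)) * ennreal (gauss t u (snd p)) \<partial>(\<sigma> \<Otimes>\<^sub>M \<tau>) \<partial>lborel)"
  proof (rule nn_integral_cong)
    fix u
    have m: "(\<lambda>x. ennreal (gauss t u x)) \<in> borel_measurable \<sigma>" "(\<lambda>x. ennreal (gauss t u x)) \<in> borel_measurable \<tau>"
      using \<sigma> \<tau> by (auto cong: measurable_cong_sets)
    have "(\<lambda>p. ennreal (gauss t u (fst p)) * ennreal (gauss t u (snd p))) \<in> borel_measurable (\<sigma> \<Otimes>\<^sub>M \<tau>)"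
      unfolding meas by measurable
    from T.nn_integral_fst[OF this] m
    show "gauss_pot t \<sigma> u * gauss_pot t \<tau> u
      = (\<integral>\<^sup>+p. ennreal (gauss t u (fst p)) * ennreal (gauss t u (snd p)) \<partial>(\<sigma> \<Otimes>\<^sub>M \<tau>))"
      by (simp add: gauss_pot_def nn_integral_cmult nn_integral_multc)
  qed
  also have "\<dots> = (\<integral>\<^sup>+p. \<integral>\<^sup>+u. ennreal (gauss t u (fst p)) * ennreal (gauss t u (snd p)) \<partial>lborel \<partial>(\<sigma> \<Otimes>\<^sub>M \<tau>))"
  proof (rule STL.Fubini')
    have "(\<lambda>q. ennreal (gauss t (snd q) (fst (fst q))) * ennreal (gauss t (snd q) (snd (fst q))))
      \<in> borel_measurable ((borel \<Otimes>\<^sub>M borel) \<Otimes>\<^sub>M borel)"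
      by measurable
    then show "(\<lambda>(p, u). ennreal (gauss t u (fst p)) * ennreal (gauss t u (snd p)))
      \<in> borel_measurable ((\<sigma> \<Otimes>\<^sub>M \<tau>) \<Otimes>\<^sub>M lborel)"
      unfolding split_beta
      by (subst measurable_cong_sets[OF sets_pair_measure_cong[OF sets_pair_borel[OF assms] sets_lborel] refl])
  qed
  also have "\<dots> = (\<integral>\<^sup>+p. ennreal (exp (- t * (cmod (fst p - snd p))\<^sup>2)) * gauss_mass t \<partial>(\<sigma> \<Otimes>\<^sub>M \<tau>))"
    by (simp add: gauss_overlap)
  also have "\<dots> = gauss_energy t \<sigma> \<tau> * gauss_mass t"
    unfolding gauss_energy_def by (rule nn_integral_multc) (unfold meas, measurable)
  finally show ?thesis by simp
qed

lemma AE_pair_prob_on: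
  assumes "prob_on S \<sigma>" "prob_on T \<tau>"
  shows "AE p in \<sigma> \<Otimes>\<^sub>M \<tau>. fst p \<in> S \<and> snd p \<in> T"
proof -
  note \<sigma> = prob_onD[OF assms(1)] and \<tau> = prob_onD[OF assms(2)]
  interpret S: prob_space \<sigma> by fact
  interpret T: prob_space \<tau> by fact
  interpret ST: pair_prob_space \<sigma> \<tau> by (rule pair_prob_space_borel_prob) fact+
  obtain N1 where N1: "N1 \<in> null_sets \<sigma>" "{z \<in> space \<sigma>. z \<notin> S} \<subseteq> N1"
    using \<sigma>(5) by (elim AE_E) (blast intro: null_setsI)
  obtain N2 where N2: "N2 \<in> null_sets \<tau>" "{z \<in> space \<tau>. z \<notin> T} \<subseteq> N2"
    using \<tau>(5) by (elim AE_E) (blast intro: null_setsI)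
  have "N1 \<times> space \<tau> \<in> null_sets (\<sigma> \<Otimes>\<^sub>M \<tau>)" "space \<sigma> \<times> N2 \<in> null_sets (\<sigma> \<Otimes>\<^sub>M \<tau>)"
    using N1(1) N2(1) by (auto simp: null_sets_def T.emeasure_pair_measure_Times)
  then have "N1 \<times> space \<tau> \<union> space \<sigma> \<times> N2 \<in> null_sets (\<sigma> \<Otimes>\<^sub>M \<tau>)" by auto
  then show ?thesis
    by (rule AE_I') (use N1(2) N2(2) in \<open>auto simp: space_pair_measure\<close>)
qed

lemma gauss_energy_bounds:
  assumes "prob_on (cball 0 (D/2)) \<sigma>" "prob_on (cball 0 (D/2)) \<tau>" "t \<ge> 0"
  shows "ennreal (exp (- t * D\<^sup>2)) \<le> gauss_energy t \<sigma> \<tau>" "gauss_energy t \<sigma> \<tau> \<le> 1"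
proof -
  note bp = prob_onD(1)[OF assms(1)] prob_onD(1)[OF assms(2)]
  interpret ST: pair_prob_space \<sigma> \<tau> by (rule pair_prob_space_borel_prob[OF bp])
  have "ennreal (exp (- t * D\<^sup>2)) = (\<integral>\<^sup>+p. ennreal (exp (- t * D\<^sup>2)) \<partial>(\<sigma> \<Otimes>\<^sub>M \<tau>))"
    by (simp add: ST.emeasure_space_1)
  also have "\<dots> \<le> gauss_energy t \<sigma> \<tau>"
    unfolding gauss_energy_def
  proof (rule nn_integral_mono_AE)
    show "AE p in \<sigma> \<Otimes>\<^sub>M \<tau>. ennreal (exp (- t * D\<^sup>2)) \<le> ennreal (exp (- t * (cmod (fst p - snd p))\<^sup>2))"
      using AE_pair_prob_on[OF assms(1,2)]
    proof eventually_elim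
      case (elim p)
      then have "cmod (fst p - snd p) \<le> D"
        using norm_triangle_ineq4[of "fst p" "snd p"] by auto
      then show ?case using assms(3) by (auto intro!: ennreal_leI mult_left_mono power_mono)
    qed
  qed
  finally show "ennreal (exp (- t * D\<^sup>2)) \<le> gauss_energy t \<sigma> \<tau>" .
  have "gauss_energy t \<sigma> \<tau> \<le> (\<integral>\<^sup>+p. 1 \<partial>(\<sigma> \<Otimes>\<^sub>M \<tau>))"
    unfolding gauss_energy_def using assms(3) by (intro nn_integral_mono) (auto simp: mult_nonneg_nonneg)
  then show "gauss_energy t \<sigma> \<tau> \<le> 1" by (simp add: ST.emeasure_space_1)
qed

lemma neg_energy_gauss_mix:
  assumes "D > 0" "prob_on (cball 0 (D/2)) \<sigma>" "prob_on (cball 0 (D/2)) \<tau>"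
  shows "neg_energy D \<sigma> \<tau> = (\<integral>\<^sup>+t. gauss_mix_weight t * (gauss_energy t \<sigma> \<tau> - ennreal (exp (- t * D\<^sup>2))) \<partial>lborel)"
proof -
  note bp = prob_onD(1)[OF assms(2)] prob_onD(1)[OF assms(3)]
  interpret ST: pair_prob_space \<sigma> \<tau> by (rule pair_prob_space_borel_prob[OF bp])
  interpret STL: pair_sigma_finite "\<sigma> \<Otimes>\<^sub>M \<tau>" "lborel :: real measure" ..
  have meas: "borel_measurable (\<sigma> \<Otimes>\<^sub>M \<tau>) = borel_measurable (borel \<Otimes>\<^sub>M borel)"
    by (rule measurable_pair_borel_prob[OF bp])
  let ?g = "\<lambda>p t. gauss_mix_weight t * ennreal (exp (- t * (cmod (fst p - snd p))\<^sup>2) - exp (- t * D\<^sup>2))"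
  have "neg_energy D \<sigma> \<tau> = (\<integral>\<^sup>+p. \<integral>\<^sup>+t. ?g p t \<partial>lborel \<partial>(\<sigma> \<Otimes>\<^sub>M \<tau>))"
    unfolding neg_energy_def using log_kernel_gauss_mix[OF assms(1)] by simp
  also have "\<dots> = (\<integral>\<^sup>+t. \<integral>\<^sup>+p. ?g p t \<partial>(\<sigma> \<Otimes>\<^sub>M \<tau>) \<partial>lborel)"
  proof (rule STL.Fubini'[symmetric])
    have "(\<lambda>q. ?g (fst q) (snd q)) \<in> borel_measurable ((borel \<Otimes>\<^sub>M borel) \<Otimes>\<^sub>M borel)"
      by measurable
    then show "(\<lambda>(p, t). ?g p t) \<in> borel_measurable ((\<sigma> \<Otimes>\<^sub>M \<tau>) \<Otimes>\<^sub>M lborel)"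
      unfolding split_beta
      by (subst measurable_cong_sets[OF sets_pair_measure_cong[OF sets_pair_borel[OF bp] sets_lborel] refl])
  qed
  also have "\<dots> = (\<integral>\<^sup>+t. gauss_mix_weight t * (gauss_energy t \<sigma> \<tau> - ennreal (exp (- t * D\<^sup>2))) \<partial>lborel)"
  proof (rule nn_integral_cong)
    fix t :: real
    show "(\<integral>\<^sup>+p. ?g p t \<partial>(\<sigma> \<Otimes>\<^sub>M \<tau>)) = gauss_mix_weight t * (gauss_energy t \<sigma> \<tau> - ennreal (exp (- t * D\<^sup>2)))"
    proof (cases "t > 0")
      case True
      have "(\<integral>\<^sup>+p. ?g p t \<partial>(\<sigma> \<Otimes>\<^sub>M \<tau>))
        = gauss_mix_weight t * (\<integral>\<^sup>+p. ennreal (exp (- t * (cmod (fst p - snd p))\<^sup>2)) - ennreal (exp (- t * D\<^sup>2)) \<partial>(\<sigma> \<Otimes>\<^sub>M \<tau>))"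
        by (subst nn_integral_cmult[symmetric]) (auto simp: ennreal_minus meas)
      also have "(\<integral>\<^sup>+p. ennreal (exp (- t * (cmod (fst p - snd p))\<^sup>2)) - ennreal (exp (- t * D\<^sup>2)) \<partial>(\<sigma> \<Otimes>\<^sub>M \<tau>))
        = gauss_energy t \<sigma> \<tau> - (\<integral>\<^sup>+p. ennreal (exp (- t * D\<^sup>2)) \<partial>(\<sigma> \<Otimes>\<^sub>M \<tau>))"
        unfolding gauss_energy_def
      proof (rule nn_integral_diff)
        show "AE p in \<sigma> \<Otimes>\<^sub>M \<tau>. ennreal (exp (- t * D\<^sup>2)) \<le> ennreal (exp (- t * (cmod (fst p - snd p))\<^sup>2))"
          using AE_pair_prob_on[OF assms(2,3)]
        proof eventually_elim
          case (elim p)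
          then have "cmod (fst p - snd p) \<le> D"
            using norm_triangle_ineq4[of "fst p" "snd p"] by auto
          then show ?case using True by (auto intro!: ennreal_leI mult_left_mono power_mono)
        qed
      qed (auto simp: meas ST.emeasure_space_1)
      finally show ?thesis by (simp add: ST.emeasure_space_1)
    qed (simp add: gauss_mix_weight_def)
  qed
  finally show ?thesis .
qed

section \<open>Positive definiteness and semicontinuity of the energy\<close>

lemma gauss_energy_measurable:
  assumes "borel_prob \<sigma>" "borel_prob \<tau>"
  shows "(\<lambda>t. gauss_energy t \<sigma> \<tau>) \<in> borel_measurable borel"
proof -
  interpret ST: pair_prob_space \<sigma> \<tau> by (rule pair_prob_space_borel_prob[OF assms])
  have "(\<lambda>q. ennreal (exp (- fst q * (cmod (fst (snd q) - snd (snd q)))\<^sup>2))) \<in> borel_measurable (borel \<Otimes>\<^sub>M (borel \<Otimes>\<^sub>M borel))"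
    by measurable
  then have "(\<lambda>(t, p). ennreal (exp (- t * (cmod (fst p - snd p))\<^sup>2))) \<in> borel_measurable (borel \<Otimes>\<^sub>M (\<sigma> \<Otimes>\<^sub>M \<tau>))"
    unfolding split_beta
    by (subst measurable_cong_sets[OF sets_pair_measure_cong[OF refl sets_pair_borel[OF assms]] refl])
  then show ?thesis
    unfolding gauss_energy_def by (rule ST.borel_measurable_nn_integral)
qed

lemma gauss_pot_le_1:
  assumes "borel_prob \<sigma>" "t \<ge> 0"
  shows "gauss_pot t \<sigma> u \<le> 1"
proof -
  interpret prob_space \<sigma> using assms borel_prob_simps by auto
  have "gauss_pot t \<sigma> u \<le> (\<integral>\<^sup>+x. 1 \<partial>\<sigma>)"
    unfolding gauss_pot_def using gauss_bounds(1)[OF assms(2)] by (intro nn_integral_mono) auto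
  then show ?thesis by (simp add: emeasure_space_1)
qed

lemma ennreal_amgm:
  fixes p q :: ennreal
  assumes "p \<le> 1" "q \<le> 1"
  shows "2 * (p * q) \<le> p * p + q * q" "p * p + q * q \<le> 2 * (p * q) \<Longrightarrow> p = q"
proof -
  obtain a where a: "p = ennreal a" "a \<ge> 0" using assms(1) by (cases p) (auto simp: top_unique)
  obtain b where b: "q = ennreal b" "b \<ge> 0" using assms(2) by (cases q) (auto simp: top_unique)
  have l: "2 * (p * q) = ennreal (2 * (a * b))"
    using a b by (simp add: ennreal_mult flip: ennreal_numeral)
  have r: "p * p + q * q = ennreal (a * a + b * b)"
    using a b by (simp add: ennreal_mult ennreal_plus)
  have sq: "0 \<le> (a - b) * (a - b)" by simp
  show "2 * (p * q) \<le> p * p + q * q"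
    unfolding l r using sq by (intro ennreal_leI) (simp add: algebra_simps)
  assume "p * p + q * q \<le> 2 * (p * q)"
  then have "a * a + b * b \<le> 2 * (a * b)"
    unfolding l r using a b by (subst (asm) ennreal_le_iff) auto
  then have "(a - b) * (a - b) \<le> 0" by (simp add: algebra_simps)
  then have "a = b" using sq by simp
  then show "p = q" using a b by simp
qed

text \<open>The inequality of arithmetic and geometric means, applied pointwise to the two potentials.\<close>
lemma gauss_energy_pos_def:
  assumes "borel_prob \<sigma>" "borel_prob \<tau>" "t > 0"
  shows "2 * gauss_energy t \<sigma> \<tau> \<le> gauss_energy t \<sigma> \<sigma> + gauss_energy t \<tau> \<tau>"
proof -
  note [measurable] = gauss_pot_measurable[OF assms(1)] gauss_pot_measurable[OF assms(2)]
  have "gauss_mass t * (2 * gauss_energy t \<sigma> \<tau>) = (\<integral>\<^sup>+u. 2 * (gauss_pot t \<sigma> u * gauss_pot t \<tau> u) \<partial>lborel)"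
    using gauss_energy_pot[OF assms(1,2), of t, symmetric]
    by (subst nn_integral_cmult) (auto simp: mult_ac)
  also have "\<dots> \<le> (\<integral>\<^sup>+u. gauss_pot t \<sigma> u * gauss_pot t \<sigma> u + gauss_pot t \<tau> u * gauss_pot t \<tau> u \<partial>lborel)"
    using assms by (intro nn_integral_mono ennreal_amgm gauss_pot_le_1) auto
  also have "\<dots> = gauss_mass t * (gauss_energy t \<sigma> \<sigma> + gauss_energy t \<tau> \<tau>)"
    using gauss_energy_pot[OF assms(1,1), of t] gauss_energy_pot[OF assms(2,2), of t]
    by (simp add: nn_integral_add distrib_left mult_ac)
  finally show ?thesis
    using gauss_mass_bounds[OF assms(3)] by (simp add: ennreal_mult_le_mult_iff)
qed

text \<open>The constants \<open>exp(-t D\<^sup>2)\<close> of the kernel representation cancel because all measures have mass 1.\<close>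
lemma ennreal_diff_pos_def:
  fixes k k1 k2 q :: ennreal
  assumes "2 * k \<le> k1 + k2" "q \<le> k" "q \<le> k1" "q \<le> k2" "q < \<infinity>"
  shows "2 * (k - q) \<le> (k1 - q) + (k2 - q)"
    and "(k1 - q) + (k2 - q) \<le> 2 * (k - q) \<Longrightarrow> k1 + k2 \<le> 2 * k"
proof -
  have eq: "2 * k = 2 * (k - q) + 2 * q" "k1 + k2 = ((k1 - q) + (k2 - q)) + 2 * q"
  proof -
    have "k = (k - q) + q" "k1 = (k1 - q) + q" "k2 = (k2 - q) + q"
      using assms by (simp_all add: diff_add_cancel_ennreal)
    then have "2 * k = 2 * ((k - q) + q)" "k1 + k2 = ((k1 - q) + q) + ((k2 - q) + q)"
      by metis+
    then show "2 * k = 2 * (k - q) + 2 * q" "k1 + k2 = ((k1 - q) + (k2 - q)) + 2 * q"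
      by (simp_all add: distrib_left mult_2 add_ac)
  qed
  have fin: "2 * q \<noteq> \<infinity>" using assms(5) by (simp add: ennreal_mult_eq_top_iff)
  show "2 * (k - q) \<le> (k1 - q) + (k2 - q)"
    using assms(1) fin unfolding eq by (simp add: add.commute[of _ "2 * q"] ennreal_add_left_cancel_le)
  assume "(k1 - q) + (k2 - q) \<le> 2 * (k - q)"
  then show "k1 + k2 \<le> 2 * k" unfolding eq by (rule add_right_mono)
qed

theorem neg_energy_pos_def:
  assumes "D > 0" "prob_on (cball 0 (D/2)) \<sigma>" "prob_on (cball 0 (D/2)) \<tau>"
  shows "2 * neg_energy D \<sigma> \<tau> \<le> neg_energy D \<sigma> \<sigma> + neg_energy D \<tau> \<tau>"
proof -
  note bp = prob_onD(1)[OF assms(2)] prob_onD(1)[OF assms(3)]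
  note [measurable] = gauss_energy_measurable[OF bp] gauss_energy_measurable[OF bp(1) bp(1)]
    gauss_energy_measurable[OF bp(2) bp(2)]
  let ?q = "\<lambda>t. ennreal (exp (- t * D\<^sup>2))"
  have "2 * neg_energy D \<sigma> \<tau> = (\<integral>\<^sup>+t. gauss_mix_weight t * (2 * (gauss_energy t \<sigma> \<tau> - ?q t)) \<partial>lborel)"
    unfolding neg_energy_gauss_mix[OF assms]
    by (subst nn_integral_cmult[symmetric]) (auto simp: mult_ac)
  also have "\<dots> \<le> (\<integral>\<^sup>+t. gauss_mix_weight t * (gauss_energy t \<sigma> \<sigma> - ?q t) + gauss_mix_weight t * (gauss_energy t \<tau> \<tau> - ?q t) \<partial>lborel)"
  proof (rule nn_integral_mono)
    fix t :: real
    show "gauss_mix_weight t * (2 * (gauss_energy t \<sigma> \<tau> - ?q t))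
      \<le> gauss_mix_weight t * (gauss_energy t \<sigma> \<sigma> - ?q t) + gauss_mix_weight t * (gauss_energy t \<tau> \<tau> - ?q t)"
    proof (cases "t > 0")
      case True
      then show ?thesis
        unfolding distrib_left[symmetric] using assms bp
        by (intro mult_left_mono ennreal_diff_pos_def gauss_energy_pos_def gauss_energy_bounds) auto
    qed (simp add: gauss_mix_weight_def)
  qed
  also have "\<dots> = neg_energy D \<sigma> \<sigma> + neg_energy D \<tau> \<tau>"
    unfolding neg_energy_gauss_mix[OF assms(1,2,2)] neg_energy_gauss_mix[OF assms(1,3,3)]
    by (rule nn_integral_add) measurable
  finally show ?thesis .
qed

lemma neg_energy_eq_gauss_energy:
  assumes "D > 0" "prob_on (cball 0 (D/2)) \<sigma>" "prob_on (cball 0 (D/2)) \<tau>"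
    and le: "neg_energy D \<sigma> \<sigma> + neg_energy D \<tau> \<tau> \<le> 2 * neg_energy D \<sigma> \<tau>"
    and fin: "neg_energy D \<sigma> \<sigma> < \<infinity>" "neg_energy D \<tau> \<tau> < \<infinity>"
  shows "AE t in lborel. t > 0 \<longrightarrow> gauss_energy t \<sigma> \<sigma> + gauss_energy t \<tau> \<tau> \<le> 2 * gauss_energy t \<sigma> \<tau>"
proof -
  note bp = prob_onD(1)[OF assms(2)] prob_onD(1)[OF assms(3)]
  note [measurable] = gauss_energy_measurable[OF bp] gauss_energy_measurable[OF bp(1) bp(1)]
    gauss_energy_measurable[OF bp(2) bp(2)]
  let ?q = "\<lambda>t. ennreal (exp (- t * D\<^sup>2))"
  let ?f = "\<lambda>t. gauss_mix_weight t * (2 * (gauss_energy t \<sigma> \<tau> - ?q t))"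
  let ?g = "\<lambda>t. gauss_mix_weight t * ((gauss_energy t \<sigma> \<sigma> - ?q t) + (gauss_energy t \<tau> \<tau> - ?q t))"
  have f: "integral\<^sup>N lborel ?f = 2 * neg_energy D \<sigma> \<tau>"
    unfolding neg_energy_gauss_mix[OF assms(1-3)]
    by (subst nn_integral_cmult[symmetric]) (auto simp: mult_ac)
  have g: "integral\<^sup>N lborel ?g = neg_energy D \<sigma> \<sigma> + neg_energy D \<tau> \<tau>"
    unfolding neg_energy_gauss_mix[OF assms(1,2,2)] neg_energy_gauss_mix[OF assms(1,3,3)] distrib_left
    by (rule nn_integral_add) measurable
  have pd: "t > 0 \<Longrightarrow> 2 * (gauss_energy t \<sigma> \<tau> - ?q t) \<le> (gauss_energy t \<sigma> \<sigma> - ?q t) + (gauss_energy t \<tau> \<tau> - ?q t)" for t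
    using assms bp by (intro ennreal_diff_pos_def gauss_energy_pos_def gauss_energy_bounds) auto
  have "AE t in lborel. ?g t \<le> ?f t"
  proof (rule ccontr)
    assume *: "\<not> ?thesis"
    have "integral\<^sup>N lborel ?f < integral\<^sup>N lborel ?g"
    proof (rule nn_integral_less)
      show "integral\<^sup>N lborel ?f \<noteq> \<infinity>"
      proof -
        have "neg_energy D \<sigma> \<sigma> + neg_energy D \<tau> \<tau> < \<infinity>"
          using fin by simp
        then show ?thesis
          unfolding f using order.strict_trans1[OF neg_energy_pos_def[OF assms(1-3)]] by (metis less_irrefl)
      qed
      show "AE t in lborel. ?f t \<le> ?g t"
      proof (rule AE_I2)
        fix t show "?f t \<le> ?g t"
        proof (cases "t > 0")
          case True then show ?thesis using pd by (intro mult_left_mono) auto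
        qed (simp add: gauss_mix_weight_def)
      qed
      show "\<not> (AE t in lborel. ?g t \<le> ?f t)" by (rule *)
    qed measurable
    then show False using le f g by simp
  qed
  then show ?thesis
  proof eventually_elim
    case (elim t)
    show ?case
    proof
      assume t: "t > 0"
      then have w: "gauss_mix_weight t \<noteq> 0" "gauss_mix_weight t \<noteq> \<infinity>"
        by (auto simp: gauss_mix_weight_def)
      have le2: "(gauss_energy t \<sigma> \<sigma> - ?q t) + (gauss_energy t \<tau> \<tau> - ?q t) \<le> 2 * (gauss_energy t \<sigma> \<tau> - ?q t)"
        using elim w by (simp add: ennreal_mult_le_mult_iff)
      have fin_q: "?q t < \<infinity>" by simp
      note bounds = gauss_energy_bounds(1)[OF _ _ less_imp_le[OF t], where D=D]
      show "gauss_energy t \<sigma> \<sigma> + gauss_energy t \<tau> \<tau> \<le> 2 * gauss_energy t \<sigma> \<tau>"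
        by (rule ennreal_diff_pos_def(2)[OF gauss_energy_pos_def[OF bp t] bounds[OF assms(2,3)]
              bounds[OF assms(2,2)] bounds[OF assms(3,3)] fin_q le2])
    qed
  qed
qed

text \<open>Equality in the inequality of arithmetic and geometric means holds only for equal potentials.\<close>
lemma gauss_energy_eq_pot:
  assumes "borel_prob \<sigma>" "borel_prob \<tau>" "t > 0"
    and le: "gauss_energy t \<sigma> \<sigma> + gauss_energy t \<tau> \<tau> \<le> 2 * gauss_energy t \<sigma> \<tau>"
    and fin: "gauss_energy t \<sigma> \<tau> < \<infinity>"
  shows "AE u in lborel. gauss_pot t \<sigma> u = gauss_pot t \<tau> u"
proof -
  note [measurable] = gauss_pot_measurable[OF assms(1)] gauss_pot_measurable[OF assms(2)]
  let ?f = "\<lambda>u. 2 * (gauss_pot t \<sigma> u * gauss_pot t \<tau> u)"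
  let ?g = "\<lambda>u. gauss_pot t \<sigma> u * gauss_pot t \<sigma> u + gauss_pot t \<tau> u * gauss_pot t \<tau> u"
  have f: "integral\<^sup>N lborel ?f = gauss_mass t * (2 * gauss_energy t \<sigma> \<tau>)"
    using gauss_energy_pot[OF assms(1,2), of t, symmetric]
    by (subst nn_integral_cmult) (auto simp: mult_ac)
  have g: "integral\<^sup>N lborel ?g = gauss_mass t * (gauss_energy t \<sigma> \<sigma> + gauss_energy t \<tau> \<tau>)"
    using gauss_energy_pot[OF assms(1,1), of t] gauss_energy_pot[OF assms(2,2), of t]
    by (simp add: nn_integral_add distrib_left mult_ac)
  have le1: "gauss_pot t \<sigma> u \<le> 1" "gauss_pot t \<tau> u \<le> 1" for u
    using assms gauss_pot_le_1 by auto
  have "AE u in lborel. ?g u \<le> ?f u"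
  proof (rule ccontr)
    assume *: "\<not> ?thesis"
    have "integral\<^sup>N lborel ?f < integral\<^sup>N lborel ?g"
    proof (rule nn_integral_less)
      show "integral\<^sup>N lborel ?f \<noteq> \<infinity>"
        using gauss_mass_bounds[OF assms(3)] fin unfolding f by (auto simp: ennreal_mult_eq_top_iff)
      show "AE u in lborel. ?f u \<le> ?g u" using ennreal_amgm(1)[OF le1] by auto
    qed (use * in auto)
    moreover have "integral\<^sup>N lborel ?g \<le> integral\<^sup>N lborel ?f"
      unfolding f g using le by (intro mult_left_mono) auto
    ultimately show False by simp
  qed
  then show ?thesis
    by eventually_elim (rule ennreal_amgm(2)[OF le1])
qed

text \<open>The integral of \<open>f\<close> against the convolution of \<open>\<sigma>\<close> with a Gaussian of width \<open>c\<close>, up to a constant.\<close>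
definition gauss_smooth :: "(complex \<Rightarrow> real) \<Rightarrow> real \<Rightarrow> complex measure \<Rightarrow> ennreal" where
  "gauss_smooth f c \<sigma> = (\<integral>\<^sup>+x. \<integral>\<^sup>+v. ennreal (f (x + of_real c * plane_point v)) * ennreal (gauss 1 v 0) \<partial>lborel \<partial>\<sigma>)"

text \<open>Substituting \<open>u = x + v / sqrt t\<close> shows that integrals against the potential of parameter \<open>t\<close> are
  smoothings of width \<open>1 / sqrt t\<close>.\<close>
lemma gauss_smooth_pot:
  assumes "borel_prob \<sigma>" "t > 0" and [measurable]: "f \<in> borel_measurable borel"
  shows "(\<integral>\<^sup>+u. ennreal (f (plane_point u)) * gauss_pot t \<sigma> u \<partial>lborel) = ennreal (1 / t) * gauss_smooth f (1 / sqrt t) \<sigma>"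
proof -
  note \<sigma> = borel_prob_simps[OF assms(1)]
  interpret prob_space \<sigma> by fact
  interpret SL: pair_sigma_finite \<sigma> "lborel :: (real \<times> real) measure" ..
  define c where "c = 1 / sqrt t"
  have c: "c > 0" "c\<^sup>2 = 1 / t" using assms by (auto simp: c_def power_one_over)
  have scale: "(\<integral>\<^sup>+u. ennreal (f (plane_point u)) * ennreal (gauss t u x) \<partial>lborel)
    = ennreal (1 / t) * (\<integral>\<^sup>+v. ennreal (f (x + of_real c * plane_point v)) * ennreal (gauss 1 v 0) \<partial>lborel)" for x
  proof -
    let ?F = "\<lambda>u. ennreal (f (plane_point u)) * ennreal (gauss t u x)"
    have [measurable]: "?F \<in> borel_measurable borel" by measurable
    have pt: "plane_point ((Re x, Im x) + c *\<^sub>R v) = x + of_real c * plane_point v" for v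
      by (simp add: plane_point_def complex_eq_iff)
    have g: "gauss t ((Re x, Im x) + c *\<^sub>R v) x = gauss 1 v 0" for v
      unfolding gauss_def pt using c assms(2) by (simp add: norm_mult power_mult_distrib)
    have "integral\<^sup>N lborel ?F = integral\<^sup>N (density (distr lborel borel (\<lambda>v. (Re x, Im x) + c *\<^sub>R v)) (\<lambda>_. ennreal (1/t))) ?F"
      using lborel_affine[of c "(Re x, Im x)"] c by (simp add: power2_eq_square)
    also have "\<dots> = ennreal (1/t) * (\<integral>\<^sup>+v. ?F ((Re x, Im x) + c *\<^sub>R v) \<partial>lborel)"
      by (simp add: nn_integral_density nn_integral_distr nn_integral_cmult)
    finally show ?thesis by (simp only: pt g)
  qed
  have "(\<integral>\<^sup>+u. ennreal (f (plane_point u)) * gauss_pot t \<sigma> u \<partial>lborel)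
    = (\<integral>\<^sup>+u. \<integral>\<^sup>+x. ennreal (f (plane_point u)) * ennreal (gauss t u x) \<partial>\<sigma> \<partial>lborel)"
    unfolding gauss_pot_def using \<sigma>
    by (intro nn_integral_cong nn_integral_cmult[symmetric]) (auto cong: measurable_cong_sets)
  also have "\<dots> = (\<integral>\<^sup>+x. \<integral>\<^sup>+u. ennreal (f (plane_point u)) * ennreal (gauss t u x) \<partial>lborel \<partial>\<sigma>)"
  proof (rule SL.Fubini')
    have "(\<lambda>q. ennreal (f (plane_point (snd q))) * ennreal (gauss t (snd q) (fst q))) \<in> borel_measurable (borel \<Otimes>\<^sub>M borel)"
      by measurable
    then show "(\<lambda>(x, u). ennreal (f (plane_point u)) * ennreal (gauss t u x)) \<in> borel_measurable (\<sigma> \<Otimes>\<^sub>M lborel)"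
      unfolding split_beta
      by (subst measurable_cong_sets[OF sets_pair_measure_cong[OF \<sigma>(2) sets_lborel] refl])
  qed
  also have "\<dots> = ennreal (1/t) * gauss_smooth f c \<sigma>"
    unfolding scale gauss_smooth_def
  proof (rule nn_integral_cmult)
    have "(\<lambda>q. ennreal (f (fst q + of_real c * plane_point (snd q))) * ennreal (gauss 1 (snd q) 0)) \<in> borel_measurable (borel \<Otimes>\<^sub>M borel)"
      by measurable
    then have "(\<lambda>(x, v). ennreal (f (x + of_real c * plane_point v)) * ennreal (gauss 1 v 0)) \<in> borel_measurable (\<sigma> \<Otimes>\<^sub>M lborel)"
      unfolding split_beta
      by (subst measurable_cong_sets[OF sets_pair_measure_cong[OF \<sigma>(2) sets_lborel] refl])
    then show "(\<lambda>x. \<integral>\<^sup>+v. ennreal (f (x + of_real c * plane_point v)) * ennreal (gauss 1 v 0) \<partial>lborel) \<in> borel_measurable \<sigma>"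
      by (rule lborel.borel_measurable_nn_integral)
  qed
  finally show ?thesis by (simp add: c_def)
qed

lemma gauss_smooth_tendsto:
  assumes "borel_prob \<sigma>" "test_fun f" "c \<longlonglongrightarrow> 0"
  shows "(\<lambda>k. gauss_smooth f (c k) \<sigma>) \<longlonglongrightarrow> (\<integral>\<^sup>+x. ennreal (f x) \<partial>\<sigma>) * gauss_mass (1/2)"
proof -
  note \<sigma> = borel_prob_simps[OF assms(1)]
  interpret prob_space \<sigma> by fact
  have [measurable]: "f \<in> borel_measurable borel" by (rule test_fun_measurable[OF assms(2)])
  have fm: "f \<in> borel_measurable \<sigma>" using \<sigma> by (auto cong: measurable_cong_sets)
  obtain B where B: "\<And>z. \<bar>f z\<bar> \<le> B" "B > 0" using test_fun_bounded[OF assms(2)] by blast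
  let ?h = "\<lambda>k q. ennreal (f (fst q + of_real (c k) * plane_point (snd q))) * ennreal (gauss 1 (snd q) 0)"
  have meas: "borel_measurable (\<sigma> \<Otimes>\<^sub>M (lborel :: (real \<times> real) measure)) = borel_measurable (borel \<Otimes>\<^sub>M borel)"
    by (rule measurable_cong_sets[OF sets_pair_measure_cong[OF \<sigma>(2) sets_lborel] refl])
  have mass: "(\<integral>\<^sup>+v. ennreal (gauss 1 v 0) \<partial>lborel) = gauss_mass (1/2)"
    by (simp add: gauss_mass_def gauss_def)
  have h: "?h k \<in> borel_measurable (\<sigma> \<Otimes>\<^sub>M lborel)" for k
    unfolding meas by measurable
  have "(\<lambda>k. \<integral>\<^sup>+q. ?h k q \<partial>(\<sigma> \<Otimes>\<^sub>M lborel)) \<longlonglongrightarrow> (\<integral>\<^sup>+q. ennreal (f (fst q)) * ennreal (gauss 1 (snd q) 0) \<partial>(\<sigma> \<Otimes>\<^sub>M lborel))"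
  proof (rule nn_integral_dominated_convergence[where w="\<lambda>q. ennreal B * ennreal (gauss 1 (snd q) 0)"])
    show "(\<lambda>q. ennreal (f (fst q)) * ennreal (gauss 1 (snd q) 0)) \<in> borel_measurable (\<sigma> \<Otimes>\<^sub>M lborel)"
      "(\<lambda>q. ennreal B * ennreal (gauss 1 (snd q) 0)) \<in> borel_measurable (\<sigma> \<Otimes>\<^sub>M lborel)"
      unfolding meas by measurable
    show "AE q in \<sigma> \<Otimes>\<^sub>M lborel. ?h k q \<le> ennreal B * ennreal (gauss 1 (snd q) 0)" for k
      using B(1) by (intro AE_I2 mult_right_mono ennreal_leI) (auto intro: order_trans[OF abs_ge_self])
    have "(\<lambda>q. ennreal B * ennreal (gauss 1 (snd q) 0)) \<in> borel_measurable (\<sigma> \<Otimes>\<^sub>M lborel)"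
      unfolding meas by measurable
    from lborel.nn_integral_fst[OF this]
    have "(\<integral>\<^sup>+q. ennreal B * ennreal (gauss 1 (snd q) 0) \<partial>(\<sigma> \<Otimes>\<^sub>M lborel)) = ennreal B * gauss_mass (1/2)"
      by (simp add: nn_integral_cmult mass emeasure_space_1)
    then show "(\<integral>\<^sup>+q. ennreal B * ennreal (gauss 1 (snd q) 0) \<partial>(\<sigma> \<Otimes>\<^sub>M lborel)) < \<infinity>"
      using gauss_mass_bounds(2)[of "1/2"] by (simp add: ennreal_mult_less_top)
    show "AE q in \<sigma> \<Otimes>\<^sub>M lborel. (\<lambda>k. ?h k q) \<longlonglongrightarrow> ennreal (f (fst q)) * ennreal (gauss 1 (snd q) 0)"
    proof (rule AE_I2)
      fix q :: "complex \<times> (real \<times> real)"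
      have "(\<lambda>k. fst q + of_real (c k) * plane_point (snd q)) \<longlonglongrightarrow> fst q + of_real 0 * plane_point (snd q)"
        by (intro tendsto_intros assms)
      then have "(\<lambda>k. f (fst q + of_real (c k) * plane_point (snd q))) \<longlonglongrightarrow> f (fst q)"
        using assms(2) by (auto simp: test_fun_def continuous_on_eq_continuous_at intro: isCont_tendsto_compose)
      then show "(\<lambda>k. ?h k q) \<longlonglongrightarrow> ennreal (f (fst q)) * ennreal (gauss 1 (snd q) 0)"
        by (intro tendsto_mult_ennreal tendsto_ennrealI tendsto_const) auto
    qed
  qed (rule h)
  moreover have "(\<integral>\<^sup>+q. ?h k q \<partial>(\<sigma> \<Otimes>\<^sub>M lborel)) = gauss_smooth f (c k) \<sigma>" for k
    unfolding gauss_smooth_def by (subst lborel.nn_integral_fst[OF h, symmetric]) simp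
  moreover have "(\<integral>\<^sup>+q. ennreal (f (fst q)) * ennreal (gauss 1 (snd q) 0) \<partial>(\<sigma> \<Otimes>\<^sub>M lborel)) = (\<integral>\<^sup>+x. ennreal (f x) \<partial>\<sigma>) * gauss_mass (1/2)"
  proof -
    have "(\<lambda>q. ennreal (f (fst q)) * ennreal (gauss 1 (snd q) 0)) \<in> borel_measurable (\<sigma> \<Otimes>\<^sub>M lborel)"
      unfolding meas by measurable
    from lborel.nn_integral_fst[OF this] show ?thesis
      using fm by (simp add: nn_integral_cmult nn_integral_multc mass)
  qed
  ultimately show ?thesis by simp
qed

text \<open>Equality in positive definiteness forces equality of the Gaussian potentials for almost every \<open>t\<close>.
  Along parameters that tend to infinity, the smoothed measures agree and converge to the measures themselves.\<close>
theorem neg_energy_eq_imp_eq: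
  assumes "D > 0" "prob_on (cball 0 (D/2)) \<sigma>" "prob_on (cball 0 (D/2)) \<tau>"
    and le: "neg_energy D \<sigma> \<sigma> + neg_energy D \<tau> \<tau> \<le> 2 * neg_energy D \<sigma> \<tau>"
    and fin: "neg_energy D \<sigma> \<sigma> < \<infinity>" "neg_energy D \<tau> \<tau> < \<infinity>"
  shows "\<sigma> = \<tau>"
proof -
  note bp = prob_onD(1)[OF assms(2)] prob_onD(1)[OF assms(3)]
  have ae: "AE t in lborel. t > 0 \<longrightarrow> gauss_energy t \<sigma> \<sigma> + gauss_energy t \<tau> \<tau> \<le> 2 * gauss_energy t \<sigma> \<tau>"
    by (rule neg_energy_eq_gauss_energy[OF assms])
  \<comment> \<open>A property of almost every \<open>t\<close> holds somewhere in every interval.\<close>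
  have "\<exists>t>real k + 1. gauss_energy t \<sigma> \<sigma> + gauss_energy t \<tau> \<tau> \<le> 2 * gauss_energy t \<sigma> \<tau>" for k
  proof (rule ccontr)
    assume *: "\<not> ?thesis"
    have "AE t in lborel. t \<notin> {real k + 1<..<real k + 2}"
      using ae by eventually_elim (use * in auto)
    then have "emeasure lborel {real k + 1<..<real k + 2} = 0"
      by (subst (asm) AE_iff_measurable[of "{real k + 1<..<real k + 2}"]) auto
    then show False by simp
  qed
  then obtain t where t: "\<And>k. t k > real k + 1"
      "\<And>k. gauss_energy (t k) \<sigma> \<sigma> + gauss_energy (t k) \<tau> \<tau> \<le> 2 * gauss_energy (t k) \<sigma> \<tau>"
    by metis
  have tpos: "t k > 0" for k using t(1)[of k] by linarith
  have pot: "AE u in lborel. gauss_pot (t k) \<sigma> u = gauss_pot (t k) \<tau> u" for k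
  proof (rule gauss_energy_eq_pot[OF bp tpos t(2)])
    have "gauss_energy (t k) \<sigma> \<tau> \<le> 1"
      using assms tpos[of k] by (intro gauss_energy_bounds) auto
    then show "gauss_energy (t k) \<sigma> \<tau> < \<infinity>" by (simp add: order_le_less_trans)
  qed
  have lim: "(\<lambda>k. 1 / sqrt (t k)) \<longlonglongrightarrow> 0"
  proof -
    have "filterlim t at_top sequentially"
      by (rule filterlim_at_top_mono[OF filterlim_real_sequentially]) (use t(1) in \<open>auto intro!: always_eventually less_imp_le order_less_trans[OF _ t(1)]\<close>)
    then have "filterlim (\<lambda>k. sqrt (t k)) at_top sequentially"
      by (rule filterlim_compose[OF sqrt_at_top])
    then show ?thesis
      using tendsto_inverse_0_at_top by (simp add: divide_inverse)
  qed
  show ?thesis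
  proof (rule borel_prob_eqI_test_fun[OF bp])
    fix f assume f: "test_fun f" "\<And>x. 0 \<le> f x"
    have fm: "f \<in> borel_measurable borel" by (rule test_fun_measurable[OF f(1)])
    have "gauss_smooth f (1 / sqrt (t k)) \<sigma> = gauss_smooth f (1 / sqrt (t k)) \<tau>" for k
    proof -
      have "(\<integral>\<^sup>+u. ennreal (f (plane_point u)) * gauss_pot (t k) \<sigma> u \<partial>lborel)
        = (\<integral>\<^sup>+u. ennreal (f (plane_point u)) * gauss_pot (t k) \<tau> u \<partial>lborel)"
        using pot[of k] by (intro nn_integral_cong_AE) (auto elim: eventually_mono)
      then show ?thesis
        using tpos[of k] unfolding gauss_smooth_pot[OF bp(1) tpos fm] gauss_smooth_pot[OF bp(2) tpos fm]
        by (subst (asm) ennreal_mult_cancel_left) auto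
    qed
    then have "(\<integral>\<^sup>+x. ennreal (f x) \<partial>\<sigma>) * gauss_mass (1/2) = (\<integral>\<^sup>+x. ennreal (f x) \<partial>\<tau>) * gauss_mass (1/2)"
      using gauss_smooth_tendsto[OF bp(1) f(1) lim] gauss_smooth_tendsto[OF bp(2) f(1) lim]
      by (simp add: LIMSEQ_unique)
    then have "(\<integral>\<^sup>+x. ennreal (f x) \<partial>\<sigma>) = (\<integral>\<^sup>+x. ennreal (f x) \<partial>\<tau>)"
      using gauss_mass_bounds[of "1/2"]
      by (auto simp: mult.commute[of _ "gauss_mass _"] ennreal_mult_cancel_left)
    then show "(LINT x|\<sigma>. f x) = (LINT x|\<tau>. f x)"
      using f fm borel_prob_simps[OF bp(1)] borel_prob_simps[OF bp(2)]
      by (subst (1 2) integral_eq_nn_integral) (auto cong: measurable_cong_sets)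
  qed
qed

lemma gauss_pot_tendsto:
  assumes "weak_star_conv \<sigma> \<nu>" "\<And>k. prob_on (cball 0 R) (\<sigma> k)" "borel_prob \<nu>"
  shows "(\<lambda>k. gauss_pot t (\<sigma> k) u) \<longlonglongrightarrow> gauss_pot t \<nu> u"
proof -
  have cont: "continuous_on UNIV (\<lambda>x. gauss t u x)"
    unfolding gauss_def[abs_def]
    by (intro continuous_on_exp continuous_on_mult continuous_on_power continuous_on_norm
        continuous_on_diff continuous_on_const continuous_on_id)
  have \<nu>: "prob_on (cball 0 R) \<nu>"
    by (rule prob_on_weak_limit[OF assms(1,2) closed_cball assms(3)])
  have "gauss_pot t \<tau> u = ennreal (LINT x|\<tau>. gauss t u x)" if "prob_on (cball 0 R) \<tau>" for \<tau>
    unfolding gauss_pot_def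
    by (rule nn_integral_eq_integral[OF cutoff_integral(2)[OF that cont] AE_I2[OF less_imp_le[OF gauss_bounds(2)]]])
  then show ?thesis
    using weak_star_conv_continuous[OF assms cont] assms(2) \<nu> by (simp add: tendsto_ennrealI)
qed

text \<open>The Gaussian potentials converge pointwise because Gaussians are continuous; Fatou's lemma is applied once in
  the plane and once for the mixture over \<open>t\<close>.\<close>
theorem neg_energy_lsc:
  assumes "weak_star_conv \<sigma> \<nu>" "\<And>k. prob_on (cball 0 (D/2)) (\<sigma> k)" "borel_prob \<nu>" "D > 0"
  shows "neg_energy D \<nu> \<nu> \<le> liminf (\<lambda>k. neg_energy D (\<sigma> k) (\<sigma> k))"
proof -
  have \<nu>: "prob_on (cball 0 (D/2)) \<nu>"
    by (rule prob_on_weak_limit[OF assms(1,2) closed_cball assms(3)])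
  note bp = prob_onD(1)[OF assms(2)]
  let ?q = "\<lambda>t. ennreal (exp (- t * D\<^sup>2))"
  have liminf_gauss: "gauss_energy t \<nu> \<nu> \<le> liminf (\<lambda>k. gauss_energy t (\<sigma> k) (\<sigma> k))" if t: "t > 0" for t
  proof -
    have repr: "gauss_energy t \<tau> \<tau> = (\<integral>\<^sup>+u. inverse (gauss_mass t) * (gauss_pot t \<tau> u * gauss_pot t \<tau> u) \<partial>lborel)"
      if "borel_prob \<tau>" for \<tau>
    proof -
      note [measurable] = gauss_pot_measurable[OF that]
      have "(\<integral>\<^sup>+u. inverse (gauss_mass t) * (gauss_pot t \<tau> u * gauss_pot t \<tau> u) \<partial>lborel)
        = inverse (gauss_mass t) * (gauss_mass t * gauss_energy t \<tau> \<tau>)"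
        using gauss_energy_pot[OF that that, of t] by (simp add: nn_integral_cmult mult_ac)
      also have "\<dots> = gauss_energy t \<tau> \<tau>"
        using gauss_mass_bounds[OF t] by (simp add: ennreal_inverse_mult mult.assoc[symmetric] ennreal_divide_times divide_ennreal_def[symmetric] mult.commute[of "inverse _"])
      finally show ?thesis by simp
    qed
    have "gauss_energy t \<nu> \<nu> = (\<integral>\<^sup>+u. liminf (\<lambda>k. inverse (gauss_mass t) * (gauss_pot t (\<sigma> k) u * gauss_pot t (\<sigma> k) u)) \<partial>lborel)"
      unfolding repr[OF assms(3)]
    proof (rule nn_integral_cong)
      fix u
      have fin: "gauss_pot t \<nu> u \<noteq> \<infinity>"
        using gauss_pot_le_1[OF assms(3), of t u] t by (auto simp: top_unique)
      have inv: "inverse (gauss_mass t) < \<infinity>"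
        using gauss_mass_bounds[OF t] by (simp add: less_top[symmetric])
      have "(\<lambda>k. gauss_pot t (\<sigma> k) u * gauss_pot t (\<sigma> k) u) \<longlonglongrightarrow> gauss_pot t \<nu> u * gauss_pot t \<nu> u"
        by (rule tendsto_mult_ennreal) (use fin gauss_pot_tendsto[OF assms(1-3)] in simp_all)
      from lim_imp_Liminf[OF _ ennreal_tendsto_cmult[OF _ this]] inv
      show "inverse (gauss_mass t) * (gauss_pot t \<nu> u * gauss_pot t \<nu> u) = liminf (\<lambda>k. inverse (gauss_mass t) * (gauss_pot t (\<sigma> k) u * gauss_pot t (\<sigma> k) u))"
        by simp
    qed
    also have "\<dots> \<le> liminf (\<lambda>k. \<integral>\<^sup>+u. inverse (gauss_mass t) * (gauss_pot t (\<sigma> k) u * gauss_pot t (\<sigma> k) u) \<partial>lborel)"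
    proof (rule nn_integral_liminf)
      fix k
      have "(\<lambda>u. inverse (gauss_mass t) * (gauss_pot t \<tau> u * gauss_pot t \<tau> u)) \<in> borel_measurable lborel"
        if "borel_prob \<tau>" for \<tau>
        using gauss_pot_measurable[OF that] by measurable
      from this[OF bp] show "(\<lambda>u. inverse (gauss_mass t) * (gauss_pot t (\<sigma> k) u * gauss_pot t (\<sigma> k) u)) \<in> borel_measurable lborel" .
    qed
    also have "\<dots> = liminf (\<lambda>k. gauss_energy t (\<sigma> k) (\<sigma> k))"
      by (intro arg_cong[of _ _ liminf] ext repr[OF bp, symmetric])
    finally show ?thesis .
  qed
  have "neg_energy D \<nu> \<nu> = (\<integral>\<^sup>+t. gauss_mix_weight t * (gauss_energy t \<nu> \<nu> - ?q t) \<partial>lborel)"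
    by (rule neg_energy_gauss_mix[OF assms(4) \<nu> \<nu>])
  also have "\<dots> \<le> (\<integral>\<^sup>+t. liminf (\<lambda>k. gauss_mix_weight t * (gauss_energy t (\<sigma> k) (\<sigma> k) - ?q t)) \<partial>lborel)"
  proof (rule nn_integral_mono)
    fix t :: real
    show "gauss_mix_weight t * (gauss_energy t \<nu> \<nu> - ?q t) \<le> liminf (\<lambda>k. gauss_mix_weight t * (gauss_energy t (\<sigma> k) (\<sigma> k) - ?q t))"
    proof (cases "t > 0")
      case True
      have w: "gauss_mix_weight t < \<infinity>" using True by (simp add: gauss_mix_weight_def)
      have "gauss_mix_weight t * (gauss_energy t \<nu> \<nu> - ?q t) \<le> gauss_mix_weight t * (liminf (\<lambda>k. gauss_energy t (\<sigma> k) (\<sigma> k)) - ?q t)"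
        by (intro mult_left_mono ennreal_minus_mono liminf_gauss True) auto
      also have "\<dots> = liminf (\<lambda>k. gauss_mix_weight t * (gauss_energy t (\<sigma> k) (\<sigma> k) - ?q t))"
      proof (rule Liminf_compose_continuous_mono[symmetric])
        have "continuous_on UNIV (\<lambda>x. x - ?q t)"
          unfolding continuous_on_def
          by (intro ballI tendsto_diff_ennreal_general tendsto_ident_at tendsto_const) simp
        then show "continuous_on UNIV (\<lambda>x. gauss_mix_weight t * (x - ?q t))"
          using w by (intro ennreal_continuous_on_cmult) auto
        show "mono (\<lambda>x. gauss_mix_weight t * (x - ?q t))"
          by (intro monoI mult_left_mono ennreal_minus_mono) auto
      qed simp
      finally show ?thesis .
    qed (simp add: gauss_mix_weight_def)
  qed
  also have "\<dots> \<le> liminf (\<lambda>k. \<integral>\<^sup>+t. gauss_mix_weight t * (gauss_energy t (\<sigma> k) (\<sigma> k) - ?q t) \<partial>lborel)"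
  proof (rule nn_integral_liminf)
    fix k
    have "(\<lambda>t. gauss_mix_weight t * (gauss_energy t \<tau> \<tau> - ?q t)) \<in> borel_measurable lborel"
      if "borel_prob \<tau>" for \<tau>
      using gauss_energy_measurable[OF that that] by measurable
    from this[OF bp] show "(\<lambda>t. gauss_mix_weight t * (gauss_energy t (\<sigma> k) (\<sigma> k) - ?q t)) \<in> borel_measurable lborel" .
  qed
  also have "\<dots> = liminf (\<lambda>k. neg_energy D (\<sigma> k) (\<sigma> k))"
    by (intro arg_cong[of _ _ liminf] ext neg_energy_gauss_mix[OF assms(4) assms(2) assms(2), symmetric])
  finally show ?thesis .
qed

section \<open>Mixtures of measures\<close>

text \<open>The uniform mixture \<open>(\<sigma>\<^sub>0 + \<dots> + \<sigma>\<^sub>n\<^sub>-\<^sub>1) / n\<close>.\<close>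
definition mixture :: "nat \<Rightarrow> (nat \<Rightarrow> complex measure) \<Rightarrow> complex measure" where
  "mixture n \<sigma> = measure_pmf (pmf_of_set {..<n}) \<bind> \<sigma>"

lemma mixture_kernel_measurable:
  assumes "\<And>i. borel_prob (\<sigma> i)"
  shows "\<sigma> \<in> measurable (measure_pmf p) (subprob_algebra borel)"
proof -
  have "\<sigma> i \<in> space (subprob_algebra borel)" for i
    using borel_prob_simps[OF assms[of i]]
    by (simp add: space_subprob_algebra prob_space_imp_subprob_space)
  then show ?thesis by simp
qed

lemma sets_mixture: "(\<And>i. borel_prob (\<sigma> i)) \<Longrightarrow> sets (mixture n \<sigma>) = sets borel"
  unfolding mixture_def by (rule sets_bind) (auto simp: borel_prob_simps)

lemma nn_integral_mixture:
  assumes "\<And>i. borel_prob (\<sigma> i)" "n > 0" "f \<in> borel_measurable borel"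
  shows "(\<integral>\<^sup>+z. f z \<partial>mixture n \<sigma>) = (\<Sum>i<n. \<integral>\<^sup>+z. f z \<partial>\<sigma> i) / of_nat n"
proof -
  have "(\<integral>\<^sup>+z. f z \<partial>mixture n \<sigma>) = (\<integral>\<^sup>+i. \<integral>\<^sup>+z. f z \<partial>\<sigma> i \<partial>measure_pmf (pmf_of_set {..<n}))"
    unfolding mixture_def by (rule nn_integral_bind[OF assms(3) mixture_kernel_measurable[OF assms(1)]])
  also have "\<dots> = (\<Sum>i<n. \<integral>\<^sup>+z. f z \<partial>\<sigma> i) / of_nat n"
    using assms(2) by (subst nn_integral_pmf_of_set) (auto simp: lessThan_empty_iff ennreal_of_nat_eq_real_of_nat)
  finally show ?thesis .
qed

lemma borel_prob_mixture:
  assumes "\<And>i. borel_prob (\<sigma> i)" "n > 0"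
  shows "borel_prob (mixture n \<sigma>)"
proof -
  have "emeasure (mixture n \<sigma>) UNIV = (\<integral>\<^sup>+z. 1 \<partial>mixture n \<sigma>)"
    using sets_mixture[OF assms(1)] sets_eq_imp_space_eq[OF sets_mixture[OF assms(1)]] by simp
  also have "\<dots> = (\<Sum>i<n. \<integral>\<^sup>+z. 1 \<partial>\<sigma> i) / of_nat n"
    by (rule nn_integral_mixture[OF assms]) simp
  also have "\<dots> = of_nat n / of_nat n"
    using prob_space.emeasure_space_1[OF borel_prob_simps(1)[OF assms(1)]] by simp
  also have "\<dots> = (1 :: ennreal)"
    using assms(2) by (intro ennreal_divide_self) (auto simp: less_top[symmetric])
  finally show ?thesis
    using sets_mixture[OF assms(1)] sets_eq_imp_space_eq[OF sets_mixture[OF assms(1)]]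
    by (auto simp: borel_prob_def intro: prob_spaceI)
qed

text \<open>This form makes almost sure statements available for measures that are known through their integrals, such as
  mixtures.\<close>
lemma AE_iff_nn_integral:
  assumes "sets \<sigma> = sets borel" "S \<in> sets borel"
  shows "(AE z in \<sigma>. z \<in> S) \<longleftrightarrow> (\<integral>\<^sup>+z. indicator (- S) z \<partial>\<sigma>) = 0"
proof -
  have "space \<sigma> = UNIV" using sets_eq_imp_space_eq[OF assms(1)] by simp
  then show ?thesis
    using assms by (subst AE_iff_measurable[of "- S"]) (auto simp: Compl_eq_Diff_UNIV)
qed

lemma prob_on_mixture:
  assumes "\<And>i. prob_on S (\<sigma> i)" "n > 0" "S \<in> sets borel"
  shows "prob_on S (mixture n \<sigma>)"
proof -
  note bp = prob_onD(1)[OF assms(1)]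
  have "(\<integral>\<^sup>+z. indicator (- S) z \<partial>\<sigma> i) = 0" for i
    using prob_onD(5)[OF assms(1)] AE_iff_nn_integral[OF prob_onD(3)[OF assms(1)] assms(3)] by blast
  then have "(\<integral>\<^sup>+z. indicator (- S) z \<partial>mixture n \<sigma>) = 0"
    using assms by (subst nn_integral_mixture[OF bp assms(2)]) auto
  then show ?thesis
    using AE_iff_nn_integral[OF sets_mixture[OF bp] assms(3)] borel_prob_mixture[OF bp assms(2)]
    by (simp add: prob_on_def)
qed

lemma neg_energy_iterated:
  assumes "borel_prob \<sigma>" "borel_prob \<tau>"
  shows "neg_energy D \<sigma> \<tau> = (\<integral>\<^sup>+z. \<integral>\<^sup>+w. log_kernel D z w \<partial>\<tau> \<partial>\<sigma>)"
    and "neg_energy D \<sigma> \<tau> = (\<integral>\<^sup>+w. \<integral>\<^sup>+z. log_kernel D z w \<partial>\<sigma> \<partial>\<tau>)"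
proof -
  interpret ST: pair_prob_space \<sigma> \<tau> by (rule pair_prob_space_borel_prob[OF assms])
  have m: "(\<lambda>p. log_kernel D (fst p) (snd p)) \<in> borel_measurable (\<sigma> \<Otimes>\<^sub>M \<tau>)"
    unfolding measurable_pair_borel_prob[OF assms] by measurable
  show 1: "neg_energy D \<sigma> \<tau> = (\<integral>\<^sup>+z. \<integral>\<^sup>+w. log_kernel D z w \<partial>\<tau> \<partial>\<sigma>)"
    unfolding neg_energy_def using ST.M2.nn_integral_fst[OF m] by simp
  show "neg_energy D \<sigma> \<tau> = (\<integral>\<^sup>+w. \<integral>\<^sup>+z. log_kernel D z w \<partial>\<sigma> \<partial>\<tau>)"
    unfolding 1 using ST.Fubini'[of "log_kernel D"] m by (simp add: split_beta)
qed

lemma log_kernel_commute: "log_kernel D z w = log_kernel D w z"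
  by (auto simp: log_kernel_def norm_minus_commute)

lemma neg_energy_commute:
  assumes "borel_prob \<sigma>" "borel_prob \<tau>"
  shows "neg_energy D \<sigma> \<tau> = neg_energy D \<tau> \<sigma>"
  using neg_energy_iterated(1)[OF assms] neg_energy_iterated(2)[OF assms(2,1)]
  by (simp add: log_kernel_commute)

lemma log_potential_measurable:
  assumes "borel_prob \<tau>"
  shows "(\<lambda>z. \<integral>\<^sup>+w. log_kernel D z w \<partial>\<tau>) \<in> borel_measurable borel"
proof -
  interpret prob_space \<tau> using assms borel_prob_simps by auto
  have "(\<lambda>(z, w). log_kernel D z w) \<in> borel_measurable (borel \<Otimes>\<^sub>M borel)"
    unfolding split_beta by measurable
  then have "(\<lambda>(z, w). log_kernel D z w) \<in> borel_measurable (borel \<Otimes>\<^sub>M \<tau>)"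
    using borel_prob_simps[OF assms] by (subst measurable_cong_sets[OF sets_pair_measure_cong]) auto
  then show ?thesis by (rule borel_measurable_nn_integral)
qed

lemma neg_energy_mixture_left:
  assumes "\<And>i. borel_prob (\<sigma> i)" "borel_prob \<tau>" "n > 0"
  shows "neg_energy D (mixture n \<sigma>) \<tau> = (\<Sum>i<n. neg_energy D (\<sigma> i) \<tau>) / of_nat n"
  using nn_integral_mixture[OF assms(1,3) log_potential_measurable[OF assms(2)]]
  by (simp add: neg_energy_iterated(1) assms borel_prob_mixture)

lemma neg_energy_mixture_right:
  assumes "\<And>i. borel_prob (\<sigma> i)" "borel_prob \<tau>" "n > 0"
  shows "neg_energy D \<tau> (mixture n \<sigma>) = (\<Sum>i<n. neg_energy D \<tau> (\<sigma> i)) / of_nat n"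
  using neg_energy_mixture_left[OF assms]
  by (simp add: neg_energy_commute[OF assms(2)] neg_energy_commute[OF assms(2,1)] assms borel_prob_mixture)

section \<open>Energies of sets and equilibrium measures\<close>

text \<open>The positive part of \<open>c - y\<close> is on the left and its negative part on the right. Without a difference of the two, the
  identity can be integrated even when \<open>y\<close> is infinite.\<close>
lemma e2ennreal_const_minus:
  "e2ennreal (ereal c - enn2ereal y) + y + ennreal (- c) = e2ennreal (enn2ereal y - ereal c) + ennreal c"
proof (cases y)
  case (real r)
  then have "e2ennreal (ereal c - enn2ereal y) = ennreal (c - r)" "e2ennreal (enn2ereal y - ereal c) = ennreal (r - c)"
    by simp_all
  moreover have "ennreal (c - r) + ennreal r + ennreal (- c) = ennreal (r - c) + ennreal c"
  proof (cases "0 \<le> c")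
    case True
    then show ?thesis
      using real by (cases "c \<le> r") (auto simp: ennreal_neg simp flip: ennreal_plus)
  next
    case False
    then show ?thesis using real by (auto simp: ennreal_neg simp flip: ennreal_plus)
  qed
  ultimately show ?thesis using real by simp
qed simp

text \<open>The positive part of \<open>c - g\<close> is at most \<open>c\<close> and so has finite integral. Hence the difference of
  the integrals of the two parts is not of the form \<open>\<infinity> - \<infinity>\<close>.\<close>
lemma eintegral_const_minus:
  assumes "prob_space M" "g \<in> borel_measurable M" "AE x in M. f x = ereal c - enn2ereal (g x)"
  shows "eintegral M f = ereal c - enn2ereal (\<integral>\<^sup>+x. g x \<partial>M)"
proof -
  interpret prob_space M by fact
  note [measurable] = assms(2)
  let ?P = "\<integral>\<^sup>+x. e2ennreal (ereal c - enn2ereal (g x)) \<partial>M"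
  let ?N = "\<integral>\<^sup>+x. e2ennreal (enn2ereal (g x) - ereal c) \<partial>M"
  let ?G = "\<integral>\<^sup>+x. g x \<partial>M"
  have P: "(\<integral>\<^sup>+x. e2ennreal (f x) \<partial>M) = ?P"
    using assms(3) by (intro nn_integral_cong_AE) (auto elim: eventually_mono)
  have N: "(\<integral>\<^sup>+x. e2ennreal (- f x) \<partial>M) = ?N"
    using assms(3) by (intro nn_integral_cong_AE) (auto elim!: eventually_mono simp: ereal_minus_diff_eq)
  have "?P + ?G + ennreal (- c) = (\<integral>\<^sup>+x. e2ennreal (ereal c - enn2ereal (g x)) + g x + ennreal (- c) \<partial>M)"
    by (simp add: nn_integral_add emeasure_space_1)
  also have "\<dots> = (\<integral>\<^sup>+x. e2ennreal (enn2ereal (g x) - ereal c) + ennreal c \<partial>M)"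
    by (simp add: e2ennreal_const_minus)
  also have "\<dots> = ?N + ennreal c"
    by (simp add: nn_integral_add emeasure_space_1)
  finally have eq: "?P + ?G + ennreal (- c) = ?N + ennreal c" .
  have "?P \<le> (\<integral>\<^sup>+x. ennreal c \<partial>M)"
  proof (rule nn_integral_mono)
    fix x
    have "ereal c - enn2ereal (g x) \<le> ereal c"
      by (cases "g x") auto
    then show "e2ennreal (ereal c - enn2ereal (g x)) \<le> ennreal c"
      using e2ennreal_mono[of "ereal c - enn2ereal (g x)" "ereal c"] by simp
  qed
  then have "?P \<noteq> \<infinity>" by (auto simp: emeasure_space_1 top_unique)
  then obtain p where p: "?P = ennreal p" "p \<ge> 0" by (cases ?P) auto
  have "enn2ereal ?P - enn2ereal ?N = ereal c - enn2ereal ?G"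
  proof (cases ?G)
    case top
    then have "?N + ennreal c = \<infinity>" using eq by simp
    then have "?N = \<infinity>" by (simp add: ennreal_add_eq_top)
    then show ?thesis using top p by simp
  next
    case (real r)
    then have "?N \<noteq> \<infinity>" using eq p by (metis ennreal_add_eq_top ennreal_neq_top infinity_ennreal_def)
    then obtain s where s: "?N = ennreal s" "s \<ge> 0" by (cases ?N) auto
    have "p + r + max 0 (- c) = s + max 0 c"
      using eq unfolding p(1) real(2) s(1)
      using p(2) real(1) s(2) by (cases "0 \<le> c") (auto simp: ennreal_neg simp flip: ennreal_plus)
    then have "p - s = c - r" by (auto simp: max_def split: if_splits)
    then show ?thesis using p s real by simp
  qed
  then show ?thesis unfolding eintegral_def P N .
qed

lemma energy_eq_neg_energy:
  assumes "D > 0" "prob_on (cball 0 (D/2)) \<sigma>"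
  shows "energy \<sigma> = ereal (ln D) - enn2ereal (neg_energy D \<sigma> \<sigma>)"
proof -
  note \<sigma> = prob_onD[OF assms(2)]
  have m: "log_kernel D z \<in> borel_measurable \<sigma>" for z
    using \<sigma>(3) by (subst measurable_cong_sets[of \<sigma> borel]) auto
  have inner: "eintegral \<sigma> (\<lambda>w. log_ereal (cmod (z - w))) = ereal (ln D) - enn2ereal (\<integral>\<^sup>+w. log_kernel D z w \<partial>\<sigma>)"
    if z: "z \<in> cball 0 (D/2)" for z
  proof (rule eintegral_const_minus[OF \<sigma>(2) m])
    show "AE w in \<sigma>. log_ereal (cmod (z - w)) = ereal (ln D) - enn2ereal (log_kernel D z w)"
      using \<sigma>(5)
    proof eventually_elim
      case (elim w)
      show ?case
      proof (cases "z = w")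
        case False
        have "cmod (z - w) \<le> D"
          using z elim norm_triangle_ineq4[of z w] by auto
        then have "ln (D / cmod (z - w)) \<ge> 0" using False assms(1) by (intro ln_ge_zero) simp
        then show ?thesis
          using False assms(1) by (simp add: log_ereal_def log_kernel_def ln_div)
      qed (simp add: log_ereal_def log_kernel_def)
    qed
  qed
  have "energy \<sigma> = ereal (ln D) - enn2ereal (\<integral>\<^sup>+z. \<integral>\<^sup>+w. log_kernel D z w \<partial>\<sigma> \<partial>\<sigma>)"
    unfolding energy_def
  proof (rule eintegral_const_minus[OF \<sigma>(2)])
    show "(\<lambda>z. \<integral>\<^sup>+w. log_kernel D z w \<partial>\<sigma>) \<in> borel_measurable \<sigma>"
      using log_potential_measurable[OF \<sigma>(1)] \<sigma>(3) by (auto cong: measurable_cong_sets)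
    show "AE z in \<sigma>. eintegral \<sigma> (\<lambda>w. log_ereal (cmod (z - w))) = ereal (ln D) - enn2ereal (\<integral>\<^sup>+w. log_kernel D z w \<partial>\<sigma>)"
      using \<sigma>(5) by eventually_elim (rule inner)
  qed
  then show ?thesis by (simp add: neg_energy_iterated(1)[OF \<sigma>(1,1)])
qed

lemma energy_ge_iff:
  assumes "D > 0" "prob_on (cball 0 (D/2)) \<sigma>"
  shows "ereal c \<le> energy \<sigma> \<longleftrightarrow> c \<le> ln D \<and> neg_energy D \<sigma> \<sigma> \<le> ennreal (ln D - c)"
proof (cases "neg_energy D \<sigma> \<sigma>")
  case (real r)
  then show ?thesis
    unfolding energy_eq_neg_energy[OF assms] by (auto simp: ennreal_le_iff2)
next
  case top
  then show ?thesis
    unfolding energy_eq_neg_energy[OF assms] by (auto simp: top_unique)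
qed

lemma energy_le_log_diameter:
  assumes "D > 0" "prob_on (cball 0 (D/2)) \<sigma>"
  shows "energy \<sigma> \<le> ereal (ln D)"
  unfolding energy_eq_neg_energy[OF assms] by (cases "neg_energy D \<sigma> \<sigma>") auto

text \<open>Semicontinuity is stated through eventual lower bounds, since this is how it is applied to maximising
  sequences.\<close>
lemma energy_usc:
  assumes "weak_star_conv \<sigma> \<nu>" "\<And>k. prob_on (cball 0 R) (\<sigma> k)" "borel_prob \<nu>"
    "eventually (\<lambda>k. ereal c \<le> energy (\<sigma> k)) sequentially"
  shows "ereal c \<le> energy \<nu>"
proof -
  define D where "D = 2 * max R 1"
  have D: "D > 0" by (simp add: D_def)
  have on: "prob_on (cball 0 (D/2)) (\<sigma> k)" for k
    by (rule prob_on_mono[OF assms(2)]) (auto simp: D_def)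
  have \<nu>: "prob_on (cball 0 (D/2)) \<nu>"
    by (rule prob_on_weak_limit[OF assms(1) on closed_cball assms(3)])
  have ev: "eventually (\<lambda>k. c \<le> ln D \<and> neg_energy D (\<sigma> k) (\<sigma> k) \<le> ennreal (ln D - c)) sequentially"
    using assms(4) by eventually_elim (simp only: energy_ge_iff[OF D on])
  have cD: "c \<le> ln D"
    using eventually_happens'[OF _ ev] by simp
  have "neg_energy D \<nu> \<nu> \<le> liminf (\<lambda>k. neg_energy D (\<sigma> k) (\<sigma> k))"
    by (rule neg_energy_lsc[OF assms(1) on assms(3) D])
  also have "\<dots> \<le> limsup (\<lambda>k. neg_energy D (\<sigma> k) (\<sigma> k))"
    by (rule Liminf_le_Limsup) simp
  also have "\<dots> \<le> ennreal (ln D - c)"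
    by (rule Limsup_bounded) (use ev in \<open>eventually_elim, simp\<close>)
  finally show ?thesis
    using cD energy_ge_iff[OF D \<nu>] by simp
qed

lemma compact_in_half_ball:
  assumes "compact (S :: complex set)"
  obtains D where "D > 0" "S \<subseteq> cball 0 (D/2)"
proof -
  obtain B where "B > 0" "\<And>z. z \<in> S \<Longrightarrow> cmod z \<le> B"
    using compact_imp_bounded[OF assms] by (auto simp: bounded_pos)
  then have "S \<subseteq> cball 0 (2 * B / 2)" "2 * B > 0" by auto
  then show ?thesis using that by blast
qed

lemma set_energy_eq: "compact S \<Longrightarrow> set_energy S = Sup {energy \<sigma> | \<sigma>. prob_on S \<sigma>}"
proof -
  assume S: "compact S"
  have "borel_prob \<sigma> \<and> compact (msupport \<sigma>) \<and> msupport \<sigma> \<subseteq> S \<longleftrightarrow> prob_on S \<sigma>" for \<sigma>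
    unfolding prob_on_iff_msupport[OF compact_imp_closed[OF S]]
    using S closed_msupport[of \<sigma>] compact_Int_closed[OF S, of "msupport \<sigma>"] by (auto simp: Int_absorb1)
  then show ?thesis unfolding set_energy_def by simp
qed

lemma energy_le_set_energy: "compact S \<Longrightarrow> prob_on S \<sigma> \<Longrightarrow> energy \<sigma> \<le> set_energy S"
  unfolding set_energy_eq by (rule Sup_upper) auto

lemma set_energy_mono: "S \<subseteq> T \<Longrightarrow> set_energy S \<le> set_energy T"
  unfolding set_energy_def by (rule Sup_subset_mono) auto

lemma polar_iff: "polar S \<longleftrightarrow> set_energy S = -\<infinity>"
  unfolding polar_def log_capacity_def using exp_ereal.simps(2,3)
  by (cases "set_energy S") (auto simp del: exp_ereal.simps(2,3))

lemma set_energy_bounded: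
  assumes "compact S"
  shows "set_energy S < \<infinity>"
proof -
  obtain D where D: "D > 0" "S \<subseteq> cball 0 (D/2)" using compact_in_half_ball[OF assms] .
  have "set_energy S \<le> ereal (ln D)"
    unfolding set_energy_eq[OF assms]
    using energy_le_log_diameter[OF D(1)] prob_on_mono[OF _ D(2)] by (intro Sup_least) auto
  then show ?thesis by auto
qed

text \<open>A maximising sequence has a weak limit in \<open>S\<close>, to which upper semicontinuity applies.\<close>
lemma set_energy_attained:
  assumes "compact S" "\<not> polar S"
  obtains \<sigma> where "prob_on S \<sigma>" "energy \<sigma> = set_energy S"
proof -
  let ?E = "{energy \<sigma> | \<sigma>. prob_on S \<sigma>}"
  have ne: "?E \<noteq> {}"
  proof
    assume "?E = {}"
    then have "set_energy S = Sup {}" unfolding set_energy_eq[OF assms(1)] by (rule arg_cong)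
    then show False using assms(2) by (simp add: polar_iff bot_ereal_def)
  qed
  obtain R where R: "S \<subseteq> cball 0 R"
    using compact_in_half_ball[OF assms(1)] by metis
  obtain f :: "nat \<Rightarrow> ereal" where f: "incseq f" "range f \<subseteq> ?E" "Sup ?E = (SUP i. f i)"
    using Sup_countable_SUP[OF ne] by auto
  have "\<exists>\<sigma>. prob_on S \<sigma> \<and> energy \<sigma> = f k" for k
  proof -
    have "f k \<in> ?E" using f(2) by blast
    then obtain \<sigma> where "f k = energy \<sigma>" "prob_on S \<sigma>" by blast
    then show ?thesis by metis
  qed
  then obtain \<sigma> where \<sigma>: "\<And>k. prob_on S (\<sigma> k)" "\<And>k. energy (\<sigma> k) = f k" by metis
  have on: "prob_on (cball 0 R) (\<sigma> k)" for k by (rule prob_on_mono[OF \<sigma>(1) R])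
  obtain s \<nu> where s: "strict_mono s" "borel_prob \<nu>" "weak_star_conv (\<lambda>k. \<sigma> (s k)) \<nu>"
    using weak_star_compact[OF on] .
  have \<nu>: "prob_on S \<nu>"
    by (rule prob_on_weak_limit[OF s(3) \<sigma>(1) compact_imp_closed[OF assms(1)] s(2)])
  have "f \<longlonglongrightarrow> set_energy S"
    using LIMSEQ_SUP[OF f(1)] f(3) set_energy_eq[OF assms(1)] by simp
  then have lim: "(\<lambda>k. f (s k)) \<longlonglongrightarrow> set_energy S"
    using LIMSEQ_subseq_LIMSEQ[OF _ s(1)] by (simp add: comp_def)
  have "set_energy S \<le> energy \<nu>"
  proof (rule dense_le)
    fix y assume y: "y < set_energy S"
    show "y \<le> energy \<nu>"
    proof (cases y)
      case (real c)
      have "eventually (\<lambda>k. ereal c \<le> energy (\<sigma> (s k))) sequentially"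
        using order_tendstoD(1)[OF lim y] real \<sigma>(2) by (auto elim: eventually_mono)
      then show ?thesis
        using energy_usc[OF s(3) on s(2)] real by simp
    qed (use y in auto)
  qed
  then show ?thesis
    using that \<nu> energy_le_set_energy[OF assms(1) \<nu>] by auto
qed

text \<open>The midpoint of two maximisers has energy at most the maximum. So their mutual energy is at most the maximum as
  well, which is equality in positive definiteness.\<close>
lemma set_energy_max_unique:
  assumes "compact S" "\<not> polar S"
    "prob_on S \<sigma>" "energy \<sigma> = set_energy S" "prob_on S \<tau>" "energy \<tau> = set_energy S"
  shows "\<sigma> = \<tau>"
proof -
  obtain D where D: "D > 0" "S \<subseteq> cball 0 (D/2)" using compact_in_half_ball[OF assms(1)] .
  note on = prob_on_mono[OF _ D(2)]
  obtain c where c: "set_energy S = ereal c"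
    using assms(2) set_energy_bounded[OF assms(1)] by (cases "set_energy S") (auto simp: polar_iff)
  define e where "e = ln D - c"
  have e_eq: "neg_energy D \<rho> \<rho> = ennreal e \<and> e \<ge> 0" if "prob_on S \<rho>" "energy \<rho> = set_energy S" for \<rho>
    using that(2) unfolding energy_eq_neg_energy[OF D(1) on[OF that(1)]] c e_def
    by (cases "neg_energy D \<rho> \<rho>") (auto simp: algebra_simps)
  note bp = prob_onD(1)[OF assms(3)] prob_onD(1)[OF assms(5)]
  define pair where "pair i = (if i = 0 then \<sigma> else \<tau>)" for i :: nat
  have pair: "prob_on S (pair i)" for i using assms by (simp add: pair_def)
  have bpp: "borel_prob (pair i)" for i by (rule prob_onD(1)[OF pair])
  define m where "m = mixture 2 pair"
  have m: "prob_on S m"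
    unfolding m_def using assms(1) by (intro prob_on_mixture pair) (auto simp: borel_compact)
  have mid: "neg_energy D m m = ((neg_energy D \<sigma> \<sigma> + neg_energy D \<sigma> \<tau>) / 2 + (neg_energy D \<sigma> \<tau> + neg_energy D \<tau> \<tau>) / 2) / 2"
  proof -
    have "neg_energy D m m = (neg_energy D \<sigma> m + neg_energy D \<tau> m) / 2"
      using neg_energy_mixture_left[of pair m 2 D, OF bpp prob_onD(1)[OF m]]
      unfolding m_def[symmetric] by (simp add: pair_def lessThan_Suc numeral_2_eq_2 add.commute)
    moreover have "neg_energy D \<rho> m = (neg_energy D \<rho> \<sigma> + neg_energy D \<rho> \<tau>) / 2" if "borel_prob \<rho>" for \<rho>
      using neg_energy_mixture_right[of pair \<rho> 2 D, OF bpp that]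
      unfolding m_def[symmetric] by (simp add: pair_def lessThan_Suc numeral_2_eq_2 add.commute)
    ultimately show ?thesis
      using bp neg_energy_commute[OF bp, of D] by simp
  qed
  have e0: "e \<ge> 0" using e_eq[OF assms(3,4)] by simp
  \<comment> \<open>If the mutual energy were larger than the maximum, so would be the energy of the midpoint.\<close>
  have "ennreal e \<le> neg_energy D \<sigma> \<tau>"
  proof (rule ccontr)
    assume "\<not> ?thesis"
    then obtain x where x: "neg_energy D \<sigma> \<tau> = ennreal x" "x < e" "x \<ge> 0"
      using e0 by (cases "neg_energy D \<sigma> \<tau>") (auto simp: ennreal_le_iff not_le)
    have half: "ennreal a / 2 = ennreal (a / 2)" if "a \<ge> 0" for a
      using divide_ennreal[of a 2] that by simp
    have "neg_energy D m m = ennreal (((e + x) / 2 + (x + e) / 2) / 2)"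
      unfolding mid using x e0 e_eq[OF assms(3,4)] e_eq[OF assms(5,6)]
      by (simp add: half flip: ennreal_plus)
    then have "energy m = ereal (ln D - ((e + x) / 2 + (x + e) / 2) / 2)"
      unfolding energy_eq_neg_energy[OF D(1) on[OF m]] using x e0 by simp
    moreover have "energy m \<le> ereal c"
      using energy_le_set_energy[OF assms(1) m] c by simp
    ultimately have "ln D - ((e + x) / 2 + (x + e) / 2) / 2 \<le> c" by simp
    then have "ln D - (e + x) / 2 \<le> c" by (simp add: add.commute)
    then show False using x(2) by (simp add: e_def field_simps)
  qed
  then have "neg_energy D \<sigma> \<sigma> + neg_energy D \<tau> \<tau> \<le> 2 * neg_energy D \<sigma> \<tau>"
    using e_eq[OF assms(3,4)] e_eq[OF assms(5,6)] by (simp add: mult_2 add_mono)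
  then show ?thesis
    using e_eq[OF assms(3,4)] e_eq[OF assms(5,6)]
    by (intro neg_energy_eq_imp_eq[OF D(1) on[OF assms(3)] on[OF assms(5)]]) auto
qed

theorem equilibrium_measure_props:
  assumes "compact S" "\<not> polar S"
  shows "prob_on S (equilibrium_measure S)" "energy (equilibrium_measure S) = set_energy S"
    and "\<And>\<sigma>. prob_on S \<sigma> \<Longrightarrow> set_energy S \<le> energy \<sigma> \<Longrightarrow> \<sigma> = equilibrium_measure S"
proof -
  have closed: "closed S" by (rule compact_imp_closed[OF assms(1)])
  obtain \<sigma> where \<sigma>: "prob_on S \<sigma>" "energy \<sigma> = set_energy S"
    using set_energy_attained[OF assms] .
  have "equilibrium_measure S = \<sigma>"
    unfolding equilibrium_measure_def
  proof (rule the_equality)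
    show "borel_prob \<sigma> \<and> msupport \<sigma> \<subseteq> S \<and> energy \<sigma> = set_energy S"
      using \<sigma> by (simp add: prob_on_iff_msupport[OF closed])
    show "\<tau> = \<sigma>" if "borel_prob \<tau> \<and> msupport \<tau> \<subseteq> S \<and> energy \<tau> = set_energy S" for \<tau>
      using that \<sigma> by (intro set_energy_max_unique[OF assms]) (auto simp: prob_on_iff_msupport[OF closed])
  qed
  then show eq: "prob_on S (equilibrium_measure S)" "energy (equilibrium_measure S) = set_energy S"
    using \<sigma> by auto
  show "\<tau> = equilibrium_measure S" if "prob_on S \<tau>" "set_energy S \<le> energy \<tau>" for \<tau>
    using that eq energy_le_set_energy[OF assms(1) that(1)]
    by (intro set_energy_max_unique[OF assms]) auto
qed

section \<open>Measurable factorisations of a polynomial family\<close>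

lemma poly_root_exists:
  assumes "degree (p :: complex poly) > 0"
  obtains z where "poly p z = 0"
  using assms fundamental_theorem_of_algebra[of p] constant_degree[of p] by auto

text \<open>The coefficients of the quotient are computed from the top by Horner's recursion.\<close>
lemma coeff_synthetic_div_measurable:
  fixes q :: "'a \<Rightarrow> complex poly"
  assumes [measurable]: "\<And>i. (\<lambda>w. coeff (q w) i) \<in> borel_measurable M" "c \<in> borel_measurable M"
    and deg: "\<And>w. w \<in> space M \<Longrightarrow> degree (q w) = n"
  shows "(\<lambda>w. coeff (synthetic_div (q w) (c w)) i) \<in> borel_measurable M"
proof -
  have rec: "coeff (synthetic_div (q w) (c w)) i = coeff (q w) (Suc i) + c w * coeff (synthetic_div (q w) (c w)) (Suc i)" for w i
    using arg_cong[OF synthetic_div_correct[of "q w" "c w"], of "\<lambda>p. coeff p (Suc i)"] by simp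
  have "(\<lambda>w. coeff (synthetic_div (q w) (c w)) i) \<in> borel_measurable M" if "n \<le> i + k" for k i
    using that
  proof (induction k arbitrary: i)
    case 0
    have "coeff (synthetic_div (q w) (c w)) i = 0" if "w \<in> space M" for w
    proof (cases "n = 0")
      case True
      then have "synthetic_div (q w) (c w) = 0"
        using deg[OF that] by (simp add: synthetic_div_eq_0_iff)
      then show ?thesis by simp
    next
      case False
      then show ?thesis
        using 0 deg[OF that] by (intro coeff_eq_0) (simp add: degree_synthetic_div)
    qed
    then show ?case by (subst measurable_cong[of M _ "\<lambda>_. 0"]) auto
  next
    case (Suc k)
    have [measurable]: "(\<lambda>w. coeff (synthetic_div (q w) (c w)) (Suc i)) \<in> borel_measurable M"
      using Suc by auto
    show ?case by (subst rec) measurable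
  qed
  from this[of i n] show ?thesis by simp
qed

text \<open>A root is selected measurably as a first zero along a curve through the disc, and its linear factor is
  divided off.\<close>
lemma measurable_factorisation:
  fixes q :: "'a \<Rightarrow> complex poly"
  assumes "\<And>i. (\<lambda>w. coeff (q w) i) \<in> borel_measurable M"
    and "\<And>w. w \<in> space M \<Longrightarrow> degree (q w) = n" "\<And>w. w \<in> space M \<Longrightarrow> lead_coeff (q w) = 1"
    and "\<And>w z. w \<in> space M \<Longrightarrow> poly (q w) z = 0 \<Longrightarrow> z \<in> cball 0 R" "R > 0"
  shows "\<exists>r. (\<forall>i<n. r i \<in> borel_measurable M) \<and> (\<forall>w\<in>space M. q w = (\<Prod>i<n. [:- r i w, 1:]))"
  using assms(1-4)
proof (induction n arbitrary: q)
  case 0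
  have "q w = 1" if "w \<in> space M" for w
    using 0(2,3)[OF that] by (metis degree_eq_zeroE lead_coeff_pCons(2) one_pCons)
  then show ?case by simp
next
  case (Suc n)
  obtain h :: "real \<Rightarrow> complex" where h: "continuous_on UNIV h" "cball 0 R \<subseteq> h ` {0..1}"
    using curve_onto_disc[OF assms(5)] by blast
  note [measurable] = Suc.prems(1)
  obtain \<tau> where \<tau>: "\<tau> \<in> borel_measurable M" "\<And>w. w \<in> space M \<Longrightarrow> \<tau> w \<in> {0..1} \<and> poly (q w) (h (\<tau> w)) = 0"
  proof (rule measurable_zero_coding[of M "\<lambda>w. poly (q w)" h R])
    show "continuous_on UNIV (poly (q w))" for w by (intro continuous_intros)
    have "poly (q w) z = (\<Sum>i\<le>Suc n. coeff (q w) i * z ^ i)" if "w \<in> space M" for w z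
      using Suc.prems(2)[OF that] by (simp only: poly_altdef)
    then show "(\<lambda>w. poly (q w) z) \<in> borel_measurable M" for z
      by (subst measurable_cong[of M _ "\<lambda>w. \<Sum>i\<le>Suc n. coeff (q w) i * z ^ i"]) auto
    show "\<exists>z\<in>cball 0 R. poly (q w) z = 0" if w: "w \<in> space M" for w
    proof -
      obtain z where "poly (q w) z = 0"
        using poly_root_exists[of "q w"] Suc.prems(2)[OF w] by auto
      then show ?thesis using Suc.prems(4)[OF w] by blast
    qed
  qed (use h in auto)
  define c where "c w = h (\<tau> w)" for w
  have c_meas: "c \<in> borel_measurable M"
    unfolding c_def[abs_def] using measurable_compose[OF \<tau>(1) borel_measurable_continuous_onI[OF h(1)]] .
  define q' where "q' w = synthetic_div (q w) (c w)" for w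
  have split: "q w = [:- c w, 1:] * q' w" if "w \<in> space M" for w
    using synthetic_div_correct'[of "c w" "q w"] \<tau>(2)[OF that] by (simp add: q'_def c_def)
  have "\<exists>r. (\<forall>i<n. r i \<in> borel_measurable M) \<and> (\<forall>w\<in>space M. q' w = (\<Prod>i<n. [:- r i w, 1:]))"
  proof (rule Suc.IH)
    show "(\<lambda>w. coeff (q' w) i) \<in> borel_measurable M" for i
      unfolding q'_def by (rule coeff_synthetic_div_measurable[OF Suc.prems(1) c_meas Suc.prems(2)])
    fix w assume w: "w \<in> space M"
    show "degree (q' w) = n"
      using Suc.prems(2)[OF w] by (simp add: q'_def degree_synthetic_div)
    show "lead_coeff (q' w) = 1"
      using Suc.prems(3)[OF w] unfolding split[OF w] lead_coeff_mult by simp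
    show "z \<in> cball 0 R" if "poly (q' w) z = 0" for z
      using Suc.prems(4)[OF w, of z] that unfolding split[OF w] by simp
  qed
  then obtain r where r: "\<And>i. i < n \<Longrightarrow> r i \<in> borel_measurable M" "\<And>w. w \<in> space M \<Longrightarrow> q' w = (\<Prod>i<n. [:- r i w, 1:])"
    by blast
  show ?case
  proof (intro exI[of _ "\<lambda>i. if i = n then c else r i"] conjI allI impI ballI)
    show "(if i = n then c else r i) \<in> borel_measurable M" if "i < Suc n" for i
      using that r(1)[of i] c_meas by auto
    show "q w = (\<Prod>i<Suc n. [:- (if i = n then c else r i) w, 1:])" if "w \<in> space M" for w
      using split[OF that] r(2)[OF that] by (simp add: mult.commute)
  qed
qed

text \<open>The polynomial \<open>p - w\<close> is factorised measurably in \<open>w\<close>. The escape condition keeps the preimages of points of the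
  disc in the disc.\<close>
lemma measurable_preimages:
  fixes p :: "complex poly"
  assumes "degree p = n" "n \<ge> 1" "R > 0" "\<And>z. cmod z > R \<Longrightarrow> cmod (poly p z) > R"
  obtains r :: "nat \<Rightarrow> complex \<Rightarrow> complex"
  where "\<And>i. r i \<in> borel_measurable borel" "\<And>i w. r i w \<in> cball 0 R"
    "\<And>w. w \<in> cball 0 R \<Longrightarrow> p - [:w:] = smult (lead_coeff p) (\<Prod>i<n. [:- r i w, 1:])"
proof -
  have p0: "p \<noteq> 0" using assms by auto
  define N where "N = restrict_space (borel :: complex measure) (cball 0 R)"
  have spN: "space N = cball 0 R" by (simp add: N_def space_restrict_space)
  define a where "a = lead_coeff p"
  have a0: "a \<noteq> 0" using p0 by (simp add: a_def)
  define q where "q w = smult (1 / a) (p - [:w:])" for w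
  have degw: "degree (p - [:w:]) = n" for w
  proof -
    have "degree (p - [:w:]) = degree p"
      unfolding diff_conv_add_uminus using assms(1,2) by (intro degree_add_eq_left) auto
    then show ?thesis using assms(1) by simp
  qed
  have "\<exists>r. (\<forall>i<n. r i \<in> borel_measurable N) \<and> (\<forall>w\<in>space N. q w = (\<Prod>i<n. [:- r i w, 1:]))"
  proof (rule measurable_factorisation[where R=R])
    have "(\<lambda>w. coeff (q w) i) \<in> borel_measurable borel" for i
      unfolding q_def by (cases i) (auto simp: coeff_pCons)
    then show "(\<lambda>w. coeff (q w) i) \<in> borel_measurable N" for i
      unfolding N_def by (rule measurable_restrict_space1)
    show "degree (q w) = n" for w using degw a0 by (simp add: q_def)
    show "lead_coeff (q w) = 1" for w
      unfolding q_def lead_coeff_smult using degw[of w] a0 assms(1,2)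
      by (cases n) (auto simp: a_def coeff_pCons)
    show "z \<in> cball 0 R" if "w \<in> space N" "poly (q w) z = 0" for w z
    proof -
      have "poly p z = w" using that(2) a0 by (simp add: q_def)
      then have "\<not> cmod (poly p z) > R" using that(1) by (simp add: spN)
      then show ?thesis using assms(4)[of z] by force
    qed
  qed (rule assms(3))
  then obtain r where r: "\<And>i. i < n \<Longrightarrow> r i \<in> borel_measurable N"
      "\<And>w. w \<in> cball 0 R \<Longrightarrow> q w = (\<Prod>i<n. [:- r i w, 1:])"
    unfolding spN by blast
  \<comment> \<open>The value 0 elsewhere keeps the branches Borel on the whole plane and inside the disc.\<close>
  define r' where "r' i w = (if i < n \<and> w \<in> cball 0 R then r i w else 0)" for i w
  have "r' i \<in> borel_measurable borel" for i
  proof (cases "i < n")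
    case True
    then show ?thesis
      unfolding r'_def[abs_def] using r(1)[OF True] unfolding N_def
      by (simp, subst measurable_If_restrict_space_iff) (auto simp: cball_def)
  qed (simp add: r'_def[abs_def])
  moreover have fact: "p - [:w:] = smult a (\<Prod>i<n. [:- r' i w, 1:])" if "w \<in> cball 0 R" for w
  proof -
    have "p - [:w:] = smult a (q w)" using a0 by (simp add: q_def)
    also have "q w = (\<Prod>i<n. [:- r' i w, 1:])"
      unfolding r(2)[OF that] using that by (intro prod.cong) (auto simp: r'_def)
    finally show ?thesis .
  qed
  moreover have "r' i w \<in> cball 0 R" for i w
  proof (cases "i < n \<and> w \<in> cball 0 R")
    case True
    have "poly (p - [:w:]) (r' i w) = 0"
      using True fact[of w] by (auto simp: poly_prod prod_zero_iff)
    then have "poly p (r' i w) = w" by simp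
    then have "\<not> cmod (poly p (r' i w)) > R" using True by simp
    then show ?thesis using assms(4)[of "r' i w"] by force
  next
    case False
    then have "r' i w = 0" unfolding r'_def by (rule if_not_P)
    then show ?thesis using assms(3) by simp
  qed
  ultimately show ?thesis using that a_def by blast
qed

section \<open>Pulling measures back under a polynomial\<close>

text \<open>The functions \<open>r i\<close> are Borel branches of the inverse of \<open>p\<close>, with multiplicities. They parametrise
  the preimages only over the disc of radius \<open>R\<close>.\<close>
locale polynomial_pullback =
  fixes p :: "complex poly" and n :: nat and \<gamma> R :: real and r :: "nat \<Rightarrow> complex \<Rightarrow> complex"
  assumes degree_p: "degree p = n" and n_ge_2: "n \<ge> 2"
    and lead_p: "lead_coeff p = of_real \<gamma>" and lead_pos: "\<gamma> > 0" and R_pos: "R > 0"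
    and r_measurable: "\<And>i. r i \<in> borel_measurable borel"
    and r_ball: "\<And>i w. r i w \<in> cball 0 R"
    and preimages: "\<And>w. w \<in> cball 0 R \<Longrightarrow> p - [:w:] = smult (of_real \<gamma>) (\<Prod>i<n. [:- r i w, 1:])"
begin

definition pull :: "complex measure \<Rightarrow> complex measure" where
  "pull \<sigma> = mixture n (\<lambda>i. distr \<sigma> borel (r i))"

definition push :: "complex measure \<Rightarrow> complex measure" where
  "push \<sigma> = distr \<sigma> borel (poly p)"

abbreviation "D \<equiv> 2 * R"

text \<open>From \<open>|p(z) - w| = \<gamma> \<Prod> |z - r i w|\<close>: one kernel \<open>ln (D / \<cdot>)\<close> on the left against \<open>n\<close> kernels on the right
  leaves \<open>- ln \<gamma> - (n - 1) ln D\<close>.\<close>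
definition shift_const :: real where
  "shift_const = - ln \<gamma> - real (n - 1) * ln D"

lemma poly_p_measurable: "poly p \<in> borel_measurable borel"
  by (intro borel_measurable_continuous_onI continuous_intros)

lemma poly_r: "w \<in> cball 0 R \<Longrightarrow> i < n \<Longrightarrow> poly p (r i w) = w"
proof -
  assume w: "w \<in> cball 0 R" and i: "i < n"
  have "poly (p - [:w:]) (r i w) = 0"
    unfolding preimages[OF w] using i by (auto simp: poly_prod prod_zero_iff)
  then show ?thesis by simp
qed

lemma poly_diff: "w \<in> cball 0 R \<Longrightarrow> poly p z - w = of_real \<gamma> * (\<Prod>i<n. z - r i w)"
proof -
  assume w: "w \<in> cball 0 R"
  have "poly p z - w = poly (p - [:w:]) z" by simp
  also have "\<dots> = of_real \<gamma> * (\<Prod>i<n. z - r i w)"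
    unfolding preimages[OF w] by (simp add: poly_prod)
  finally show ?thesis .
qed

lemma prob_on_branch:
  assumes "prob_on S \<sigma>"
  shows "prob_on (cball 0 R) (distr \<sigma> borel (r i))"
  using prob_onD[OF assms] r_measurable[of i] r_ball
  by (intro prob_on_distr) (auto cong: measurable_cong_sets)

lemma prob_on_pull: "prob_on S \<sigma> \<Longrightarrow> prob_on (cball 0 R) (pull \<sigma>)"
  unfolding pull_def using n_ge_2 by (intro prob_on_mixture prob_on_branch) auto

lemma nn_integral_pull:
  assumes "prob_on S \<sigma>" "f \<in> borel_measurable borel"
  shows "(\<integral>\<^sup>+z. f z \<partial>pull \<sigma>) = (\<integral>\<^sup>+w. (\<Sum>i<n. f (r i w)) / of_nat n \<partial>\<sigma>)"
proof -
  have rm: "r i \<in> borel_measurable \<sigma>" for i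
    using r_measurable[of i] prob_onD(3)[OF assms(1)] by (auto cong: measurable_cong_sets)
  have fm: "(\<lambda>w. f (r i w)) \<in> borel_measurable \<sigma>" for i
    by (rule measurable_compose[OF rm assms(2)])
  have "(\<integral>\<^sup>+z. f z \<partial>pull \<sigma>) = (\<Sum>i<n. \<integral>\<^sup>+z. f z \<partial>distr \<sigma> borel (r i)) / of_nat n"
    unfolding pull_def using n_ge_2
    by (intro nn_integral_mixture prob_onD(1)[OF prob_on_branch[OF assms(1)]] assms) auto
  also have "\<dots> = (\<Sum>i<n. \<integral>\<^sup>+w. f (r i w) \<partial>\<sigma>) / of_nat n"
    using rm assms(2) by (simp add: nn_integral_distr)
  also have "\<dots> = (\<integral>\<^sup>+w. (\<Sum>i<n. f (r i w)) / of_nat n \<partial>\<sigma>)"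
    using fm by (simp add: nn_integral_divide nn_integral_sum)
  finally show ?thesis .
qed

lemma AE_pull:
  assumes "prob_on S \<sigma>" "A \<in> sets borel" "AE w in \<sigma>. \<forall>i<n. r i w \<in> A"
  shows "AE z in pull \<sigma>. z \<in> A"
proof -
  have "(\<integral>\<^sup>+z. indicator (- A) z \<partial>pull \<sigma>) = (\<integral>\<^sup>+w. (\<Sum>i<n. indicator (- A) (r i w)) / of_nat n \<partial>\<sigma>)"
    using assms by (intro nn_integral_pull) auto
  also have "\<dots> = (\<integral>\<^sup>+w. 0 \<partial>\<sigma>)"
    using assms(3) by (intro nn_integral_cong_AE) (auto elim!: eventually_mono)
  finally show ?thesis
    using AE_iff_nn_integral[OF prob_onD(3)[OF prob_on_pull[OF assms(1)]] assms(2)] by simp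
qed

lemma push_pull:
  assumes "prob_on (cball 0 R) \<sigma>"
  shows "push (pull \<sigma>) = \<sigma>"
proof (rule measure_eqI)
  note \<sigma> = prob_onD[OF assms] and T = prob_onD[OF prob_on_pull[OF assms]]
  show "sets (push (pull \<sigma>)) = sets \<sigma>" using \<sigma> by (simp add: push_def)
  fix A assume "A \<in> sets (push (pull \<sigma>))"
  then have A: "A \<in> sets borel" by (simp add: push_def)
  have pm: "poly p \<in> borel_measurable (pull \<sigma>)"
    using poly_p_measurable T(3) by (auto cong: measurable_cong_sets)
  have im: "(\<lambda>z. indicator A (poly p z) :: ennreal) \<in> borel_measurable borel"
    by (rule measurable_compose[OF poly_p_measurable]) (use A in simp)
  have "emeasure (push (pull \<sigma>)) A = (\<integral>\<^sup>+z. indicator A z \<partial>push (pull \<sigma>))"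
    using A by (simp add: push_def)
  also have "\<dots> = (\<integral>\<^sup>+z. indicator A (poly p z) \<partial>pull \<sigma>)"
    unfolding push_def using pm A by (intro nn_integral_distr) auto
  also have "\<dots> = (\<integral>\<^sup>+w. (\<Sum>i<n. indicator A (poly p (r i w))) / of_nat n \<partial>\<sigma>)"
    by (rule nn_integral_pull[OF assms im])
  also have "\<dots> = (\<integral>\<^sup>+w. indicator A w \<partial>\<sigma>)"
  proof (rule nn_integral_cong_AE)
    show "AE w in \<sigma>. (\<Sum>i<n. indicator A (poly p (r i w))) / of_nat n = (indicator A w :: ennreal)"
      using \<sigma>(5)
    proof eventually_elim
      case (elim w)
      then have "(\<Sum>i<n. indicator A (poly p (r i w))) = (of_nat n * indicator A w :: ennreal)"
        by (simp add: poly_r)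
      moreover have "of_nat n / of_nat n = (1 :: ennreal)"
        using n_ge_2 by (intro ennreal_divide_self) (auto simp: less_top[symmetric])
      ultimately show ?case by (auto simp: indicator_def)
    qed
  qed
  also have "\<dots> = emeasure \<sigma> A" using A \<sigma> by simp
  finally show "emeasure (push (pull \<sigma>)) A = emeasure \<sigma> A" .
qed

text \<open>The logarithm of \<open>|p(z) - w| = \<gamma> \<Prod> |z - r i w|\<close>. The constant may have either sign; its positive and
  negative parts are placed on different sides, so that the identity also makes sense for infinite values.\<close>
lemma log_kernel_push_pull:
  assumes "z \<in> cball 0 R" "poly p z \<in> cball 0 R" "w \<in> cball 0 R"
  shows "log_kernel D (poly p z) w + ennreal (- shift_const) = (\<Sum>i<n. log_kernel D z (r i w)) + ennreal shift_const"
proof (cases "\<exists>i<n. z = r i w")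
  case True
  then obtain i where i: "i < n" "z = r i w" by blast
  have "log_kernel D z (r i w) = \<infinity>" using i by (simp add: log_kernel_def)
  then have "(\<Sum>i<n. log_kernel D z (r i w)) = \<infinity>"
    using i(1) member_le_sum[of i "{..<n}" "\<lambda>i. log_kernel D z (r i w)"] by (auto simp: top_unique)
  moreover have "log_kernel D (poly p z) w = \<infinity>"
    using i poly_r[OF assms(3) i(1)] by (simp add: log_kernel_def)
  ultimately show ?thesis by (simp only: infinity_ennreal_def add_top_left_ennreal)
next
  case False
  have pos: "0 < cmod (z - r i w)" if "i < n" for i using False that by auto
  have le: "cmod (z - r i w) \<le> D" for i
    using assms(1) r_ball[of i w] norm_triangle_ineq4[of z "r i w"] by auto
  have norm_eq: "cmod (poly p z - w) = \<gamma> * (\<Prod>i<n. cmod (z - r i w))"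
    unfolding poly_diff[OF assms(3)] using lead_pos by (simp add: norm_mult prod_norm)
  have prod_pos: "0 < (\<Prod>i<n. cmod (z - r i w))" using pos by (intro prod_pos) auto
  have pw_pos: "0 < cmod (poly p z - w)" unfolding norm_eq using prod_pos lead_pos by simp
  have pw_le: "cmod (poly p z - w) \<le> D"
    using assms norm_triangle_ineq4[of "poly p z" w] by auto
  have D_pos: "D > 0" using R_pos by simp
  have "ln (cmod (poly p z - w)) = ln \<gamma> + (\<Sum>i<n. ln (cmod (z - r i w)))"
  proof -
    have "ln (\<Prod>i<n. cmod (z - r i w)) = (\<Sum>i<n. ln (cmod (z - r i w)))"
      by (rule Transcendental.ln_prod) (use pos in force)+
    then show ?thesis
      unfolding norm_eq using lead_pos prod_pos by (subst ln_mult_pos) auto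
  qed
  then have eq: "ln (D / cmod (poly p z - w)) = (\<Sum>i<n. ln (D / cmod (z - r i w))) + shift_const"
  proof -
    assume a: "ln (cmod (poly p z - w)) = ln \<gamma> + (\<Sum>i<n. ln (cmod (z - r i w)))"
    have "(\<Sum>i<n. ln (D / cmod (z - r i w))) = (\<Sum>i<n. ln D - ln (cmod (z - r i w)))"
      using pos D_pos by (intro sum.cong) (auto simp: ln_div)
    also have "\<dots> = real n * ln D - (\<Sum>i<n. ln (cmod (z - r i w)))"
      by (simp add: sum_subtractf)
    finally have "(\<Sum>i<n. ln (D / cmod (z - r i w))) = real n * ln D - (\<Sum>i<n. ln (cmod (z - r i w)))" .
    moreover have "ln (D / cmod (poly p z - w)) = ln D - ln (cmod (poly p z - w))"
      using pw_pos D_pos by (simp add: ln_div)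
    moreover have "real (n - 1) = real n - 1" using n_ge_2 by simp
    ultimately show ?thesis unfolding shift_const_def a by (simp add: algebra_simps)
  qed
  have nonneg: "0 \<le> ln (D / cmod (z - r i w))" if "i < n" for i
    using pos[OF that] le[of i] D_pos by (intro ln_ge_zero) simp
  have nonneg': "0 \<le> ln (D / cmod (poly p z - w))"
    using pw_pos pw_le D_pos by (intro ln_ge_zero) simp
  have "(\<Sum>i<n. log_kernel D z (r i w)) = (\<Sum>i<n. ennreal (ln (D / cmod (z - r i w))))"
    using False by (intro sum.cong) (auto simp: log_kernel_def)
  also have "\<dots> = ennreal (\<Sum>i<n. ln (D / cmod (z - r i w)))"
    using nonneg by (intro sum_ennreal) auto
  finally have sum_eq: "(\<Sum>i<n. log_kernel D z (r i w)) = ennreal (\<Sum>i<n. ln (D / cmod (z - r i w)))" .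
  have k_eq: "log_kernel D (poly p z) w = ennreal (ln (D / cmod (poly p z - w)))"
    using pw_pos by (auto simp: log_kernel_def)
  have "0 \<le> (\<Sum>i<n. ln (D / cmod (z - r i w)))" using nonneg by (intro sum_nonneg) auto
  then show ?thesis
    unfolding sum_eq k_eq using nonneg' eq
    by (cases "0 \<le> shift_const") (auto simp: ennreal_neg simp flip: ennreal_plus)
qed

text \<open>Push-forward and pullback are adjoint for the mutual energy, up to the factor \<open>n\<close> and a
  constant.\<close>
theorem neg_energy_push_pull:
  assumes "prob_on (cball 0 R) \<alpha>" "prob_on (cball 0 R) (push \<alpha>)" "prob_on (cball 0 R) \<beta>"
  shows "neg_energy D (push \<alpha>) \<beta> + ennreal (- shift_const)
    = of_nat n * neg_energy D \<alpha> (pull \<beta>) + ennreal shift_const"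
proof -
  note \<alpha> = prob_onD[OF assms(1)] and \<beta> = prob_onD[OF assms(3)]
  have pm: "poly p \<in> borel_measurable \<alpha>"
    using poly_p_measurable \<alpha>(3) by (auto cong: measurable_cong_sets)
  have ae_push: "AE z in \<alpha>. poly p z \<in> cball 0 R"
    using prob_onD(5)[OF assms(2)] pm unfolding push_def by (subst (asm) AE_distr_iff) auto
  interpret A: prob_space \<alpha> by fact
  interpret B: prob_space \<beta> by fact
  let ?U = "\<lambda>\<tau> z. \<integral>\<^sup>+w. log_kernel D z w \<partial>\<tau>"
  have km: "(\<lambda>w. log_kernel D z (f w)) \<in> borel_measurable \<beta>" if "f \<in> borel_measurable borel" for z f
  proof -
    have "f \<in> borel_measurable \<beta>" using that \<beta>(3) by (auto cong: measurable_cong_sets)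
    then show ?thesis by measurable
  qed
  have Um: "(\<lambda>z. ?U \<tau> (f z)) \<in> borel_measurable \<alpha>" if "borel_prob \<tau>" "f \<in> borel_measurable \<alpha>" for \<tau> f
    by (rule measurable_compose[OF that(2) log_potential_measurable[OF that(1)]])
  have bp_branch: "borel_prob (distr \<beta> borel (r i))" for i
    by (rule prob_onD(1)[OF prob_on_branch[OF assms(3)]])
  have id_m: "(\<lambda>z. z) \<in> borel_measurable \<alpha>" using \<alpha>(3) by (auto intro!: measurable_ident_sets)
  have rm: "r i \<in> borel_measurable \<beta>" for i
    using r_measurable[of i] \<beta>(3) by (auto cong: measurable_cong_sets)
  have U_branch: "?U (distr \<beta> borel (r i)) z = (\<integral>\<^sup>+w. log_kernel D z (r i w) \<partial>\<beta>)" for i z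
    using rm by (intro nn_integral_distr) auto
  have "neg_energy D (push \<alpha>) \<beta> = (\<integral>\<^sup>+z. ?U \<beta> (poly p z) \<partial>\<alpha>)"
    unfolding neg_energy_iterated(1)[OF prob_onD(1)[OF assms(2)] \<beta>(1)]
    unfolding push_def using pm log_potential_measurable[OF \<beta>(1)] by (intro nn_integral_distr) auto
  then have "neg_energy D (push \<alpha>) \<beta> + ennreal (- shift_const) = (\<integral>\<^sup>+z. ?U \<beta> (poly p z) + ennreal (- shift_const) \<partial>\<alpha>)"
    using Um[OF \<beta>(1) pm] by (simp add: nn_integral_add A.emeasure_space_1)
  also have "\<dots> = (\<integral>\<^sup>+z. (\<Sum>i<n. ?U (distr \<beta> borel (r i)) z) + ennreal shift_const \<partial>\<alpha>)"
  proof (rule nn_integral_cong_AE)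
    show "AE z in \<alpha>. ?U \<beta> (poly p z) + ennreal (- shift_const) = (\<Sum>i<n. ?U (distr \<beta> borel (r i)) z) + ennreal shift_const"
      using \<alpha>(5) ae_push
    proof eventually_elim
      case (elim z)
      have "?U \<beta> (poly p z) + ennreal (- shift_const) = (\<integral>\<^sup>+w. log_kernel D (poly p z) w + ennreal (- shift_const) \<partial>\<beta>)"
        using km[of "\<lambda>w. w"] by (simp add: nn_integral_add B.emeasure_space_1)
      also have "\<dots> = (\<integral>\<^sup>+w. (\<Sum>i<n. log_kernel D z (r i w)) + ennreal shift_const \<partial>\<beta>)"
        using \<beta>(5) elim by (intro nn_integral_cong_AE) (auto elim!: eventually_mono intro!: log_kernel_push_pull simp del: mem_cball)
      also have "\<dots> = (\<Sum>i<n. ?U (distr \<beta> borel (r i)) z) + ennreal shift_const"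
        using km[OF r_measurable] by (simp add: U_branch nn_integral_add nn_integral_sum B.emeasure_space_1)
      finally show ?case .
    qed
  qed
  also have "\<dots> = (\<Sum>i<n. \<integral>\<^sup>+z. ?U (distr \<beta> borel (r i)) z \<partial>\<alpha>) + ennreal shift_const"
    using Um[OF bp_branch id_m] by (simp add: nn_integral_add nn_integral_sum A.emeasure_space_1)
  also have "(\<Sum>i<n. \<integral>\<^sup>+z. ?U (distr \<beta> borel (r i)) z \<partial>\<alpha>) = (\<Sum>i<n. neg_energy D \<alpha> (distr \<beta> borel (r i)))"
    using neg_energy_iterated(1)[OF \<alpha>(1) bp_branch] by simp
  also have "\<dots> = of_nat n * neg_energy D \<alpha> (pull \<beta>)"
  proof -
    have "neg_energy D \<alpha> (pull \<beta>) = (\<Sum>i<n. neg_energy D \<alpha> (distr \<beta> borel (r i))) / of_nat n"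
      unfolding pull_def using n_ge_2 by (intro neg_energy_mixture_right bp_branch \<alpha>(1)) auto
    then show ?thesis
      using n_ge_2 by (simp add: ennreal_times_divide mult_divide_eq_ennreal mult.commute[of "of_nat n"] less_top[symmetric])
  qed
  finally show ?thesis .
qed

end

section \<open>Equilibrium measures of Julia sets\<close>

text \<open>The starting measure \<open>\<beta>\<close> for the iterated pullbacks keeps distance 1 from the disc that contains the
  filled Julia set, which bounds its mutual energies with measures on that set.\<close>
locale escaping_pullback = polynomial_pullback +
  fixes R1 :: real and \<beta> :: "complex measure"
  assumes R1_pos: "R1 > 0" and R1_R: "R1 + 1 \<le> R"
    and escape: "\<And>z. R1 \<le> cmod z \<Longrightarrow> 2 * cmod z \<le> cmod (poly p z)"
    and \<beta>: "prob_on {z. R1 + 1 \<le> cmod z \<and> cmod z \<le> R} \<beta>"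
    and \<beta>_energy: "neg_energy D \<beta> \<beta> < \<infinity>"
begin

lemma iterate_growth:
  assumes "R1 \<le> cmod z"
  shows "2 ^ k * cmod z \<le> cmod ((poly p ^^ k) z)"
proof (induction k)
  case (Suc k)
  have "1 * cmod z \<le> 2 ^ k * cmod z" by (intro mult_right_mono) auto
  then have "R1 \<le> cmod ((poly p ^^ k) z)" using Suc assms by linarith
  then have "2 * cmod ((poly p ^^ k) z) \<le> cmod ((poly p ^^ Suc k) z)"
    using escape by simp
  then show ?case using Suc by simp
qed simp

lemma iterate_mono: "R1 \<le> cmod z \<Longrightarrow> cmod z \<le> cmod ((poly p ^^ k) z)"
  using iterate_growth[of z k] mult_right_mono[of 1 "2 ^ k" "cmod z"] by auto

lemma escape_set_iff: "z \<in> escape_set p \<longleftrightarrow> (\<exists>j. R1 < cmod ((poly p ^^ j) z))"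
proof
  assume "z \<in> escape_set p"
  then have "filterlim (\<lambda>k. cmod ((poly p ^^ k) z)) at_top sequentially"
    by (simp add: escape_set_def filterlim_at_infinity_conv_norm_at_top)
  then have "eventually (\<lambda>k. R1 < cmod ((poly p ^^ k) z)) sequentially"
    by (simp add: filterlim_at_top_dense)
  then show "\<exists>j. R1 < cmod ((poly p ^^ j) z)"
    by (auto simp: eventually_sequentially)
next
  assume "\<exists>j. R1 < cmod ((poly p ^^ j) z)"
  then obtain j where j: "R1 < cmod ((poly p ^^ j) z)" ..
  have grow: "2 ^ k * R1 \<le> cmod ((poly p ^^ (k + j)) z)" for k
  proof -
    have "2 ^ k * R1 \<le> 2 ^ k * cmod ((poly p ^^ j) z)" using j by simp
    also have "\<dots> \<le> cmod ((poly p ^^ k) ((poly p ^^ j) z))"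
      using j by (intro iterate_growth) simp
    finally show ?thesis by (simp add: funpow_add)
  qed
  have "filterlim (\<lambda>k. 2 ^ k * R1) at_top sequentially"
    using R1_pos by real_asymp
  then have "filterlim (\<lambda>k. cmod ((poly p ^^ (k + j)) z)) at_top sequentially"
    by (rule filterlim_at_top_mono) (use grow in auto)
  then have "filterlim (\<lambda>k. cmod ((poly p ^^ k) z)) at_top sequentially"
    unfolding filterlim_at_top
    using eventually_sequentially_seg[of "\<lambda>k. _ \<le> cmod ((poly p ^^ k) z)" j] by simp
  then show "z \<in> escape_set p"
    by (simp add: escape_set_def filterlim_at_infinity_conv_norm_at_top)
qed

lemma filled_julia_iff: "z \<in> filled_julia p \<longleftrightarrow> (\<forall>j. cmod ((poly p ^^ j) z) \<le> R1)"
  by (auto simp: filled_julia_def escape_set_iff not_less)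

lemma continuous_iterate: "continuous_on UNIV (poly p ^^ j)"
proof (induction j)
  case (Suc j)
  have "continuous_on UNIV (poly p \<circ> (poly p ^^ j))"
    by (intro continuous_on_compose Suc continuous_on_poly continuous_on_id)
  then show ?case by simp
qed (simp add: id_def[symmetric] continuous_on_id')

lemma closed_iterate_ball: "closed {z. cmod ((poly p ^^ j) z) \<le> B}"
  by (intro closed_Collect_le continuous_on_norm continuous_iterate continuous_on_const)

lemma closed_filled_julia: "closed (filled_julia p)"
proof -
  have "filled_julia p = (\<Inter>j. {z. cmod ((poly p ^^ j) z) \<le> R1})"
    using filled_julia_iff by auto
  then show ?thesis using closed_iterate_ball by auto
qed

lemma filled_julia_subset: "filled_julia p \<subseteq> cball 0 R1"
  using filled_julia_iff[of _] by (force dest: spec[of _ 0])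

lemma compact_filled_julia: "compact (filled_julia p)"
  using closed_filled_julia bounded_subset[OF bounded_cball filled_julia_subset]
  by (simp add: compact_eq_bounded_closed)

lemma poly_filled_julia: "poly p z \<in> filled_julia p \<longleftrightarrow> z \<in> filled_julia p"
proof
  assume "z \<in> filled_julia p"
  then have "cmod ((poly p ^^ Suc j) z) \<le> R1" for j using filled_julia_iff by blast
  then show "poly p z \<in> filled_julia p"
    unfolding filled_julia_iff by (simp only: funpow_Suc_right comp_apply) simp
next
  assume *: "poly p z \<in> filled_julia p"
  show "z \<in> filled_julia p"
    unfolding filled_julia_iff
  proof
    fix j
    show "cmod ((poly p ^^ j) z) \<le> R1"
    proof (cases j)
      case 0
      have "cmod (poly p z) \<le> R1" using filled_julia_subset * by auto
      then show ?thesis using 0 escape[of z] R1_pos by fastforce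
    next
      case (Suc k)
      have "cmod ((poly p ^^ k) (poly p z)) \<le> R1" using * filled_julia_iff by blast
      then show ?thesis unfolding Suc by (simp only: funpow_Suc_right comp_apply)
    qed
  qed
qed

lemma julia_eq: "julia p = filled_julia p - interior (filled_julia p)"
  by (simp add: julia_def frontier_def closure_closed[OF closed_filled_julia])

lemma compact_julia: "compact (julia p)"
  unfolding julia_def by (rule compact_frontier[OF compact_filled_julia])

lemma julia_subset: "julia p \<subseteq> filled_julia p"
  by (auto simp: julia_eq)

definition pulls :: "nat \<Rightarrow> complex measure" where
  "pulls k = (pull ^^ k) \<beta>"

lemma pulls_simps: "pulls 0 = \<beta>" "pulls (Suc k) = pull (pulls k)"
  by (simp_all add: pulls_def)

lemma prob_on_pulls: "prob_on (cball 0 R) (pulls k)"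
proof (induction k)
  case 0
  show ?case unfolding pulls_simps by (rule prob_on_mono[OF \<beta>]) auto
qed (simp add: pulls_simps prob_on_pull)

lemma D_pos: "D > 0"
  using R_pos by simp

lemma prob_on_K_ball: "prob_on (filled_julia p) \<sigma> \<Longrightarrow> prob_on (cball 0 R) \<sigma>"
  by (erule prob_on_mono) (use filled_julia_subset R1_R in force)

lemma AE_pulls_not_filled: "AE z in pulls k. z \<in> - filled_julia p"
proof (induction k)
  case 0
  show ?case
    unfolding pulls_simps using prob_onD(5)[OF \<beta>]
    by eventually_elim (use filled_julia_subset in force)
next
  case (Suc k)
  have "AE w in pulls k. \<forall>i<n. r i w \<in> - filled_julia p"
    using Suc prob_onD(5)[OF prob_on_pulls]
  proof eventually_elim
    case (elim w)
    then show ?case using poly_r poly_filled_julia by (metis ComplD ComplI)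
  qed
  then show ?case
    unfolding pulls_simps using closed_filled_julia
    by (intro AE_pull[OF prob_on_pulls]) auto
qed

lemma AE_pulls_iterate: "AE z in pulls k. z \<in> {z. cmod ((poly p ^^ k) z) \<le> R}"
proof (induction k)
  case 0
  show ?case using prob_onD(5)[OF prob_on_pulls[of 0]] by eventually_elim simp
next
  case (Suc k)
  have "AE w in pulls k. \<forall>i<n. r i w \<in> {z. cmod ((poly p ^^ Suc k) z) \<le> R}"
    using Suc prob_onD(5)[OF prob_on_pulls]
  proof eventually_elim
    case (elim w)
    show ?case
    proof (intro allI impI)
      fix i assume "i < n"
      then have "(poly p ^^ Suc k) (r i w) = (poly p ^^ k) w"
        using poly_r[OF elim(2)] by (simp only: funpow_Suc_right comp_apply)
      then show "r i w \<in> {z. cmod ((poly p ^^ Suc k) z) \<le> R}" using elim(1) by simp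
    qed
  qed
  then show ?case
    unfolding pulls_simps using closed_iterate_ball[of "Suc k" R]
    by (intro AE_pull[OF prob_on_pulls]) auto
qed

lemma AE_pulls_iterate_le:
  assumes "j \<le> k"
  shows "AE z in pulls k. z \<in> {z. cmod ((poly p ^^ j) z) \<le> R}"
  using AE_pulls_iterate[of k]
proof eventually_elim
  case (elim z)
  show ?case
  proof (rule ccontr)
    assume "z \<notin> {z. cmod ((poly p ^^ j) z) \<le> R}"
    then have gt: "R < cmod ((poly p ^^ j) z)" by simp
    then have "cmod ((poly p ^^ j) z) \<le> cmod ((poly p ^^ (k - j)) ((poly p ^^ j) z))"
      using R1_R by (intro iterate_mono) simp
    also have "\<dots> = cmod ((poly p ^^ k) z)"
      using assms by (simp flip: funpow_add comp_apply[of "poly p ^^ (k - j)"])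
    finally show False using elim gt by simp
  qed
qed

text \<open>The pullbacks never charge the filled Julia set, so a limit does not charge its interior. On the other hand
  the \<open>k\<close>-th pullback is carried by the points that stay in the disc of radius \<open>R\<close> for \<open>k\<close> steps, so a limit does
  not charge the escape set.\<close>
lemma weak_limit_pulls_julia:
  assumes "strict_mono s" "weak_star_conv (\<lambda>k. pulls (s k)) \<nu>" "borel_prob \<nu>"
  shows "prob_on (julia p) \<nu>"
proof -
  have "prob_on (- interior (filled_julia p)) \<nu>"
  proof (rule prob_on_weak_limit[OF assms(2) _ _ assms(3)])
    show "prob_on (- interior (filled_julia p)) (pulls (s k))" for k
      unfolding prob_on_def using prob_onD(1)[OF prob_on_pulls] AE_pulls_not_filled[of "s k"] interior_subset
      by (auto elim!: eventually_mono)
    show "closed (- interior (filled_julia p))" by (intro closed_Compl open_interior)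
  qed
  then have 1: "msupport \<nu> \<subseteq> - interior (filled_julia p)"
    by (subst (asm) prob_on_iff_msupport) (auto intro: closed_Compl)
  have 2: "msupport \<nu> \<subseteq> {z. cmod ((poly p ^^ j) z) \<le> R}" for j
  proof -
    have le: "j \<le> s (k + j)" for k
      using seq_suble[OF assms(1), of "k + j"] by simp
    have "weak_star_conv (\<lambda>k. pulls (s (k + j))) \<nu>"
      using weak_star_conv_subseq[OF assms(2), of "\<lambda>k. k + j"] by (simp add: strict_mono_def)
    then have "prob_on {z. cmod ((poly p ^^ j) z) \<le> R} \<nu>"
    proof (rule prob_on_weak_limit[OF _ _ closed_iterate_ball assms(3)])
      show "prob_on {z. cmod ((poly p ^^ j) z) \<le> R} (pulls (s (k + j)))" for k
        unfolding prob_on_def using prob_onD(1)[OF prob_on_pulls] AE_pulls_iterate_le[OF le] by blast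
    qed
    then show ?thesis by (simp add: prob_on_iff_msupport[OF closed_iterate_ball])
  qed
  have "z \<in> filled_julia p" if z: "z \<in> msupport \<nu>" for z
  proof (rule ccontr)
    assume "z \<notin> filled_julia p"
    then have "z \<in> escape_set p" by (simp add: filled_julia_def)
    then have "filterlim (\<lambda>k. cmod ((poly p ^^ k) z)) at_top sequentially"
      by (simp add: escape_set_def filterlim_at_infinity_conv_norm_at_top)
    then have "eventually (\<lambda>k. R < cmod ((poly p ^^ k) z)) sequentially"
      by (simp add: filterlim_at_top_dense)
    then obtain j where "R < cmod ((poly p ^^ j) z)" by (auto simp: eventually_sequentially)
    then show False using 2[of j] z by auto
  qed
  then show ?thesis
    using 1 assms(3) compact_imp_closed[OF compact_julia]
    by (auto simp: prob_on_iff_msupport julia_eq)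
qed

text \<open>The fixed point of the affine map \<open>a \<mapsto> (a - shift_const) / n\<close> that a pullback induces on energies.\<close>
definition limit_energy :: real where
  "limit_energy = - shift_const / real (n - 1)"

lemma limit_energy_fix: "limit_energy = real n * limit_energy + shift_const"
  using n_ge_2 by (simp add: limit_energy_def field_simps of_nat_diff)

lemma shift_equation:
  assumes "ennreal a + ennreal (- shift_const) = of_nat n * y + ennreal shift_const" "a \<ge> 0"
  obtains y' where "y = ennreal y'" "y' \<ge> 0" "y' - limit_energy = (a - limit_energy) / real n"
proof -
  have "y \<noteq> \<infinity>"
  proof
    assume "y = \<infinity>"
    then have "of_nat n * y = \<infinity>" using n_ge_2 by (simp add: ennreal_mult_top)
    then have "ennreal a + ennreal (- shift_const) = \<infinity>" using assms(1) by simp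
    then show False by (simp add: ennreal_add_eq_top)
  qed
  then obtain y' where y': "y = ennreal y'" "y' \<ge> 0" by (cases y) auto
  have "ennreal (a + max 0 (- shift_const)) = ennreal (real n * y' + max 0 shift_const)"
  proof -
    have "of_nat n * y = ennreal (real n * y')"
      unfolding y'(1) by (simp add: ennreal_mult' ennreal_of_nat_eq_real_of_nat)
    then show ?thesis
      using assms y'(2) by (cases "0 \<le> shift_const") (auto simp: ennreal_neg max_def simp flip: ennreal_plus)
  qed
  then have "a + max 0 (- shift_const) = real n * y' + max 0 shift_const"
    using assms(2) y'(2) by (subst (asm) ennreal_inj) auto
  then have "a = real n * y' + shift_const" by (auto simp: max_def split: if_splits)
  then have "a - limit_energy = real n * (y' - limit_energy)"
    using limit_energy_fix by (simp add: algebra_simps)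
  then show ?thesis using that y' n_ge_2 by simp
qed

text \<open>The energy identity with \<open>\<alpha> = pull \<sigma>\<close> and \<open>push \<alpha> = \<sigma>\<close>: a pullback contracts the distance of the energy
  from the fixed point by the factor \<open>n\<close>.\<close>
lemma pulls_energy:
  "\<exists>b. neg_energy D (pulls k) (pulls k) = ennreal b \<and> 0 \<le> b
     \<and> b - limit_energy = (enn2real (neg_energy D \<beta> \<beta>) - limit_energy) / real n ^ k"
proof (induction k)
  case 0
  have "neg_energy D \<beta> \<beta> = ennreal (enn2real (neg_energy D \<beta> \<beta>))"
    using \<beta>_energy by (simp add: less_top)
  then show ?case by (auto simp: pulls_simps intro!: exI[of _ "enn2real (neg_energy D \<beta> \<beta>)"])
next
  case (Suc k)
  then obtain b where b: "neg_energy D (pulls k) (pulls k) = ennreal b" "0 \<le> b"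
     "b - limit_energy = (enn2real (neg_energy D \<beta> \<beta>) - limit_energy) / real n ^ k" by blast
  have "neg_energy D (push (pulls (Suc k))) (pulls k) + ennreal (- shift_const)
    = of_nat n * neg_energy D (pulls (Suc k)) (pull (pulls k)) + ennreal shift_const"
    using prob_on_pulls[of k] prob_on_pulls[of "Suc k"] push_pull[OF prob_on_pulls[of k]]
    by (intro neg_energy_push_pull) (simp_all add: pulls_simps)
  then have "ennreal b + ennreal (- shift_const) = of_nat n * neg_energy D (pulls (Suc k)) (pulls (Suc k)) + ennreal shift_const"
    using push_pull[OF prob_on_pulls[of k]] b(1) by (simp add: pulls_simps)
  from shift_equation[OF this b(2)] obtain y where "neg_energy D (pulls (Suc k)) (pulls (Suc k)) = ennreal y" "y \<ge> 0"
    "y - limit_energy = (b - limit_energy) / real n" .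
  then show ?case using b(3) by (intro exI[of _ y]) simp
qed

lemma prob_on_push:
  assumes "prob_on (filled_julia p) \<sigma>"
  shows "prob_on (filled_julia p) (push \<sigma>)"
  unfolding push_def
proof (rule prob_on_distr)
  note \<sigma> = prob_onD[OF assms]
  show "prob_space \<sigma>" by fact
  show "poly p \<in> borel_measurable \<sigma>" using poly_p_measurable \<sigma>(3) by (auto cong: measurable_cong_sets)
  show "AE x in \<sigma>. poly p x \<in> filled_julia p" using \<sigma>(5) poly_filled_julia by simp
  show "filled_julia p \<in> sets borel" using closed_filled_julia by simp
qed

lemma mutual_energy_\<beta>:
  assumes "prob_on (filled_julia p) \<sigma>"
  shows "neg_energy D \<sigma> \<beta> \<le> ennreal \<bar>ln D\<bar>"
proof -
  note bp = prob_onD(1)[OF assms] prob_onD(1)[OF \<beta>]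
  interpret P: pair_prob_space \<sigma> \<beta> by (rule pair_prob_space_borel_prob[OF bp])
  have "neg_energy D \<sigma> \<beta> \<le> (\<integral>\<^sup>+q. ennreal \<bar>ln D\<bar> \<partial>(\<sigma> \<Otimes>\<^sub>M \<beta>))"
    unfolding neg_energy_def
  proof (rule nn_integral_mono_AE)
    show "AE q in \<sigma> \<Otimes>\<^sub>M \<beta>. log_kernel D (fst q) (snd q) \<le> ennreal \<bar>ln D\<bar>"
      using AE_pair_prob_on[OF assms \<beta>]
    proof eventually_elim
      case (elim q)
      have "cmod (fst q) \<le> R1" using elim filled_julia_subset by auto
      then have "1 \<le> cmod (fst q - snd q)"
        using elim norm_triangle_ineq2[of "snd q" "fst q"] by (auto simp: norm_minus_commute)
      have "ln (D / cmod (fst q - snd q)) \<le> \<bar>ln D\<bar>"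
      proof -
        have "ln (D / cmod (fst q - snd q)) = ln D - ln (cmod (fst q - snd q))"
          using D_pos \<open>1 \<le> cmod (fst q - snd q)\<close> by (auto simp: ln_div)
        moreover have "0 \<le> ln (cmod (fst q - snd q))"
          using \<open>1 \<le> cmod (fst q - snd q)\<close> by (rule ln_ge_zero)
        ultimately show ?thesis using abs_ge_self[of "ln D"] by linarith
      qed
      then show ?case
        using \<open>1 \<le> cmod (fst q - snd q)\<close> by (auto simp: log_kernel_def intro: ennreal_leI)
    qed
  qed
  then show ?thesis by (simp add: P.emeasure_space_1)
qed

text \<open>Push-forward preserves the measures on the filled Julia set, so the mutual energy with the \<open>k\<close>-th pullback
  reduces to that of the \<open>k\<close>-fold push-forward with \<open>\<beta>\<close>, which is bounded independently of the measure.\<close>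
lemma mutual_energy_pulls:
  assumes "prob_on (filled_julia p) \<sigma>"
  shows "\<exists>a. neg_energy D \<sigma> (pulls k) = ennreal a \<and> 0 \<le> a
     \<and> \<bar>a - limit_energy\<bar> \<le> (\<bar>ln D\<bar> + \<bar>limit_energy\<bar>) / real n ^ k"
  using assms
proof (induction k arbitrary: \<sigma>)
  case 0
  obtain a where a: "neg_energy D \<sigma> \<beta> = ennreal a" "0 \<le> a" "a \<le> \<bar>ln D\<bar>"
    using mutual_energy_\<beta>[OF 0] by (cases "neg_energy D \<sigma> \<beta>") (auto simp: top_unique)
  then show ?case by (intro exI[of _ a]) (auto simp: pulls_simps)
next
  case (Suc k)
  obtain a where a: "neg_energy D (push \<sigma>) (pulls k) = ennreal a" "0 \<le> a"
      "\<bar>a - limit_energy\<bar> \<le> (\<bar>ln D\<bar> + \<bar>limit_energy\<bar>) / real n ^ k"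
    using Suc.IH[OF prob_on_push[OF Suc.prems]] by blast
  have "ennreal a + ennreal (- shift_const) = of_nat n * neg_energy D \<sigma> (pulls (Suc k)) + ennreal shift_const"
    using neg_energy_push_pull[OF prob_on_K_ball[OF Suc.prems] prob_on_K_ball[OF prob_on_push[OF Suc.prems]] prob_on_pulls[of k]] a(1)
    by (simp add: pulls_simps)
  from shift_equation[OF this a(2)] obtain y where y: "neg_energy D \<sigma> (pulls (Suc k)) = ennreal y" "y \<ge> 0"
    "y - limit_energy = (a - limit_energy) / real n" .
  have "\<bar>y - limit_energy\<bar> = \<bar>a - limit_energy\<bar> / real n"
    unfolding y(3) by simp
  also have "\<dots> \<le> ((\<bar>ln D\<bar> + \<bar>limit_energy\<bar>) / real n ^ k) / real n"
    by (intro divide_right_mono a(3)) auto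
  finally show ?case using y by (intro exI[of _ y]) (simp add: mult.commute)
qed

lemma power_n_limit: "(\<lambda>k. C / real n ^ k) \<longlonglongrightarrow> 0"
proof -
  have "(\<lambda>k. C * (1 / real n) ^ k) \<longlonglongrightarrow> C * 0"
    using n_ge_2 by (intro tendsto_mult tendsto_const LIMSEQ_realpow_zero) auto
  then show ?thesis by (simp add: divide_inverse power_inverse)
qed

lemma pulls_energy_limit:
  obtains b where "\<And>k. neg_energy D (pulls k) (pulls k) = ennreal (b k)" "\<And>k. 0 \<le> b k" "b \<longlonglongrightarrow> limit_energy"
proof -
  obtain b where b: "\<And>k. neg_energy D (pulls k) (pulls k) = ennreal (b k)" "\<And>k. 0 \<le> b k"
     "\<And>k. b k - limit_energy = (enn2real (neg_energy D \<beta> \<beta>) - limit_energy) / real n ^ k"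
    using pulls_energy by metis
  have "(\<lambda>k. b k - limit_energy) \<longlonglongrightarrow> 0"
    unfolding b(3) by (rule power_n_limit)
  then have "b \<longlonglongrightarrow> limit_energy" by (simp add: LIM_zero_iff)
  with b that show ?thesis by blast
qed

lemma limit_energy_nonneg: "limit_energy \<ge> 0"
proof -
  obtain b where "\<And>k. 0 \<le> b k" "b \<longlonglongrightarrow> limit_energy" using pulls_energy_limit by metis
  then show ?thesis by (intro LIMSEQ_le_const) auto
qed

text \<open>Positive definiteness for \<open>\<sigma>\<close> and the \<open>k\<close>-th pullback: in the limit, the mutual energy and the energy of the
  pullback both become \<open>limit_energy\<close>.\<close>
lemma limit_energy_le:
  assumes "prob_on (filled_julia p) \<sigma>"
  shows "ennreal limit_energy \<le> neg_energy D \<sigma> \<sigma>"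
proof (cases "neg_energy D \<sigma> \<sigma>")
  case (real e)
  obtain b where b: "\<And>k. neg_energy D (pulls k) (pulls k) = ennreal (b k)" "\<And>k. 0 \<le> b k" "b \<longlonglongrightarrow> limit_energy"
    using pulls_energy_limit by blast
  obtain a where a: "\<And>k. neg_energy D \<sigma> (pulls k) = ennreal (a k)" "\<And>k. 0 \<le> a k"
     "\<And>k. \<bar>a k - limit_energy\<bar> \<le> (\<bar>ln D\<bar> + \<bar>limit_energy\<bar>) / real n ^ k"
    using mutual_energy_pulls[OF assms] by metis
  have a_lim: "a \<longlonglongrightarrow> limit_energy"
  proof -
    have "(\<lambda>k. a k - limit_energy) \<longlonglongrightarrow> 0"
      by (rule Lim_null_comparison[OF _ power_n_limit[of "\<bar>ln D\<bar> + \<bar>limit_energy\<bar>"]]) (use a(3) in auto)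
    then show ?thesis by (simp add: LIM_zero_iff)
  qed
  have "2 * a k \<le> e + b k" for k
  proof -
    have "2 * neg_energy D \<sigma> (pulls k) \<le> neg_energy D \<sigma> \<sigma> + neg_energy D (pulls k) (pulls k)"
      using D_pos prob_on_K_ball[OF assms] prob_on_pulls[of k] by (intro neg_energy_pos_def) auto
    then have "ennreal (2 * a k) \<le> ennreal (e + b k)"
      using a b real by (simp add: ennreal_mult)
    then show ?thesis using real b(2)[of k] by (subst (asm) ennreal_le_iff) auto
  qed
  then have "2 * limit_energy \<le> e + limit_energy"
    by (intro LIMSEQ_le[OF tendsto_mult[OF tendsto_const a_lim] tendsto_add[OF tendsto_const b(3)]]) auto
  then show ?thesis using real by (auto intro: ennreal_leI)
qed simp

lemma limit_energy_eq: "ln D - limit_energy = - ln \<gamma> / real (n - 1)"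
  using n_ge_2 by (simp add: limit_energy_def shift_const_def field_simps)

text \<open>Of the \<open>n\<close> equally weighted preimages of a point, at most \<open>N\<close> lie in \<open>V\<close>.\<close>
lemma pull_test_bound:
  assumes "prob_on (cball 0 R) \<sigma>" "test_fun f" "\<And>z. 0 \<le> f z" "\<And>z. f z \<le> indicator V z"
    and count: "\<And>w. w \<in> cball 0 R \<Longrightarrow> card {i. i < n \<and> r i w \<in> V} \<le> N"
  shows "(LINT z|pull \<sigma>. f z) \<le> real N / real n"
proof -
  note \<sigma> = prob_onD[OF assms(1)] and T = prob_onD[OF prob_on_pull[OF assms(1)]]
  interpret S: prob_space \<sigma> by fact
  have fm: "f \<in> borel_measurable borel" by (rule test_fun_measurable[OF assms(2)])
  have "(\<integral>\<^sup>+z. ennreal (f z) \<partial>pull \<sigma>) = (\<integral>\<^sup>+w. (\<Sum>i<n. ennreal (f (r i w))) / of_nat n \<partial>\<sigma>)"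
    using fm by (intro nn_integral_pull[OF assms(1)]) auto
  also have "\<dots> \<le> (\<integral>\<^sup>+w. ennreal (real N / real n) \<partial>\<sigma>)"
  proof (rule nn_integral_mono_AE)
    show "AE w in \<sigma>. (\<Sum>i<n. ennreal (f (r i w))) / of_nat n \<le> ennreal (real N / real n)"
      using \<sigma>(5)
    proof eventually_elim
      case (elim w)
      have "(\<Sum>i<n. f (r i w)) \<le> (\<Sum>i<n. indicator V (r i w))"
        by (intro sum_mono assms(4))
      also have "\<dots> = real (card {i. i < n \<and> r i w \<in> V})"
        by (simp add: indicator_def sum.If_cases Int_def)
      also have "\<dots> \<le> real N" using count[OF elim] by simp
      finally have "(\<Sum>i<n. f (r i w)) / real n \<le> real N / real n"
        by (rule divide_right_mono) simp
      moreover have "(\<Sum>i<n. ennreal (f (r i w))) / of_nat n = ennreal ((\<Sum>i<n. f (r i w)) / real n)"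
        using n_ge_2 assms(3)
        by (simp add: sum_ennreal divide_ennreal sum_nonneg ennreal_of_nat_eq_real_of_nat)
      ultimately show ?case by (simp add: ennreal_leI)
    qed
  qed
  also have "\<dots> = ennreal (real N / real n)" by (simp add: S.emeasure_space_1)
  finally have "ennreal (LINT z|pull \<sigma>. f z) \<le> ennreal (real N / real n)"
    using assms(3) by (subst nn_integral_eq_integral[symmetric]) (auto intro: test_fun_integrable[OF assms(2) T(1)])
  then show ?thesis by (subst (asm) ennreal_le_iff) auto
qed

text \<open>By \<open>limit_energy_le\<close> no measure on the Julia set has larger energy than the fixed point, and by
  semicontinuity a weak limit of the pullbacks has at least this energy. Uniqueness identifies the limit with the equilibrium
  measure, which inherits the mass bound of the pullbacks.\<close>
theorem julia_equilibrium:
  "prob_on (julia p) (equilibrium_measure (julia p))"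
  "energy (equilibrium_measure (julia p)) = ereal (- ln \<gamma> / real (n - 1))"
  "\<And>f V N. test_fun f \<Longrightarrow> (\<And>z. 0 \<le> f z) \<Longrightarrow> (\<And>z. f z \<le> indicator V z) \<Longrightarrow>
     (\<And>w. w \<in> cball 0 R \<Longrightarrow> card {i. i < n \<and> r i w \<in> V} \<le> N) \<Longrightarrow>
     (LINT z|equilibrium_measure (julia p). f z) \<le> real N / real n"
proof -
  obtain s \<nu> where s: "strict_mono s" "borel_prob \<nu>" "weak_star_conv (\<lambda>k. pulls (s k)) \<nu>"
    using weak_star_compact[OF prob_on_pulls] .
  have \<nu>: "prob_on (julia p) \<nu>" by (rule weak_limit_pulls_julia[OF s(1,3,2)])
  have on_half: "prob_on (cball 0 (D/2)) (pulls k)" for k using prob_on_pulls by simp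
  obtain b where b: "\<And>k. neg_energy D (pulls k) (pulls k) = ennreal (b k)" "\<And>k. 0 \<le> b k" "b \<longlonglongrightarrow> limit_energy"
    using pulls_energy_limit by blast
  have "(\<lambda>k. neg_energy D (pulls (s k)) (pulls (s k))) \<longlonglongrightarrow> ennreal limit_energy"
    unfolding b(1) using LIMSEQ_subseq_LIMSEQ[OF b(3) s(1)] by (intro tendsto_ennrealI) (simp add: comp_def)
  then have "liminf (\<lambda>k. neg_energy D (pulls (s k)) (pulls (s k))) = ennreal limit_energy"
    by (intro lim_imp_Liminf) auto
  then have "neg_energy D \<nu> \<nu> \<le> ennreal limit_energy"
    using neg_energy_lsc[OF s(3) on_half s(2) D_pos] by simp
  then have \<nu>_ge: "ereal (- ln \<gamma> / real (n - 1)) \<le> energy \<nu>"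
    using limit_energy_nonneg prob_on_K_ball[OF prob_on_mono[OF \<nu> julia_subset]]
    unfolding limit_energy_eq[symmetric] by (subst energy_ge_iff[OF D_pos]) auto
  have le: "energy \<sigma> \<le> ereal (- ln \<gamma> / real (n - 1))" if "prob_on (julia p) \<sigma>" for \<sigma>
  proof -
    have K: "prob_on (filled_julia p) \<sigma>" by (rule prob_on_mono[OF that julia_subset])
    have "energy \<sigma> = ereal (ln D) - enn2ereal (neg_energy D \<sigma> \<sigma>)"
      using prob_on_K_ball[OF K] by (intro energy_eq_neg_energy D_pos) simp
    also have "\<dots> \<le> ereal (ln D) - enn2ereal (ennreal limit_energy)"
      using limit_energy_le[OF K] by (intro ereal_minus_mono) (auto simp: less_eq_ennreal.rep_eq)
    also have "\<dots> = ereal (- ln \<gamma> / real (n - 1))"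
      using limit_energy_nonneg by (simp add: limit_energy_eq)
    finally show ?thesis .
  qed
  have J: "set_energy (julia p) = ereal (- ln \<gamma> / real (n - 1))"
  proof (rule antisym)
    show "set_energy (julia p) \<le> ereal (- ln \<gamma> / real (n - 1))"
      unfolding set_energy_eq[OF compact_julia] using le by (intro Sup_least) auto
    show "ereal (- ln \<gamma> / real (n - 1)) \<le> set_energy (julia p)"
      using \<nu>_ge energy_le_set_energy[OF compact_julia \<nu>] by simp
  qed
  have np: "\<not> polar (julia p)" by (simp add: polar_iff J)
  note eq = equilibrium_measure_props[OF compact_julia np]
  have \<nu>_eq: "\<nu> = equilibrium_measure (julia p)"
    using \<nu>_ge by (intro eq(3) \<nu>) (simp add: J)
  show "prob_on (julia p) (equilibrium_measure (julia p))" by (rule eq(1))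
  show "energy (equilibrium_measure (julia p)) = ereal (- ln \<gamma> / real (n - 1))"
    using eq(2) J by simp
  fix f V N
  assume f: "test_fun f" "\<And>z. 0 \<le> f z" "\<And>z. f z \<le> indicator V z"
    and count: "\<And>w. w \<in> cball 0 R \<Longrightarrow> card {i. i < n \<and> r i w \<in> V} \<le> N"
  have "(LINT z|pulls (s (Suc k)). f z) \<le> real N / real n" for k
  proof -
    have "s (Suc k) \<noteq> 0" using seq_suble[OF s(1), of "Suc k"] by auto
    then obtain j where "s (Suc k) = Suc j" by (cases "s (Suc k)") auto
    then show ?thesis using pull_test_bound[OF prob_on_pulls f count] by (simp add: pulls_simps)
  qed
  then have "(LINT z|\<nu>. f z) \<le> real N / real n"
    using LIMSEQ_Suc[OF weak_star_convD[OF s(3) f(1)]] by (intro LIMSEQ_le_const2) auto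
  then show "(LINT z|equilibrium_measure (julia p). f z) \<le> real N / real n"
    unfolding \<nu>_eq .
qed

end

section \<open>Pole pushing and monic polynomials small relative to a power\<close>

text \<open>Uniform approximability on \<open>S\<close> by rational functions with \<open>\<zeta>\<close> as their only pole and value 0 at
  infinity.\<close>
definition pole_approx :: "complex set \<Rightarrow> complex \<Rightarrow> (complex \<Rightarrow> complex) \<Rightarrow> bool" where
  "pole_approx S \<zeta> f \<longleftrightarrow>
     (\<forall>\<epsilon>>0. \<exists>G. \<forall>z\<in>S. cmod (f z - poly G (1 / (z - \<zeta>)) / (z - \<zeta>)) \<le> \<epsilon>)"

lemma pole_approxD:
  assumes "pole_approx S \<zeta> f" "\<epsilon> > 0"
  obtains G where "\<And>z. z \<in> S \<Longrightarrow> cmod (f z - poly G (1 / (z - \<zeta>)) / (z - \<zeta>)) \<le> \<epsilon>"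
  using assms unfolding pole_approx_def by blast

lemma pole_approx_self: "pole_approx S \<zeta> (\<lambda>z. 1 / (z - \<zeta>))"
  unfolding pole_approx_def by (auto intro!: exI[of _ 1])

lemma pole_approx_0: "pole_approx S \<zeta> (\<lambda>z. 0)"
  unfolding pole_approx_def by (auto intro!: exI[of _ 0])

lemma pole_approx_add:
  assumes "pole_approx S \<zeta> f" "pole_approx S \<zeta> g"
  shows "pole_approx S \<zeta> (\<lambda>z. f z + g z)"
  unfolding pole_approx_def
proof (intro allI impI)
  fix \<epsilon> :: real assume "\<epsilon> > 0"
  then have e: "\<epsilon> / 2 > 0" by simp
  obtain F where F: "\<And>z. z \<in> S \<Longrightarrow> cmod (f z - poly F (1 / (z - \<zeta>)) / (z - \<zeta>)) \<le> \<epsilon> / 2"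
    using pole_approxD[OF assms(1) e] by blast
  obtain G where G: "\<And>z. z \<in> S \<Longrightarrow> cmod (g z - poly G (1 / (z - \<zeta>)) / (z - \<zeta>)) \<le> \<epsilon> / 2"
    using pole_approxD[OF assms(2) e] by blast
  have "cmod (f z + g z - poly (F + G) (1 / (z - \<zeta>)) / (z - \<zeta>)) \<le> \<epsilon>" if "z \<in> S" for z
  proof -
    have eq: "f z + g z - poly (F + G) (1 / (z - \<zeta>)) / (z - \<zeta>)
      = (f z - poly F (1 / (z - \<zeta>)) / (z - \<zeta>)) + (g z - poly G (1 / (z - \<zeta>)) / (z - \<zeta>))"
      by (simp add: add_divide_distrib)
    have "cmod (f z + g z - poly (F + G) (1 / (z - \<zeta>)) / (z - \<zeta>)) \<le> \<epsilon> / 2 + \<epsilon> / 2"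
      unfolding eq by (rule order_trans[OF norm_triangle_ineq add_mono[OF F[OF that] G[OF that]]])
    then show ?thesis by simp
  qed
  then show "\<exists>G. \<forall>z\<in>S. cmod (f z + g z - poly G (1 / (z - \<zeta>)) / (z - \<zeta>)) \<le> \<epsilon>" by blast
qed

lemma pole_approx_cmult:
  assumes "pole_approx S \<zeta> f"
  shows "pole_approx S \<zeta> (\<lambda>z. c * f z)"
  unfolding pole_approx_def
proof (intro allI impI)
  fix \<epsilon> :: real assume \<epsilon>: "\<epsilon> > 0"
  then have e: "\<epsilon> / (cmod c + 1) > 0" by (simp add: add_nonneg_pos)
  obtain F where F: "\<And>z. z \<in> S \<Longrightarrow> cmod (f z - poly F (1 / (z - \<zeta>)) / (z - \<zeta>)) \<le> \<epsilon> / (cmod c + 1)"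
    using pole_approxD[OF assms e] by blast
  have "cmod (c * f z - poly (smult c F) (1 / (z - \<zeta>)) / (z - \<zeta>)) \<le> \<epsilon>" if "z \<in> S" for z
  proof -
    have "c * f z - poly (smult c F) (1 / (z - \<zeta>)) / (z - \<zeta>) = c * (f z - poly F (1 / (z - \<zeta>)) / (z - \<zeta>))"
      by (simp only: poly_smult right_diff_distrib times_divide_eq_right)
    then have "cmod (c * f z - poly (smult c F) (1 / (z - \<zeta>)) / (z - \<zeta>))
      = cmod c * cmod (f z - poly F (1 / (z - \<zeta>)) / (z - \<zeta>))"
      by (simp only: norm_mult)
    also have "\<dots> \<le> (cmod c + 1) * (\<epsilon> / (cmod c + 1))"
      unfolding norm_mult using F[OF that] by (intro mult_mono) auto
    also have "\<dots> = \<epsilon>"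
      using add_nonneg_pos[OF norm_ge_zero zero_less_one, of c] by simp
    finally show ?thesis .
  qed
  then show "\<exists>G. \<forall>z\<in>S. cmod (c * f z - poly G (1 / (z - \<zeta>)) / (z - \<zeta>)) \<le> \<epsilon>" by blast
qed

lemma pole_approx_uniform:
  assumes "\<And>\<epsilon>. \<epsilon> > 0 \<Longrightarrow> \<exists>g. pole_approx S \<zeta> g \<and> (\<forall>z\<in>S. cmod (f z - g z) \<le> \<epsilon>)"
  shows "pole_approx S \<zeta> f"
  unfolding pole_approx_def
proof (intro allI impI)
  fix \<epsilon> :: real assume "\<epsilon> > 0"
  then have e: "\<epsilon> / 2 > 0" by simp
  obtain g where g: "pole_approx S \<zeta> g" "\<And>z. z \<in> S \<Longrightarrow> cmod (f z - g z) \<le> \<epsilon> / 2"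
    using assms[OF e] by blast
  obtain G where G: "\<And>z. z \<in> S \<Longrightarrow> cmod (g z - poly G (1 / (z - \<zeta>)) / (z - \<zeta>)) \<le> \<epsilon> / 2"
    using pole_approxD[OF g(1) e] by blast
  have "cmod (f z - poly G (1 / (z - \<zeta>)) / (z - \<zeta>)) \<le> \<epsilon>" if "z \<in> S" for z
    using norm_triangle_ineq[of "f z - g z" "g z - poly G (1 / (z - \<zeta>)) / (z - \<zeta>)"] g(2)[OF that] G[OF that] by simp
  then show "\<exists>G. \<forall>z\<in>S. cmod (f z - poly G (1 / (z - \<zeta>)) / (z - \<zeta>)) \<le> \<epsilon>" by blast
qed

lemma pole_approx_mult:
  assumes "pole_approx S \<zeta> f" "pole_approx S \<zeta> g" "\<And>z. z \<in> S \<Longrightarrow> cmod (f z) \<le> B" "\<And>z. z \<in> S \<Longrightarrow> cmod (g z) \<le> B"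
  shows "pole_approx S \<zeta> (\<lambda>z. f z * g z)"
  unfolding pole_approx_def
proof (intro allI impI)
  fix \<epsilon> :: real assume \<epsilon>: "\<epsilon> > 0"
  define C where "C = 2 * \<bar>B\<bar> + 2"
  define e where "e = min 1 (\<epsilon> / C)"
  have C: "C > 0" by (simp add: C_def)
  have e: "e > 0" "e \<le> 1" "e * C \<le> \<epsilon>"
    using \<epsilon> C by (auto simp: e_def min_def field_simps)
  obtain F where F: "\<And>z. z \<in> S \<Longrightarrow> cmod (f z - poly F (1 / (z - \<zeta>)) / (z - \<zeta>)) \<le> e"
    using pole_approxD[OF assms(1) e(1)] by blast
  obtain G where G: "\<And>z. z \<in> S \<Longrightarrow> cmod (g z - poly G (1 / (z - \<zeta>)) / (z - \<zeta>)) \<le> e"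
    using pole_approxD[OF assms(2) e(1)] by blast
  have "cmod (f z * g z - poly (pCons 0 (F * G)) (1 / (z - \<zeta>)) / (z - \<zeta>)) \<le> \<epsilon>" if z: "z \<in> S" for z
  proof -
    define a where "a = poly F (1 / (z - \<zeta>)) / (z - \<zeta>)"
    define b where "b = poly G (1 / (z - \<zeta>)) / (z - \<zeta>)"
    have "poly (pCons 0 (F * G)) (1 / (z - \<zeta>)) / (z - \<zeta>) = a * b" by (simp add: a_def b_def)
    moreover have "f z * g z - a * b = f z * (g z - b) + (f z - a) * g z - (f z - a) * (g z - b)"
      by (simp add: algebra_simps)
    moreover have "cmod (f z * (g z - b) + (f z - a) * g z - (f z - a) * (g z - b)) \<le> \<bar>B\<bar> * e + e * \<bar>B\<bar> + e * e"
    proof -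
      have fa: "cmod (f z - a) \<le> e" "cmod (g z - b) \<le> e" using F[OF z] G[OF z] by (simp_all add: a_def b_def)
      have fB: "cmod (f z) \<le> \<bar>B\<bar>" "cmod (g z) \<le> \<bar>B\<bar>" using assms(3,4)[OF z] by linarith+
      have "cmod (f z * (g z - b)) \<le> \<bar>B\<bar> * e" "cmod ((f z - a) * g z) \<le> e * \<bar>B\<bar>" "cmod ((f z - a) * (g z - b)) \<le> e * e"
        unfolding norm_mult using fa fB e(1) by (auto intro!: mult_mono)
      then show ?thesis
        using norm_triangle_ineq4[of "f z * (g z - b) + (f z - a) * g z" "(f z - a) * (g z - b)"]
          norm_triangle_ineq[of "f z * (g z - b)" "(f z - a) * g z"] by linarith
    qed
    moreover have "\<bar>B\<bar> * e + e * \<bar>B\<bar> + e * e \<le> e * C"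
    proof -
      have "e * e \<le> e * 1" using e by (intro mult_left_mono) auto
      then show ?thesis using e by (simp add: C_def algebra_simps)
    qed
    ultimately show ?thesis using e(3) by simp
  qed
  then show "\<exists>G. \<forall>z\<in>S. cmod (f z * g z - poly G (1 / (z - \<zeta>)) / (z - \<zeta>)) \<le> \<epsilon>" by blast
qed

lemma pole_approx_power:
  assumes "pole_approx S \<zeta> f" "\<And>z. z \<in> S \<Longrightarrow> cmod (f z) \<le> B"
  shows "pole_approx S \<zeta> (\<lambda>z. f z ^ Suc k)"
proof (induction k)
  case (Suc k)
  have "pole_approx S \<zeta> (\<lambda>z. f z * f z ^ Suc k)"
  proof (rule pole_approx_mult[OF assms(1) Suc])
    fix z assume z: "z \<in> S"
    have B: "B \<ge> 0" using assms(2)[OF z] norm_ge_zero order_trans by blast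
    show "cmod (f z) \<le> max B (B ^ Suc k)" using assms(2)[OF z] by simp
    have "cmod (f z ^ Suc k) \<le> B ^ Suc k"
      unfolding norm_power by (rule power_mono[OF assms(2)[OF z]]) simp
    then show "cmod (f z ^ Suc k) \<le> max B (B ^ Suc k)" by linarith
  qed
  then show ?case by simp
qed (use assms in simp)

text \<open>The geometric series of \<open>1 / (z - b)\<close> in powers of \<open>(b - a) / (z - a)\<close> converges uniformly on \<open>S\<close>, since
  this quotient is at most 1/2 there.\<close>
lemma pole_push:
  assumes "pole_approx S \<zeta> (\<lambda>z. 1 / (z - a))" "\<And>z. z \<in> S \<Longrightarrow> \<delta> \<le> cmod (z - a)" "\<delta> > 0" "cmod (b - a) \<le> \<delta> / 2"
  shows "pole_approx S \<zeta> (\<lambda>z. 1 / (z - b))"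
proof (rule pole_approx_uniform)
  fix \<epsilon> :: real assume \<epsilon>: "\<epsilon> > 0"
  have "(\<lambda>N. (1/2) ^ N * (2 / \<delta>)) \<longlonglongrightarrow> 0 * (2 / \<delta>)"
    by (intro tendsto_mult LIMSEQ_realpow_zero tendsto_const) auto
  then have "eventually (\<lambda>N. (1/2) ^ N * (2 / \<delta>) < \<epsilon>) sequentially"
    using \<epsilon> by (intro order_tendstoD) simp
  then obtain N where N: "(1/2) ^ N * (2 / \<delta>) < \<epsilon>" by (auto simp: eventually_sequentially)
  define g where "g z = (\<Sum>k<N. (b - a) ^ k * (1 / (z - a)) ^ Suc k)" for z
  have "pole_approx S \<zeta> (\<lambda>z. \<Sum>k<M. (b - a) ^ k * (1 / (z - a)) ^ Suc k)" for M
  proof (induction M)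
    case (Suc M)
    have pw: "pole_approx S \<zeta> (\<lambda>z. (1 / (z - a)) ^ Suc M)"
    proof (rule pole_approx_power[OF assms(1)])
      show "cmod (1 / (z - a)) \<le> 1 / \<delta>" if "z \<in> S" for z
        using assms(2)[OF that] assms(3) by (simp add: norm_divide frac_le)
    qed
    show ?case
      unfolding sum.lessThan_Suc by (rule pole_approx_add[OF Suc pole_approx_cmult[OF pw]])
  qed (simp add: pole_approx_0)
  then have "pole_approx S \<zeta> g" unfolding g_def[abs_def] .
  moreover have "cmod (1 / (z - b) - g z) \<le> \<epsilon>" if z: "z \<in> S" for z
  proof -
    have za: "z - a \<noteq> 0" using assms(2)[OF z] assms(3) by auto
    have zb: "\<delta> / 2 \<le> cmod (z - b)"
      using norm_triangle_ineq[of "z - b" "b - a"] assms(2)[OF z] assms(4) by simp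
    then have zb0: "z - b \<noteq> 0" using assms(3) by auto
    define x where "x = (b - a) / (z - a)"
    have x1: "1 - x = (z - b) / (z - a)" using za by (simp add: x_def field_simps)
    then have x1': "1 - x \<noteq> 0" using za zb0 by simp
    have "g z = (\<Sum>k<N. x ^ k) / (z - a)"
      by (simp add: g_def x_def sum_divide_distrib power_divide mult.commute)
    also have "(\<Sum>k<N. x ^ k) = (1 - x ^ N) / (1 - x)"
      using x1' sum_gp_strict[of x N] by auto
    finally have "g z = (1 - x ^ N) / (z - b)"
      using x1 za by simp
    then have "1 / (z - b) - g z = x ^ N / (z - b)"
      by (simp add: diff_divide_distrib)
    moreover have "cmod x \<le> 1/2"
      unfolding x_def norm_divide using assms(2)[OF z] assms(3,4) za
      by (simp add: pos_divide_le_eq)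
    ultimately have "cmod (1 / (z - b) - g z) \<le> (1/2) ^ N / (\<delta> / 2)"
      using zb assms(3) by (simp only: norm_divide norm_power) (intro frac_le power_mono, auto)
    then show ?thesis using N by simp
  qed
  ultimately show "\<exists>g. pole_approx S \<zeta> g \<and> (\<forall>z\<in>S. cmod (1 / (z - b) - g z) \<le> \<epsilon>)" by blast
qed

text \<open>Runge's theorem for a single pole: the set of poles that can be pushed to \<open>\<zeta>\<close> is open and closed in the
  connected set \<open>outside S\<close>.\<close>
lemma pole_approx_outside:
  assumes "compact S" "S \<noteq> {}" "\<zeta> \<in> outside S" "a \<in> outside S"
  shows "pole_approx S \<zeta> (\<lambda>z. 1 / (z - a))"
proof (rule connected_induction_simple[of "outside S" \<zeta> a "\<lambda>b. pole_approx S \<zeta> (\<lambda>z. 1 / (z - b))"])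
  show "connected (outside S)"
    using connected_outside[OF compact_imp_bounded[OF assms(1)]] by simp
  fix c assume c: "c \<in> outside S"
  have "c \<notin> S" using c outside_no_overlap by blast
  define \<delta> where "\<delta> = infdist c S"
  have \<delta>: "\<delta> > 0"
    using \<open>c \<notin> S\<close> in_closed_iff_infdist_zero[OF compact_imp_closed[OF assms(1)] assms(2), of c] infdist_nonneg[of c S]
    by (simp add: \<delta>_def)
  have dist: "\<delta> \<le> cmod (z - c)" if "z \<in> S" for z
    using infdist_le[OF that, of c] by (simp add: \<delta>_def dist_norm norm_minus_commute)
  show "\<exists>T. openin (top_of_set (outside S)) T \<and> c \<in> T \<and>
     (\<forall>x\<in>T. \<forall>y\<in>T. pole_approx S \<zeta> (\<lambda>z. 1 / (z - x)) \<longrightarrow> pole_approx S \<zeta> (\<lambda>z. 1 / (z - y)))"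
  proof (intro exI[of _ "outside S \<inter> ball c (\<delta>/8)"] conjI ballI impI)
    fix x y assume xy: "x \<in> outside S \<inter> ball c (\<delta>/8)" "y \<in> outside S \<inter> ball c (\<delta>/8)"
      and x: "pole_approx S \<zeta> (\<lambda>z. 1 / (z - x))"
    have d: "cmod (c - x) < \<delta>/8" "cmod (c - y) < \<delta>/8" using xy by (auto simp: dist_norm)
    show "pole_approx S \<zeta> (\<lambda>z. 1 / (z - y))"
    proof (rule pole_push[OF x, of "\<delta>/2"])
      show "\<delta>/2 \<le> cmod (z - x)" if "z \<in> S" for z
        using dist[OF that] norm_triangle_ineq[of "z - x" "x - c"] d \<delta> by (simp add: norm_minus_commute)
      show "cmod (y - x) \<le> \<delta>/2/2"
        using norm_triangle_ineq[of "y - c" "c - x"] d \<delta> by (simp add: norm_minus_commute)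
    qed (use \<delta> in simp)
  qed (use c \<delta> in \<open>auto intro: openin_open_Int\<close>)
qed (use assms pole_approx_self in auto)

text \<open>For \<open>a\<close> far away, \<open>1 + a / (z - a) = z / (z - a)\<close> is small on \<open>S\<close> but has value 1 at infinity. Pushing
  its pole to \<open>\<zeta>\<close> gives a polynomial in \<open>1 / (z - \<zeta>)\<close> with constant coefficient 1 that is small on \<open>S\<close>; clearing the
  pole turns this coefficient into the leading one.\<close>
lemma relatively_small_monic:
  assumes "compact S" "S \<noteq> {}" "\<zeta> \<in> outside S"
  obtains q :: "complex poly" and q0 :: real
  where "lead_coeff q = 1" "0 \<le> q0" "q0 < 1"
    "\<And>z. z \<in> S \<Longrightarrow> cmod (poly q z) \<le> q0 * cmod (z - \<zeta>) ^ degree q"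
proof -
  obtain B where B: "B > 0" "\<And>z. z \<in> S \<Longrightarrow> cmod z \<le> B"
    using compact_imp_bounded[OF assms(1)] by (auto simp: bounded_pos)
  \<comment> \<open>With \<open>|a| > 4 B\<close>, the quotient \<open>z / (z - a)\<close> is at most 1/3 on \<open>S\<close>; the approximation error adds another 1/3.\<close>
  have "\<exists>a\<in>outside S. 4 * B < cmod a"
  proof (rule ccontr)
    assume "\<not> ?thesis"
    then have "outside S \<subseteq> cball 0 (4 * B)" by auto
    then have "bounded (outside S)" by (rule bounded_subset[OF bounded_cball])
    then have "bounded (outside S \<union> - outside S)"
      using cobounded_outside[OF compact_imp_bounded[OF assms(1)]] by (simp only: bounded_Un)
    then show False using not_bounded_UNIV[where 'a=complex] by (simp add: Compl_partition)
  qed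
  then obtain a where a: "a \<in> outside S" "4 * B < cmod a" by blast
  have a0: "a \<noteq> 0" using a(2) B(1) by auto
  have "1 / (3 * cmod a) > 0" using a0 by simp
  then obtain G where G: "\<And>z. z \<in> S \<Longrightarrow> cmod (1 / (z - a) - poly G (1 / (z - \<zeta>)) / (z - \<zeta>)) \<le> 1 / (3 * cmod a)"
    using pole_approxD[OF pole_approx_outside[OF assms a(1)]] by blast
  define Q where "Q = 1 + smult a (pCons 0 G)"
  have Q0: "coeff Q 0 = 1" by (simp add: Q_def)
  have Q_small: "cmod (poly Q (1 / (z - \<zeta>))) \<le> 2/3" if z: "z \<in> S" for z
  proof -
    have za: "3 * B \<le> cmod (z - a)"
      using norm_triangle_ineq2[of a z] a(2) B(2)[OF z] by (simp add: norm_minus_commute)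
    then have "z - a \<noteq> 0" using B(1) by auto
    then have "z / (z - a) = 1 + a * (1 / (z - a))" by (simp add: field_simps)
    then have "poly Q (1 / (z - \<zeta>)) = z / (z - a) - a * (1 / (z - a) - poly G (1 / (z - \<zeta>)) / (z - \<zeta>))"
      by (simp add: Q_def algebra_simps)
    then have "cmod (poly Q (1 / (z - \<zeta>))) \<le> cmod (z / (z - a)) + cmod a * cmod (1 / (z - a) - poly G (1 / (z - \<zeta>)) / (z - \<zeta>))"
      using norm_triangle_ineq4[of "z / (z - a)"] by (simp only: norm_mult[symmetric])
    also have "cmod (z / (z - a)) \<le> B / (3 * B)"
      unfolding norm_divide using B za z by (intro frac_le) auto
    also have "cmod a * cmod (1 / (z - a) - poly G (1 / (z - \<zeta>)) / (z - \<zeta>)) \<le> cmod a * (1 / (3 * cmod a))"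
      by (intro mult_left_mono G z) simp
    finally show ?thesis using a0 B(1) by simp
  qed
  define q where "q = pcompose (reflect_poly Q) [:- \<zeta>, 1:]"
  have degR: "degree (reflect_poly Q) = degree Q" using Q0 by simp
  have deg: "degree q = degree Q" by (simp add: q_def degree_pcompose degR)
  have leadR: "lead_coeff (reflect_poly Q) = 1"
    using Q0 degR by (simp add: coeff_reflect_poly)
  have lead: "lead_coeff q = 1"
    unfolding q_def using lead_coeff_comp[of "[:- \<zeta>, 1:]" "reflect_poly Q"] leadR by simp
  have "cmod (poly q z) \<le> 2/3 * cmod (z - \<zeta>) ^ degree q" if z: "z \<in> S" for z
  proof -
    have "\<zeta> \<notin> S" using assms(3) outside_no_overlap[of S] by blast
    then have z\<zeta>: "z - \<zeta> \<noteq> 0" using z by auto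
    have "poly q z = poly (reflect_poly Q) (z - \<zeta>)" by (simp add: q_def poly_pcompose)
    also have "\<dots> = (z - \<zeta>) ^ degree Q * poly Q (1 / (z - \<zeta>))"
      using poly_reflect_poly_nz[OF z\<zeta>, of Q] by (simp add: divide_inverse)
    finally have "cmod (poly q z) = cmod (z - \<zeta>) ^ degree Q * cmod (poly Q (1 / (z - \<zeta>)))"
      by (simp only: norm_mult norm_power)
    also have "\<dots> \<le> cmod (z - \<zeta>) ^ degree Q * (2/3)"
      by (intro mult_left_mono Q_small z) simp
    finally show ?thesis by (simp add: deg)
  qed
  then show ?thesis using that[of q "2/3"] lead by auto
qed

section \<open>Orthonormal polynomials\<close>

text \<open>A measure on a finite set has an atom, and the kernel is infinite on the diagonal.\<close>
lemma finite_set_polar: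
  assumes "finite S"
  shows "polar S"
proof -
  have S: "compact S" using assms by (rule finite_imp_compact)
  obtain D where D: "D > 0" "S \<subseteq> cball 0 (D/2)" using compact_in_half_ball[OF S] .
  have "energy \<sigma> = -\<infinity>" if \<sigma>: "prob_on S \<sigma>" for \<sigma>
  proof -
    note p = prob_onD[OF \<sigma>]
    interpret prob_space \<sigma> by fact
    have "\<exists>s\<in>S. emeasure \<sigma> {s} \<noteq> 0"
    proof (rule ccontr)
      assume "\<not> ?thesis"
      then have "\<forall>s\<in>S. {s} \<in> null_sets \<sigma>" using p(3) by auto
      then have "(\<Union>s\<in>S. {s}) \<in> null_sets \<sigma>"
        using assms by (intro null_sets_UN') (auto intro: countable_finite)
      then have "S \<in> null_sets \<sigma>" by simp
      then have "AE z in \<sigma>. z \<notin> S" by (rule AE_not_in)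
      then have "AE z in \<sigma>. False" using p(5) by eventually_elim simp
      then show False by (simp add: AE_False)
    qed
    then obtain s where s: "s \<in> S" "emeasure \<sigma> {s} \<noteq> 0" by blast
    have "(\<integral>\<^sup>+z. \<infinity> * indicator {s} z \<partial>\<sigma>) \<le> (\<integral>\<^sup>+z. \<integral>\<^sup>+w. log_kernel D z w \<partial>\<sigma> \<partial>\<sigma>)"
    proof (rule nn_integral_mono)
      fix z
      show "\<infinity> * indicator {s} z \<le> (\<integral>\<^sup>+w. log_kernel D z w \<partial>\<sigma>)"
      proof (cases "z = s")
        case True
        have "(\<integral>\<^sup>+w. \<infinity> * indicator {s} w \<partial>\<sigma>) \<le> (\<integral>\<^sup>+w. log_kernel D z w \<partial>\<sigma>)"
          unfolding True by (intro nn_integral_mono) (auto simp: log_kernel_def indicator_def)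
        moreover have "(\<integral>\<^sup>+w. \<infinity> * indicator {s} w \<partial>\<sigma>) = \<infinity>"
          using s(2) p(3) by (subst nn_integral_cmult_indicator) (auto simp: ennreal_top_mult)
        ultimately show ?thesis using True by (simp add: top_unique)
      qed simp
    qed
    moreover have "(\<integral>\<^sup>+z. \<infinity> * indicator {s} z \<partial>\<sigma>) = \<infinity>"
      using s(2) p(3) by (subst nn_integral_cmult_indicator) (auto simp: ennreal_top_mult)
    ultimately have "neg_energy D \<sigma> \<sigma> = \<infinity>"
      using neg_energy_iterated(1)[OF p(1,1)] by (simp add: top_unique)
    then show ?thesis using energy_eq_neg_energy[OF D(1) prob_on_mono[OF \<sigma> D(2)]] by simp
  qed
  then have "set_energy S \<le> -\<infinity>"
    unfolding set_energy_eq[OF S] by (intro Sup_least) auto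
  then show ?thesis by (simp add: polar_iff)
qed

locale nonpolar_measure =
  fixes \<mu> :: "complex measure"
  assumes \<mu>: "\<mu> \<in> nonpolar_measures"
begin

abbreviation "S \<equiv> msupport \<mu>"

lemma \<mu>_props: "borel_prob \<mu>" "compact S" "\<not> polar S" "prob_on S \<mu>"
  using \<mu> AE_msupport by (auto simp: nonpolar_measures_def prob_on_def)

lemma S_nonempty: "S \<noteq> {}"
  using finite_set_polar[of S] \<mu>_props(3) by auto

sublocale prob_space \<mu>
  using prob_onD(2)[OF \<mu>_props(4)] .

lemma integrable_continuous:
  fixes f :: "complex \<Rightarrow> 'b :: {banach, second_countable_topology}"
  assumes "continuous_on UNIV f"
  shows "integrable \<mu> f"
proof -
  have "compact (f ` S)"
    using \<mu>_props(2) continuous_on_subset[OF assms] by (intro compact_continuous_image) auto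
  then obtain B where B: "\<And>y. y \<in> f ` S \<Longrightarrow> norm y \<le> B"
    by (metis bounded_iff compact_imp_bounded)
  have "f \<in> borel_measurable \<mu>"
    using borel_measurable_continuous_onI[OF assms] prob_onD(3)[OF \<mu>_props(4)] by (auto cong: measurable_cong_sets)
  moreover have "AE z in \<mu>. norm (f z) \<le> B"
    using prob_onD(5)[OF \<mu>_props(4)] by eventually_elim (use B in auto)
  ultimately show ?thesis by (intro integrable_const_bound)
qed

definition ip :: "complex poly \<Rightarrow> complex poly \<Rightarrow> complex" where
  "ip p q = (LINT z|\<mu>. poly p z * cnj (poly q z))"

definition nsq :: "complex poly \<Rightarrow> real" where
  "nsq p = (LINT z|\<mu>. (cmod (poly p z))\<^sup>2)"

lemma ip_integrable: "integrable \<mu> (\<lambda>z. poly p z * cnj (poly q z))"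
  by (intro integrable_continuous continuous_intros)

lemma nsq_integrable: "integrable \<mu> (\<lambda>z. (cmod (poly p z))\<^sup>2)"
  by (intro integrable_continuous continuous_intros)

lemma ip_add: "ip (p + q) s = ip p s + ip q s"
  by (simp add: ip_def distrib_right ip_integrable)

lemma ip_smult: "ip (smult c p) s = c * ip p s"
  by (simp add: ip_def mult.assoc)

lemma ip_0: "ip 0 s = 0" "ip s 0 = 0"
  by (simp_all add: ip_def)

lemma ip_cnj: "ip q p = cnj (ip p q)"
proof -
  have "cnj (ip p q) = (LINT z|\<mu>. cnj (poly p z * cnj (poly q z)))"
    unfolding ip_def by (rule Bochner_Integration.integral_cnj[symmetric])
  then show ?thesis by (simp add: ip_def mult.commute)
qed

lemma ip_diff: "ip (p - q) s = ip p s - ip q s"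
  by (simp add: ip_def left_diff_distrib ip_integrable)

lemma ip_add_right: "ip s (p + q) = ip s p + ip s q"
  by (metis complex_cnj_add ip_add ip_cnj)

lemma ip_diff_right: "ip s (p - q) = ip s p - ip s q"
  by (metis complex_cnj_diff ip_diff ip_cnj)

lemma ip_smult_right: "ip s (smult c p) = cnj c * ip s p"
  by (metis complex_cnj_mult ip_smult ip_cnj)

lemma ip_sum: "ip (\<Sum>i\<in>A. f i) s = (\<Sum>i\<in>A. ip (f i) s)"
  by (induction A rule: infinite_finite_induct) (auto simp: ip_0 ip_add)

lemma ip_self: "ip p p = of_real (nsq p)"
proof -
  show ?thesis
    unfolding ip_def nsq_def complex_norm_square[symmetric] by (simp only: integral_complex_of_real)
qed

lemma nsq_nonneg: "nsq p \<ge> 0"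
  unfolding nsq_def by (intro integral_nonneg_AE) auto

text \<open>A polynomial vanishing almost everywhere would confine the support to its finitely many zeros, but finite sets are
  polar.\<close>
lemma nsq_pos:
  assumes "p \<noteq> 0"
  shows "nsq p > 0"
proof (rule ccontr)
  assume "\<not> ?thesis"
  then have "nsq p = 0" using nsq_nonneg[of p] by simp
  then have "AE z in \<mu>. (cmod (poly p z))\<^sup>2 = 0"
    unfolding nsq_def using nsq_integrable by (subst (asm) integral_nonneg_eq_0_iff_AE) auto
  then have "AE z in \<mu>. z \<in> {z. poly p z = 0}" by simp
  moreover have fin: "finite {z. poly p z = 0}" using poly_roots_finite[OF assms] .
  ultimately have "S \<subseteq> {z. poly p z = 0}"
    using msupport_subset_iff[OF \<mu>_props(1) finite_imp_closed[OF fin]] by simp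
  then have "finite S" by (rule finite_subset[OF _ fin])
  then show False using \<mu>_props(3) finite_set_polar by simp
qed

lemma nsq_mono:
  assumes "\<And>z. z \<in> S \<Longrightarrow> cmod (poly p z) \<le> c * cmod (poly q z)"
  shows "nsq p \<le> c\<^sup>2 * nsq q"
proof -
  have "nsq p \<le> (LINT z|\<mu>. c\<^sup>2 * (cmod (poly q z))\<^sup>2)"
    unfolding nsq_def
  proof (rule integral_mono_AE[OF nsq_integrable])
    show "integrable \<mu> (\<lambda>z. c\<^sup>2 * (cmod (poly q z))\<^sup>2)" by (intro integrable_mult_right nsq_integrable)
    show "AE z in \<mu>. (cmod (poly p z))\<^sup>2 \<le> c\<^sup>2 * (cmod (poly q z))\<^sup>2"
      using prob_onD(5)[OF \<mu>_props(4)]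
    proof eventually_elim
      case (elim z)
      have "(cmod (poly p z))\<^sup>2 \<le> (c * cmod (poly q z))\<^sup>2"
        by (rule power_mono[OF assms[OF elim]]) simp
      then show ?case by (simp add: power_mult_distrib)
    qed
  qed
  then show ?thesis by (simp add: nsq_def)
qed

text \<open>Degree below \<open>n\<close>; the zero polynomial is included for \<open>n = 0\<close>, where its degree is not smaller than
  \<open>n\<close>.\<close>
definition lower :: "nat \<Rightarrow> complex poly \<Rightarrow> bool" where
  "lower n q \<longleftrightarrow> q = 0 \<or> degree q < n"

text \<open>Orthogonality to all polynomials of lower degree characterises each orthonormal polynomial separately from the rest of the
  sequence.\<close>
definition is_orth :: "nat \<Rightarrow> complex poly \<Rightarrow> bool" where
  "is_orth n p \<longleftrightarrow> degree p = n \<and> (\<exists>\<gamma>>0. lead_coeff p = complex_of_real \<gamma>) \<and>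
     (\<forall>q. lower n q \<longrightarrow> ip p q = 0) \<and> ip p p = 1"

lemma lower_sub_lead:
  assumes "degree p = n" "degree q = n" "lead_coeff q \<noteq> 0"
  shows "lower n (p - smult (lead_coeff p / lead_coeff q) q)"
proof -
  let ?r = "p - smult (lead_coeff p / lead_coeff q) q"
  have "degree ?r \<le> n" using assms by (intro degree_diff_le) auto
  moreover have "coeff ?r n = 0" using assms by simp
  ultimately show ?thesis
    unfolding lower_def by (metis leading_coeff_0_iff le_neq_implies_less)
qed

text \<open>Polynomials with degrees \<open>0, \<dots>, n - 1\<close> span all polynomials of degree below \<open>n\<close>; induction on the degree
  removes leading terms.\<close>
lemma orth_span:
  assumes P: "\<And>i. i < n \<Longrightarrow> degree (P i) = i" "\<And>i. i < n \<Longrightarrow> P i \<noteq> 0" "\<And>i. i < n \<Longrightarrow> ip s (P i) = 0"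
  shows "lower n q \<Longrightarrow> ip s q = 0"
proof (induction "degree q" arbitrary: q rule: less_induct)
  case less
  show ?case
  proof (cases "q = 0")
    case False
    define d where "d = degree q"
    have d: "d < n" using less.prems False by (simp add: lower_def d_def)
    let ?c = "lead_coeff q / lead_coeff (P d)"
    let ?r = "q - smult ?c (P d)"
    have "lead_coeff (P d) \<noteq> 0" using P(2)[OF d] by simp
    then have r: "lower d ?r"
      by (intro lower_sub_lead[OF _ P(1)[OF d]]) (simp add: d_def)
    have "ip s ?r = 0"
    proof (cases "?r = 0")
      case True
      then show ?thesis by (simp only: ip_0)
    next
      case False
      then have "degree ?r < degree q" using r by (simp add: lower_def d_def)
      moreover from this have "lower n ?r" using d unfolding lower_def d_def by linarith
      ultimately show ?thesis by (rule less.hyps)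
    qed
    then show ?thesis
      using P(3)[OF d] by (simp add: ip_diff_right ip_smult_right)
  qed (simp add: ip_0)
qed

lemma is_orth_nonzero: "is_orth n p \<Longrightarrow> p \<noteq> 0"
  by (auto simp: is_orth_def ip_0)

lemma is_orth_unique:
  assumes "is_orth n p" "is_orth n q"
  shows "p = q"
proof -
  obtain a where a: "a > 0" "lead_coeff p = complex_of_real a" using assms(1) by (auto simp: is_orth_def)
  obtain b where b: "b > 0" "lead_coeff q = complex_of_real b" using assms(2) by (auto simp: is_orth_def)
  define c where "c = a / b"
  have c: "c > 0" using a b by (simp add: c_def)
  have cc: "lead_coeff p / lead_coeff q = complex_of_real c" using a b by (simp add: c_def)
  let ?r = "p - smult (complex_of_real c) q"
  have r: "lower n ?r"
    using lower_sub_lead[of p n q] assms b unfolding cc[symmetric] by (auto simp: is_orth_def)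
  have "ip ?r ?r = 0"
    using r assms by (subst ip_diff) (simp add: ip_smult is_orth_def)
  then have "?r = 0" using nsq_pos[of ?r] by (auto simp: ip_self)
  then have pq: "p = smult (complex_of_real c) q" by simp
  have "ip p p = complex_of_real (c * c)"
    unfolding pq using assms(2) by (simp add: ip_smult ip_smult_right is_orth_def)
  then have "c * c = 1" using assms(1) by (simp add: is_orth_def del: of_real_mult)
  then have "c = 1" using c by (metis abs_of_pos real_sqrt_abs2 real_sqrt_one)
  then show ?thesis using pq by simp
qed

lemma is_orth_exists: "\<exists>p. is_orth n p"
proof (induction n rule: less_induct)
  case (less n)
  then obtain P where P: "\<And>i. i < n \<Longrightarrow> is_orth i (P i)" by metis
  \<comment> \<open>The orthogonalisation step of Gram and Schmidt.\<close>
  define m where "m = monom 1 n - (\<Sum>i<n. smult (ip (monom 1 n) (P i)) (P i))"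
  have orth: "ip (P i) (P j) = (if i = j then 1 else 0)" if "i < n" "j < n" for i j
  proof -
    consider "i = j" | "i < j" | "j < i" by linarith
    then show ?thesis
    proof cases
      case 1 then show ?thesis using P[OF that(1)] by (simp add: is_orth_def)
    next
      case 2
      then have "ip (P j) (P i) = 0"
        using P[OF that(2)] P[OF that(1)] by (auto simp: is_orth_def lower_def)
      then show ?thesis using 2 ip_cnj[of "P i" "P j"] by simp
    next
      case 3
      then show ?thesis using P[OF that(2)] P[OF that(1)] by (auto simp: is_orth_def lower_def)
    qed
  qed
  have m_orth: "ip m (P j) = 0" if "j < n" for j
  proof -
    have "(\<Sum>i<n. ip (smult (ip (monom 1 n) (P i)) (P i)) (P j)) = (\<Sum>i<n. if i = j then ip (monom 1 n) (P j) else 0)"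
      using that orth by (intro sum.cong) (auto simp: ip_smult)
    then show ?thesis using that by (simp add: m_def ip_diff ip_sum)
  qed
  have sum_low: "lower n (\<Sum>i<n. smult (ip (monom 1 n) (P i)) (P i))"
  proof (cases "n = 0")
    case False
    have "degree (\<Sum>i<n. smult (ip (monom 1 n) (P i)) (P i)) \<le> n - 1"
    proof (rule degree_sum_le)
      fix i assume "i \<in> {..<n}"
      then have "degree (P i) \<le> n - 1" using P[of i] by (simp add: is_orth_def)
      then show "degree (smult (ip (monom 1 n) (P i)) (P i)) \<le> n - 1"
        using degree_smult_le order_trans by blast
    qed simp
    then have "degree (\<Sum>i<n. smult (ip (monom 1 n) (P i)) (P i)) < n" using False by linarith
    then show ?thesis by (simp add: lower_def)
  qed (simp add: lower_def)
  have coeff_m: "coeff m n = 1"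
    using sum_low by (auto simp: m_def lower_def coeff_eq_0)
  have deg_m: "degree m = n"
  proof (rule antisym)
    show "degree m \<le> n"
      unfolding m_def using sum_low by (intro degree_diff_le) (auto simp: lower_def degree_monom_eq)
    show "n \<le> degree m" using coeff_m by (intro le_degree) simp
  qed
  have m0: "m \<noteq> 0" using coeff_m by auto
  define c where "c = 1 / sqrt (nsq m)"
  have c: "c > 0" using nsq_pos[OF m0] by (simp add: c_def)
  have "is_orth n (smult (complex_of_real c) m)"
    unfolding is_orth_def
  proof (intro conjI allI impI)
    show "degree (smult (complex_of_real c) m) = n" using deg_m c by simp
    show "\<exists>\<gamma>>0. lead_coeff (smult (complex_of_real c) m) = complex_of_real \<gamma>"
      using c deg_m coeff_m by (intro exI[of _ c]) simp
    show "ip (smult (complex_of_real c) m) q = 0" if "lower n q" for q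
    proof -
      have "ip m q = 0"
      proof (rule orth_span[of n P m q])
        fix i assume i: "i < n"
        show "degree (P i) = i" using P[OF i] by (simp add: is_orth_def)
        show "P i \<noteq> 0" by (rule is_orth_nonzero[OF P[OF i]])
        show "ip m (P i) = 0" by (rule m_orth[OF i])
      qed (rule that)
      then show ?thesis by (simp add: ip_smult)
    qed
    have "c * c * nsq m = 1"
      using nsq_pos[OF m0] by (simp add: c_def)
    moreover have "ip (smult (complex_of_real c) m) (smult (complex_of_real c) m) = complex_of_real (c * c * nsq m)"
      by (simp only: ip_smult ip_smult_right) (simp add: ip_self)
    ultimately show "ip (smult (complex_of_real c) m) (smult (complex_of_real c) m) = 1"
      by (simp only: of_real_1)
  qed
  then show ?case by blast
qed

lemma orthonormal_system_iff:
  "((\<forall>n. degree (P n) = n \<and> (\<exists>\<gamma>>0. lead_coeff (P n) = complex_of_real \<gamma>)) \<and>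
    (\<forall>m n. (LINT z|\<mu>. poly (P m) z * cnj (poly (P n) z)) = (if m = n then 1 else 0)))
   \<longleftrightarrow> (\<forall>n. is_orth n (P n))"
proof
  assume *: "(\<forall>n. degree (P n) = n \<and> (\<exists>\<gamma>>0. lead_coeff (P n) = complex_of_real \<gamma>)) \<and>
    (\<forall>m n. (LINT z|\<mu>. poly (P m) z * cnj (poly (P n) z)) = (if m = n then 1 else 0))"
  then have ip: "ip (P m) (P n) = (if m = n then 1 else 0)" for m n unfolding ip_def by blast
  have nz: "P n \<noteq> 0" for n
    using ip[of n n] ip_0(1)[of "P n"] by auto
  have deg: "degree (P n) = n" and lead: "\<exists>\<gamma>>0. lead_coeff (P n) = complex_of_real \<gamma>" for n
    using * by blast+
  show "\<forall>n. is_orth n (P n)"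
    unfolding is_orth_def
  proof (intro allI conjI impI deg lead)
    show "ip (P n) (P n) = 1" for n by (simp add: ip)
    show "ip (P n) q = 0" if "lower n q" for n q
    proof (rule orth_span[of n P "P n" q])
      show "ip (P n) (P i) = 0" if "i < n" for i using that by (simp add: ip)
    qed (use deg nz that in auto)
  qed
next
  assume *: "\<forall>n. is_orth n (P n)"
  have "ip (P m) (P n) = (if m = n then 1 else 0)" for m n
  proof -
    consider "m = n" | "m < n" | "n < m" by linarith
    then show ?thesis
    proof cases
      case 1 then show ?thesis using * by (simp add: is_orth_def)
    next
      case 2
      then have "ip (P n) (P m) = 0" using * by (auto simp: is_orth_def lower_def)
      then show ?thesis using 2 ip_cnj[of "P m" "P n"] by simp
    next
      case 3
      then show ?thesis using * by (auto simp: is_orth_def lower_def)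
    qed
  qed
  then have "\<forall>m n. (LINT z|\<mu>. poly (P m) z * cnj (poly (P n) z)) = (if m = n then 1 else 0)"
    unfolding ip_def by blast
  moreover have "degree (P n) = n \<and> (\<exists>\<gamma>>0. lead_coeff (P n) = complex_of_real \<gamma>)" for n
    using * unfolding is_orth_def by blast
  ultimately show "(\<forall>n. degree (P n) = n \<and> (\<exists>\<gamma>>0. lead_coeff (P n) = complex_of_real \<gamma>)) \<and>
    (\<forall>m n. (LINT z|\<mu>. poly (P m) z * cnj (poly (P n) z)) = (if m = n then 1 else 0))"
    by blast
qed

abbreviation "OP \<equiv> orthonormal_poly \<mu>"
abbreviation "\<gamma> \<equiv> orthonormal_lead \<mu>"

lemma is_orth_OP: "is_orth n (OP n)"
proof -
  have "OP = (THE P. \<forall>n. is_orth n (P n))"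
    unfolding orthonormal_poly_def by (simp only: orthonormal_system_iff)
  moreover have "\<exists>!P. \<forall>n. is_orth n (P n)"
  proof -
    have "\<exists>P. \<forall>n. is_orth n (P n)" using is_orth_exists by metis
    moreover have "P = Q" if "\<forall>n. is_orth n (P n)" "\<forall>n. is_orth n (Q n)" for P Q
      using that is_orth_unique by blast
    ultimately show ?thesis by blast
  qed
  ultimately show ?thesis using theI'[of "\<lambda>P. \<forall>n. is_orth n (P n)"] by auto
qed

lemma degree_OP: "degree (OP n) = n"
  using is_orth_OP[of n] by (simp add: is_orth_def)

lemma \<gamma>_pos: "\<gamma> n > 0" and lead_OP: "lead_coeff (OP n) = complex_of_real (\<gamma> n)"
proof -
  obtain g where g: "g > 0" "lead_coeff (OP n) = complex_of_real g"
    using is_orth_OP[of n] unfolding is_orth_def by blast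
  then have "\<gamma> n = g" by (simp add: orthonormal_lead_def)
  with g show "\<gamma> n > 0" "lead_coeff (OP n) = complex_of_real (\<gamma> n)" by simp_all
qed

lemma nsq_OP_shift:
  assumes "n \<ge> 1"
  shows "nsq (OP n - [:w:]) = 1 + (cmod w)\<^sup>2"
proof -
  have 0: "ip (OP n) [:w:] = 0" using is_orth_OP[of n] assms by (simp add: is_orth_def lower_def)
  then have 1: "ip [:w:] (OP n) = 0" using ip_cnj[of "[:w:]" "OP n"] by simp
  have "ip [:w:] [:w:] = complex_of_real ((cmod w)\<^sup>2)"
    unfolding ip_def complex_norm_square using prob_space by simp
  then have "ip (OP n - [:w:]) (OP n - [:w:]) = complex_of_real (1 + (cmod w)\<^sup>2)"
    using is_orth_OP[of n] 0 1 by (simp add: ip_diff ip_diff_right is_orth_def)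
  then show ?thesis unfolding ip_self by (simp only: of_real_eq_iff)
qed

text \<open>The difference to \<open>OP n\<close> has lower degree and is orthogonal to it, so Pythagoras applies.\<close>
lemma OP_minimal:
  assumes "degree q = n" "lead_coeff q = complex_of_real (\<gamma> n)"
  shows "1 \<le> nsq q"
proof -
  define r where "r = q - OP n"
  have r: "lower n r"
    using lower_sub_lead[of q n "OP n"] assms degree_OP lead_OP \<gamma>_pos[of n] by (simp add: r_def)
  have q: "q = OP n + r" by (simp add: r_def)
  have o: "ip (OP n) r = 0" using is_orth_OP[of n] r by (simp add: is_orth_def)
  then have o': "ip r (OP n) = 0" using ip_cnj[of r "OP n"] by simp
  have "ip q q = complex_of_real (1 + nsq r)"
    unfolding q using o o' is_orth_OP[of n] by (simp add: ip_add ip_add_right is_orth_def ip_self[of r])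
  then have "nsq q = 1 + nsq r" unfolding ip_self by (simp only: of_real_eq_iff)
  then show ?thesis using nsq_nonneg[of r] by simp
qed

text \<open>Replacing the factor \<open>H\<close> of \<open>OP n - w\<close> by \<open>Q\<close> keeps degree and leading coefficient. The resulting norm is at least
  the minimum 1, and at most \<open>c\<close> times the norm of \<open>OP n - w\<close>, whose square is \<open>1 + |w|\<^sup>2\<close> by
  orthogonality to constants.\<close>
lemma OP_factor_replacement:
  assumes "n \<ge> 1" "OP n - [:w:] = H * G" "lead_coeff H = 1" "lead_coeff Q = 1" "degree Q = degree H"
    and "\<And>z. z \<in> S \<Longrightarrow> cmod (poly Q z) \<le> c * cmod (poly H z)"
  shows "1 \<le> c\<^sup>2 * (1 + (cmod w)\<^sup>2)"
proof -
  have deg: "degree (OP n - [:w:]) = n" "lead_coeff (OP n - [:w:]) = complex_of_real (\<gamma> n)"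
  proof -
    have "degree (OP n - [:w:]) = degree (OP n)"
      unfolding diff_conv_add_uminus using assms(1) degree_OP by (intro degree_add_eq_left) auto
    then show d: "degree (OP n - [:w:]) = n" by (simp add: degree_OP)
    have "coeff (OP n - [:w:]) n = coeff (OP n) n"
      using assms(1) by (cases n) auto
    then show "lead_coeff (OP n - [:w:]) = complex_of_real (\<gamma> n)"
      unfolding d using lead_OP[of n] by (simp add: degree_OP)
  qed
  have "H * G \<noteq> 0" using deg(2) \<gamma>_pos[of n] unfolding assms(2) by auto
  then have 0: "H \<noteq> 0" "G \<noteq> 0" by auto
  have Q0: "Q \<noteq> 0" using assms(4) by auto
  have "degree (Q * G) = n"
    using deg(1) unfolding assms(2) degree_mult_eq[OF 0] degree_mult_eq[OF Q0 0(2)] assms(5) by simp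
  moreover have "lead_coeff (Q * G) = complex_of_real (\<gamma> n)"
    using deg(2) unfolding assms(2) lead_coeff_mult assms(3,4) by simp
  ultimately have "1 \<le> nsq (Q * G)" by (rule OP_minimal)
  also have "\<dots> \<le> c\<^sup>2 * nsq (OP n - [:w:])"
  proof (rule nsq_mono)
    fix z assume "z \<in> S"
    have "cmod (poly (Q * G) z) = cmod (poly Q z) * cmod (poly G z)" by (simp add: norm_mult)
    also have "\<dots> \<le> (c * cmod (poly H z)) * cmod (poly G z)"
      by (intro mult_right_mono assms(6) \<open>z \<in> S\<close>) simp
    finally show "cmod (poly (Q * G) z) \<le> c * cmod (poly (OP n - [:w:]) z)"
      unfolding assms(2) by (simp add: norm_mult mult.assoc)
  qed
  finally show ?thesis using nsq_OP_shift[OF assms(1)] by simp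
qed

text \<open>If \<open>|\<zeta>| > 2 B\<close> then \<open>|z| < |z - \<zeta>|\<close> uniformly on the support, and replacing the zero \<open>\<zeta>\<close> by the zero 0 would decrease
  the norm.\<close>
lemma OP_zeros:
  assumes "\<And>z. z \<in> S \<Longrightarrow> cmod z \<le> B" "B > 0" "n \<ge> 1" "poly (OP n) \<zeta> = 0"
  shows "cmod \<zeta> \<le> 2 * B"
proof (rule ccontr)
  assume "\<not> ?thesis"
  then have \<zeta>: "cmod \<zeta> - B > B" by simp
  define c where "c = B / (cmod \<zeta> - B)"
  have c: "0 \<le> c" "c < 1" using \<zeta> assms(2) by (auto simp: c_def field_simps)
  obtain G where G: "OP n = [:- \<zeta>, 1:] * G" using assms(4) by (auto simp: poly_eq_0_iff_dvd dvd_def)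
  have "1 \<le> c\<^sup>2 * (1 + (cmod 0)\<^sup>2)"
  proof (rule OP_factor_replacement[OF assms(3), of 0 "[:- \<zeta>, 1:]" G "[:0, 1:]"])
    fix z assume z: "z \<in> S"
    have "cmod \<zeta> - B \<le> cmod (z - \<zeta>)"
      using norm_triangle_ineq2[of \<zeta> z] assms(1)[OF z] by (simp add: norm_minus_commute)
    then have "c * (cmod \<zeta> - B) \<le> c * cmod (z - \<zeta>)" using c(1) by (rule mult_left_mono)
    moreover have "c * (cmod \<zeta> - B) = B" using \<zeta> assms(2) by (simp add: c_def)
    ultimately show "cmod (poly [:0, 1:] z) \<le> c * cmod (poly [:- \<zeta>, 1:] z)"
      using assms(1)[OF z] by simp
  qed (use G in auto)
  moreover have "c\<^sup>2 < 1" using c by (simp add: power_less_one_iff abs_square_less_1)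
  ultimately show False by simp
qed

text \<open>The monomial \<open>\<gamma> n z ^ n\<close> competes with \<open>OP n\<close>.\<close>
lemma \<gamma>_lower_bound:
  assumes "\<And>z. z \<in> S \<Longrightarrow> cmod z \<le> B" "B > 0"
  shows "1 \<le> \<gamma> n * B ^ n"
proof -
  let ?q = "smult (complex_of_real (\<gamma> n)) (monom 1 n)"
  have "1 \<le> nsq ?q"
    using \<gamma>_pos[of n] by (intro OP_minimal[of _ n]) (auto simp: degree_monom_eq)
  also have "\<dots> \<le> (\<gamma> n * B ^ n)\<^sup>2 * nsq 1"
  proof (rule nsq_mono)
    fix z assume "z \<in> S"
    then have "cmod z ^ n \<le> B ^ n" by (intro power_mono assms) auto
    then show "cmod (poly ?q z) \<le> (\<gamma> n * B ^ n) * cmod (poly 1 z)"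
      using \<gamma>_pos[of n] by (simp add: poly_monom norm_mult norm_power)
  qed
  also have "nsq 1 = 1" using prob_space by (simp add: nsq_def)
  finally have "1\<^sup>2 \<le> (\<gamma> n * B ^ n)\<^sup>2" by simp
  moreover have "0 \<le> \<gamma> n * B ^ n" using \<gamma>_pos[of n] assms(2) by (simp add: less_imp_le)
  ultimately show ?thesis by (rule power2_le_imp_le)
qed

end

lemma poly_growth_from_zeros:
  fixes p :: "complex poly"
  assumes "\<And>\<zeta>. poly p \<zeta> = 0 \<Longrightarrow> cmod \<zeta> \<le> A" "A \<le> cmod z"
  shows "cmod (lead_coeff p) * (cmod z - A) ^ degree p \<le> cmod (poly p z)"
  using assms(1)
proof (induction "degree p" arbitrary: p)
  case 0
  then have "degree p = 0" by simp
  then obtain c where "p = [:c:]" by (rule degree_eq_zeroE)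
  then show ?case by simp
next
  case (Suc d)
  obtain \<zeta> where \<zeta>: "poly p \<zeta> = 0" using poly_root_exists[of p] Suc.hyps(2) by auto
  then obtain q where q: "p = [:- \<zeta>, 1:] * q" by (auto simp: poly_eq_0_iff_dvd dvd_def)
  have q0: "q \<noteq> 0" using q Suc.hyps(2) by auto
  have deg: "degree p = Suc (degree q)" unfolding q using q0 by (subst degree_mult_eq) auto
  have lead: "lead_coeff p = lead_coeff q" unfolding q lead_coeff_mult by simp
  have IH: "cmod (lead_coeff q) * (cmod z - A) ^ degree q \<le> cmod (poly q z)"
    using Suc.prems Suc.hyps(2) deg by (intro Suc.hyps(1)) (auto simp: q)
  have "cmod z - A \<le> cmod (z - \<zeta>)"
    using Suc.prems[OF \<zeta>] norm_triangle_ineq2[of z \<zeta>] by simp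
  then have "(cmod (lead_coeff q) * (cmod z - A) ^ degree q) * (cmod z - A) \<le> cmod (poly q z) * cmod (z - \<zeta>)"
    using IH assms(2) by (intro mult_mono) auto
  moreover have pz: "cmod (poly p z) = cmod (poly q z) * cmod (z - \<zeta>)"
    unfolding q by (simp add: norm_mult[symmetric] algebra_simps)
  ultimately show ?case
    unfolding lead pz unfolding deg by (simp add: mult_ac)
qed

context nonpolar_measure
begin

text \<open>All \<open>n\<close> zeros lie in the disc of radius \<open>2 B\<close> and \<open>\<gamma> n \<ge> B ^ - n\<close>, so \<open>|OP n (z)|\<close> is at least
  \<open>((|z| - 2 B) / B) ^ n\<close>. The threshold on \<open>|z|\<close> is independent of \<open>n\<close>: it makes the base at least 2 and
  its square at least \<open>2 |z|\<close>.\<close>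
lemma OP_escape:
  assumes "\<And>z. z \<in> S \<Longrightarrow> cmod z \<le> B" "B \<ge> 1" "n \<ge> 2" "4 * B + 8 * B\<^sup>2 \<le> cmod z"
  shows "2 * cmod z \<le> cmod (poly (OP n) z)"
proof -
  have B0: "B > 0" using assms(2) by simp
  define x where "x = (cmod z - 2 * B) / B"
  have sq: "0 \<le> B\<^sup>2" by simp
  have zB: "4 * B \<le> cmod z" "8 * B\<^sup>2 \<le> cmod z" using assms(4) B0 sq by linarith+
  have x2: "2 \<le> x" unfolding x_def using zB(1) B0 by (subst pos_le_divide_eq) linarith+
  have half: "cmod z / 2 \<le> cmod z - 2 * B" using zB by simp
  have "2 * cmod z \<le> x\<^sup>2"
  proof -
    have "cmod z * (8 * B\<^sup>2) \<le> cmod z * cmod z"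
      by (rule mult_left_mono[OF zB(2) norm_ge_zero])
    moreover have "(cmod z / 2)\<^sup>2 \<le> (cmod z - 2 * B)\<^sup>2"
      by (rule power_mono[OF half]) simp
    ultimately have "2 * cmod z * B\<^sup>2 \<le> (cmod z - 2 * B)\<^sup>2"
      by (simp add: power2_eq_square)
    moreover have "0 < B\<^sup>2" using B0 by simp
    ultimately show ?thesis
      unfolding x_def power_divide by (subst pos_le_divide_eq)
  qed
  also have "\<dots> \<le> x ^ n" using x2 assms(3) by (intro power_increasing) auto
  also have "\<dots> \<le> (\<gamma> n * B ^ n) * x ^ n"
    using mult_right_mono[OF \<gamma>_lower_bound[OF assms(1) B0, of n], of "x ^ n"] x2 by simp
  also have "\<dots> = \<gamma> n * (cmod z - 2 * B) ^ n"
    unfolding x_def power_divide using B0 by simp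
  also have "\<dots> = cmod (lead_coeff (OP n)) * (cmod z - 2 * B) ^ degree (OP n)"
  proof -
    have l: "cmod (lead_coeff (OP n)) = \<gamma> n"
      unfolding lead_OP using \<gamma>_pos[of n] by simp
    show ?thesis unfolding l by (simp only: degree_OP)
  qed
  also have "\<dots> \<le> cmod (poly (OP n) z)"
  proof (rule poly_growth_from_zeros)
    show "cmod \<zeta> \<le> 2 * B" if "poly (OP n) \<zeta> = 0" for \<zeta>
      using OP_zeros[OF assms(1) B0 _ that] assms(3) by simp
    show "2 * B \<le> cmod z" using zB B0 by linarith
  qed
  finally show ?thesis .
qed

end

section \<open>Uniformly few preimages near a point outside the support\<close>

context nonpolar_measure
begin

text \<open>Zeros close enough to \<open>\<zeta>\<close> are almost as good as \<open>\<zeta>\<close> itself in the estimate for the polynomial \<open>q\<close> of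
  \<open>relatively_small_monic\<close>. Replacing \<open>J deg q\<close> of them by \<open>q ^ J\<close> gains a factor \<open>c ^ J\<close> with \<open>c < 1\<close>, which for large
  \<open>J\<close> outweighs the norm of \<open>OP n - w\<close> and contradicts minimality. Neither \<open>J\<close> nor the radius depends on \<open>n\<close>.\<close>
lemma few_preimages:
  assumes "\<zeta> \<in> outside S" "R \<ge> 0"
  obtains \<rho> N where "\<rho> > 0"
    "\<And>n w r. n \<ge> 1 \<Longrightarrow> cmod w \<le> R \<Longrightarrow> OP n - [:w:] = smult (complex_of_real (\<gamma> n)) (\<Prod>i<n. [:- r i, 1:]) \<Longrightarrow>
       card {i. i < n \<and> r i \<in> ball \<zeta> \<rho>} \<le> N"
proof -
  obtain q q0 where q: "lead_coeff q = 1" "0 \<le> q0" "q0 < 1"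
    "\<And>z. z \<in> S \<Longrightarrow> cmod (poly q z) \<le> q0 * cmod (z - \<zeta>) ^ degree q"
    using relatively_small_monic[OF \<mu>_props(2) S_nonempty assms(1)] by blast
  define m where "m = degree q"
  define d where "d = infdist \<zeta> S"
  have "\<zeta> \<notin> S" using assms(1) outside_no_overlap[of S] by blast
  then have d: "d > 0"
    using in_closed_iff_infdist_zero[OF compact_imp_closed[OF \<mu>_props(2)] S_nonempty, of \<zeta>] infdist_nonneg[of \<zeta> S]
    by (simp add: d_def)
  have dist: "d \<le> cmod (z - \<zeta>)" if "z \<in> S" for z
    using infdist_le[OF that, of \<zeta>] by (simp add: d_def dist_norm norm_minus_commute)
  have "((\<lambda>\<eta>. (1 + \<eta>) ^ m * q0) \<longlongrightarrow> (1 + 0) ^ m * q0) (at_right 0)"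
    by (intro tendsto_intros)
  then have "eventually (\<lambda>\<eta>. (1 + \<eta>) ^ m * q0 < 1) (at_right 0)"
    using q(3) by (intro order_tendstoD(2)) auto
  moreover have "eventually (\<lambda>\<eta>::real. \<eta> > 0) (at_right 0)"
    by (rule eventually_at_right_less)
  ultimately have "eventually (\<lambda>\<eta>. (1 + \<eta>) ^ m * q0 < 1 \<and> \<eta> > 0) (at_right 0)"
    by (rule eventually_conj)
  then obtain \<eta> where \<eta>: "(1 + \<eta>) ^ m * q0 < 1" "\<eta> > 0"
    using eventually_happens'[OF trivial_limit_at_right_real] by blast
  define c where "c = (1 + \<eta>) ^ m * q0"
  have c: "0 \<le> c" "c < 1" using \<eta> q(2) by (simp_all add: c_def)
  have "(\<lambda>j. (c\<^sup>2) ^ j * (1 + R\<^sup>2)) \<longlonglongrightarrow> 0 * (1 + R\<^sup>2)"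
  proof (intro tendsto_mult tendsto_const LIMSEQ_realpow_zero)
    show "0 \<le> c\<^sup>2" by simp
    show "c\<^sup>2 < 1" using c by (simp add: abs_square_less_1)
  qed
  then have "eventually (\<lambda>j. (c\<^sup>2) ^ j * (1 + R\<^sup>2) < 1) sequentially"
    by (intro order_tendstoD(2)) auto
  then obtain J where J: "(c\<^sup>2) ^ J * (1 + R\<^sup>2) < 1"
    by (auto simp: eventually_sequentially)
  \<comment> \<open>The solution of \<open>\<rho> = \<eta> (d - \<rho>)\<close>: moving \<open>\<zeta>\<close> by less than \<open>\<rho>\<close> changes distances to \<open>S\<close> at most by the factor \<open>1 + \<eta>\<close>.\<close>
  define \<rho> where "\<rho> = \<eta> * d / (1 + \<eta>)"
  have \<rho>: "\<rho> > 0" using d \<eta>(2) by (simp add: \<rho>_def)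
  have \<rho>_eq: "\<rho> = \<eta> * (d - \<rho>)" using \<eta>(2) by (simp add: \<rho>_def field_simps)
  have near: "cmod (z - \<zeta>) \<le> (1 + \<eta>) * cmod (z - a)" if "z \<in> S" "a \<in> ball \<zeta> \<rho>" for z a
  proof -
    have a: "cmod (\<zeta> - a) < \<rho>" using that(2) by (simp add: dist_norm)
    have 1: "cmod (z - \<zeta>) \<le> cmod (z - a) + cmod (\<zeta> - a)"
      using norm_triangle_ineq[of "z - a" "a - \<zeta>"] by (simp add: norm_minus_commute)
    then have "d - \<rho> \<le> cmod (z - a)" using dist[OF that(1)] a by linarith
    then have "\<rho> \<le> \<eta> * cmod (z - a)"
      using \<rho>_eq \<eta>(2) by (metis mult_left_mono less_imp_le)
    then show ?thesis using 1 a by (simp add: distrib_right)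
  qed
  have "card {i. i < n \<and> r i \<in> ball \<zeta> \<rho>} \<le> m * J"
    if n: "n \<ge> 1" and w: "cmod w \<le> R" and fac: "OP n - [:w:] = smult (complex_of_real (\<gamma> n)) (\<Prod>i<n. [:- r i, 1:])"
    for n w r
  proof (rule ccontr)
    assume "\<not> ?thesis"
    then have "m * J \<le> card {i. i < n \<and> r i \<in> ball \<zeta> \<rho>}" by simp
    then obtain I where I: "I \<subseteq> {i. i < n \<and> r i \<in> ball \<zeta> \<rho>}" "card I = m * J" "finite I"
      by (rule obtain_subset_with_card_n)
    define H where "H = (\<Prod>i\<in>I. [:- r i, 1:])"
    define G where "G = smult (complex_of_real (\<gamma> n)) (\<Prod>i\<in>{..<n} - I. [:- r i, 1:])"
    have In: "I \<subseteq> {..<n}" using I(1) by auto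
    have HG: "OP n - [:w:] = H * G"
      unfolding fac H_def G_def using prod.subset_diff[OF In finite_lessThan, of "\<lambda>i. [:- r i, 1:]"]
      by (simp add: mult.commute)
    have leadH: "lead_coeff H = 1" unfolding H_def by (simp add: lead_coeff_prod)
    have degH: "degree H = m * J"
      unfolding H_def using I(2) by (subst degree_prod_eq_sum_degree) auto
    have "1 \<le> (c ^ J)\<^sup>2 * (1 + (cmod w)\<^sup>2)"
    proof (rule OP_factor_replacement[OF n HG leadH, of "q ^ J"])
      show "lead_coeff (q ^ J) = 1" using q(1) by (simp only: lead_coeff_power power_one)
      have "q \<noteq> 0" using q(1) by auto
      then show "degree (q ^ J) = degree H" unfolding degH m_def by (simp add: degree_power_eq mult.commute)
      fix z assume z: "z \<in> S"
      have "cmod (poly (q ^ J) z) = cmod (poly q z) ^ J" by (simp add: norm_power)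
      also have "\<dots> \<le> (q0 * cmod (z - \<zeta>) ^ m) ^ J"
        using q(4)[OF z] unfolding m_def by (intro power_mono) auto
      also have "\<dots> = q0 ^ J * cmod (z - \<zeta>) ^ (m * J)"
        by (simp add: power_mult_distrib power_mult)
      also have "cmod (z - \<zeta>) ^ (m * J) = (\<Prod>i\<in>I. cmod (z - \<zeta>))" using I(2) by simp
      also have "q0 ^ J * (\<Prod>i\<in>I. cmod (z - \<zeta>)) \<le> q0 ^ J * (\<Prod>i\<in>I. (1 + \<eta>) * cmod (z - r i))"
        using near[OF z] I(1) q(2) by (intro mult_left_mono prod_mono) auto
      also have "(\<Prod>i\<in>I. (1 + \<eta>) * cmod (z - r i)) = (1 + \<eta>) ^ (m * J) * cmod (poly H z)"
        using I(2) by (simp add: prod.distrib H_def poly_prod prod_norm)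
      also have "q0 ^ J * ((1 + \<eta>) ^ (m * J) * cmod (poly H z)) = c ^ J * cmod (poly H z)"
      proof -
        have "(1 + \<eta>) ^ (m * J) = ((1 + \<eta>) ^ m) ^ J" by (rule power_mult)
        then show ?thesis by (simp add: c_def power_mult_distrib mult_ac)
      qed
      finally show "cmod (poly (q ^ J) z) \<le> c ^ J * cmod (poly H z)" .
    qed
    also have "\<dots> \<le> (c ^ J)\<^sup>2 * (1 + R\<^sup>2)"
      using w by (intro mult_left_mono add_left_mono power_mono) auto
    also have "(c ^ J)\<^sup>2 = (c\<^sup>2) ^ J" by (simp only: power_mult[symmetric] mult.commute)
    finally show False using J by simp
  qed
  then show ?thesis using that[OF \<rho>] by blast
qed

end

section \<open>Circle means of the logarithm\<close>

text \<open>The mean value property at 0 of the harmonic function \<open>Re (Ln (1 + a u))\<close>, from Cauchy's formula.\<close>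
lemma circle_mean_Ln:
  assumes "cmod a < 1"
  shows "((\<lambda>\<theta>. ln (cmod (1 + a * exp (2 * of_real pi * \<i> * of_real \<theta>)))) has_integral 0) {0..1}"
proof -
  have small: "cmod (a * u) < 1" if "u \<in> cball 0 1" for u
  proof -
    have "cmod (a * u) \<le> cmod a * 1" unfolding norm_mult using that by (intro mult_left_mono) auto
    then show ?thesis using assms by simp
  qed
  have slit: "1 + a * u \<notin> \<real>\<^sub>\<le>\<^sub>0" if "u \<in> cball 0 1" for u
  proof -
    have "\<bar>Re (a * u)\<bar> < 1" using abs_Re_le_cmod[of "a * u"] small[OF that] by linarith
    then show ?thesis by (auto simp: complex_nonpos_Reals_iff)
  qed
  have "(\<lambda>u. Ln (1 + a * u)) holomorphic_on cball 0 1"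
    using slit by (intro holomorphic_intros) auto
  then have "((\<lambda>u. Ln (1 + a * u) / (u - 0)) has_contour_integral 2 * of_real pi * \<i> * Ln (1 + a * 0)) (circlepath 0 1)"
    by (intro Cauchy_integral_circlepath_simple) auto
  then have "((\<lambda>x. Ln (1 + a * circlepath 0 1 x) / circlepath 0 1 x * vector_derivative (circlepath 0 1) (at x within {0..1})) has_integral 0) {0..1}"
    by (simp add: has_contour_integral_def)
  then have "((\<lambda>x. (2 * of_real pi * \<i>) * Ln (1 + a * exp (2 * of_real pi * \<i> * of_real x))) has_integral 0) {0..1}"
  proof (rule has_integral_eq[rotated])
    fix x :: real assume x: "x \<in> {0..1}"
    have v: "vector_derivative (circlepath 0 1) (at x within {0..1}) = 2 * of_real pi * \<i> * exp (2 * of_real pi * \<i> * of_real x)"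
      using vector_derivative_circlepath01[of x 0 1] x by simp
    have e: "circlepath 0 1 x = exp (2 * of_real pi * \<i> * of_real x)"
      by (simp add: circlepath)
    show "Ln (1 + a * circlepath 0 1 x) / circlepath 0 1 x * vector_derivative (circlepath 0 1) (at x within {0..1})
      = (2 * of_real pi * \<i>) * Ln (1 + a * exp (2 * of_real pi * \<i> * of_real x))"
      unfolding v e by simp
  qed
  from has_integral_mult_right[OF this, of "1 / (2 * of_real pi * \<i>)"]
  have "((\<lambda>x. Ln (1 + a * exp (2 * of_real pi * \<i> * of_real x))) has_integral 0) {0..1}"
    by simp
  from has_integral_linear[OF this bounded_linear_Re]
  have "((\<lambda>x. Re (Ln (1 + a * exp (2 * of_real pi * \<i> * of_real x)))) has_integral 0) {0..1}"
    by (simp add: o_def)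
  then show ?thesis
  proof (rule has_integral_eq[rotated])
    fix x :: real assume "x \<in> {0..1}"
    have "1 + a * exp (2 * of_real pi * \<i> * of_real x) \<noteq> 0"
      using slit[of "exp (2 * of_real pi * \<i> * of_real x)"] by (auto simp: norm_exp_eq_Re)
    then show "Re (Ln (1 + a * exp (2 * of_real pi * \<i> * of_real x))) = ln (cmod (1 + a * exp (2 * of_real pi * \<i> * of_real x)))"
      by simp
  qed
qed

definition unit_circle :: "real \<Rightarrow> complex" where
  "unit_circle \<theta> = exp (2 * of_real pi * \<i> * of_real \<theta>)"

lemma norm_unit_circle: "cmod (unit_circle \<theta>) = 1"
  by (simp add: unit_circle_def norm_exp_eq_Re)

lemma continuous_unit_circle: "continuous_on A unit_circle"
  unfolding unit_circle_def[abs_def] by (intro continuous_intros)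

text \<open>The mean of \<open>ln |x + \<cdot>|\<close> over a circle of radius \<open>\<rho>\<close> around 0 is \<open>max (ln |x|) (ln \<rho>)\<close>. Dividing by the larger of \<open>x\<close> and
  \<open>\<rho>\<close> reduces both cases to \<open>circle_mean_Ln\<close>.\<close>
lemma circle_mean_log:
  assumes "x \<noteq> 0" "\<rho> \<ge> 0" "\<rho> \<noteq> cmod x"
  shows "\<exists>c\<ge>ln (cmod x). ((\<lambda>\<theta>. ln (cmod (x + of_real \<rho> * unit_circle \<theta>))) has_integral c) {0..1}"
proof (cases "\<rho> < cmod x")
  case True
  define a where "a = of_real \<rho> / x"
  have a: "cmod a < 1" using True assms by (simp add: a_def norm_divide)
  have "((\<lambda>\<theta>. ln (cmod x) + ln (cmod (1 + a * unit_circle \<theta>))) has_integral ln (cmod x) + 0) {0..1}"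
    using has_integral_const_real[of "ln (cmod x)" 0 1] circle_mean_Ln[OF a] unfolding unit_circle_def
    by (intro has_integral_add) auto
  moreover have "ln (cmod x) + ln (cmod (1 + a * unit_circle \<theta>)) = ln (cmod (x + of_real \<rho> * unit_circle \<theta>))" for \<theta>
  proof -
    have "cmod (a * unit_circle \<theta>) < 1" using a by (simp add: norm_mult norm_unit_circle)
    then have nz: "1 + a * unit_circle \<theta> \<noteq> 0"
      by (metis add_eq_0_iff norm_minus_cancel norm_one less_irrefl)
    have "x + of_real \<rho> * unit_circle \<theta> = x * (1 + a * unit_circle \<theta>)"
      using assms(1) by (simp add: a_def field_simps)
    then show ?thesis using assms(1) nz by (simp add: norm_mult ln_mult_pos)
  qed
  ultimately show ?thesis by (intro exI[of _ "ln (cmod x)"]) simp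
next
  case False
  then have \<rho>: "cmod x < \<rho>" "\<rho> > 0" using assms norm_ge_zero[of x] by linarith+
  define a where "a = cnj (x / of_real \<rho>)"
  have a: "cmod a < 1" using \<rho> by (simp add: a_def norm_divide)
  have "((\<lambda>\<theta>. ln \<rho> + ln (cmod (1 + a * unit_circle \<theta>))) has_integral ln \<rho> + 0) {0..1}"
    using has_integral_const_real[of "ln \<rho>" 0 1] circle_mean_Ln[OF a] unfolding unit_circle_def
    by (intro has_integral_add) auto
  moreover have "ln \<rho> + ln (cmod (1 + a * unit_circle \<theta>)) = ln (cmod (x + of_real \<rho> * unit_circle \<theta>))" for \<theta>
  proof -
    have "cmod (a * unit_circle \<theta>) < 1" using a by (simp add: norm_mult norm_unit_circle)
    then have nz: "1 + a * unit_circle \<theta> \<noteq> 0"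
      by (metis add_eq_0_iff norm_minus_cancel norm_one less_irrefl)
    have u: "unit_circle \<theta> * cnj (unit_circle \<theta>) = 1"
      using complex_norm_square[of "unit_circle \<theta>"] by (simp add: norm_unit_circle)
    \<comment> \<open>Conjugation inside the modulus brings the unit circle variable back to the numerator.\<close>
    have "x + of_real \<rho> * unit_circle \<theta> = of_real \<rho> * unit_circle \<theta> * cnj (1 + a * unit_circle \<theta>)"
      using u \<rho>(2) by (simp add: a_def algebra_simps)
    then have "cmod (x + of_real \<rho> * unit_circle \<theta>) = \<rho> * cmod (1 + a * unit_circle \<theta>)"
      using \<rho>(2) by (simp only: norm_mult norm_unit_circle complex_mod_cnj norm_of_real)
    then show ?thesis using \<rho>(2) nz by (simp add: ln_mult_pos)
  qed
  moreover have "ln (cmod x) \<le> ln \<rho>" using \<rho> assms(1) by simp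
  ultimately show ?thesis by (intro exI[of _ "ln \<rho>"]) simp
qed

lemma nn_integral_continuous_unit:
  fixes g :: "real \<Rightarrow> real"
  assumes "(g has_integral I) {0..1}" "continuous_on UNIV g" "\<And>\<theta>. 0 \<le> g \<theta>"
  shows "(\<integral>\<^sup>+\<theta>. ennreal (g \<theta>) * indicator {0..1} \<theta> \<partial>lborel) = ennreal I"
proof -
  let ?f = "\<lambda>\<theta>. if \<theta> \<in> {0..1} then g \<theta> else 0"
  have [measurable]: "g \<in> borel_measurable borel" by (rule borel_measurable_continuous_onI[OF assms(2)])
  have "(\<integral>\<^sup>+\<theta>. ennreal (?f \<theta>) \<partial>lborel) = ennreal I"
  proof (rule nn_integral_has_integral_lborel)
    show "?f \<in> borel_measurable borel" by measurable
    show "(?f has_integral I) UNIV" using assms(1) by (simp only: has_integral_restrict_UNIV)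
  qed (use assms(3) in auto)
  moreover have "ennreal (?f \<theta>) = ennreal (g \<theta>) * indicator {0..1} \<theta>" for \<theta>
    by (simp add: indicator_def)
  ultimately show ?thesis by simp
qed

lemma circle_mean_kernel:
  assumes "x \<noteq> 0" "\<rho> \<ge> 0" "\<rho> \<noteq> cmod x" "D > 0" "\<And>\<theta>. cmod (x + of_real \<rho> * unit_circle \<theta>) \<le> D"
  shows "(\<integral>\<^sup>+\<theta>. log_kernel D (x + of_real \<rho> * unit_circle \<theta>) 0 * indicator {0..1} \<theta> \<partial>lborel) \<le> log_kernel D x 0"
proof -
  obtain c where c: "ln (cmod x) \<le> c" "((\<lambda>\<theta>. ln (cmod (x + of_real \<rho> * unit_circle \<theta>))) has_integral c) {0..1}"
    using circle_mean_log[OF assms(1-3)] by blast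
  have nz: "x + of_real \<rho> * unit_circle \<theta> \<noteq> 0" for \<theta>
  proof
    assume "x + of_real \<rho> * unit_circle \<theta> = 0"
    then have "x = - (of_real \<rho> * unit_circle \<theta>)" by (simp add: add_eq_0_iff2)
    then have "cmod x = \<rho>" using assms(2) by (simp add: norm_mult norm_unit_circle)
    then show False using assms(3) by simp
  qed
  let ?g = "\<lambda>\<theta>. ln D - ln (cmod (x + of_real \<rho> * unit_circle \<theta>))"
  have kernel: "log_kernel D (x + of_real \<rho> * unit_circle \<theta>) 0 = ennreal (?g \<theta>)" for \<theta>
    using nz[of \<theta>] assms(4) by (simp add: log_kernel_def ln_div)
  have "(?g has_integral ln D - c) {0..1}"
    using has_integral_const_real[of "ln D" 0 1] c(2) by (intro has_integral_diff) auto
  moreover have "continuous_on UNIV ?g"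
    using nz by (intro continuous_on_diff continuous_on_const continuous_on_ln continuous_on_norm continuous_on_add continuous_on_mult continuous_unit_circle) auto
  moreover have nonneg: "0 \<le> ?g \<theta>" for \<theta>
  proof -
    have "0 < cmod (x + of_real \<rho> * unit_circle \<theta>)" using nz by simp
    then show ?thesis using assms(5)[of \<theta>] assms(4) by simp
  qed
  ultimately have "(\<integral>\<^sup>+\<theta>. ennreal (?g \<theta>) * indicator {0..1} \<theta> \<partial>lborel) = ennreal (ln D - c)"
    by (intro nn_integral_continuous_unit)
  also have "\<dots> \<le> ennreal (ln D - ln (cmod x))" using c(1) by (intro ennreal_leI) simp
  also have "\<dots> = log_kernel D x 0" using assms(1,4) by (simp add: log_kernel_def ln_div)
  finally show ?thesis by (simp only: kernel)
qed

text \<open>The cross term is a multiple of the mean of the unit circle, which vanishes by Cauchy's theorem.\<close>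
lemma circle_mean_square:
  "(\<integral>\<^sup>+\<theta>. ennreal ((cmod (x + of_real \<rho> * unit_circle \<theta>))\<^sup>2) * indicator {0..1} \<theta> \<partial>lborel) = ennreal ((cmod x)\<^sup>2 + \<rho>\<^sup>2)"
proof -
  have "((\<lambda>u. 1) has_contour_integral 0) (circlepath 0 1)"
    by (rule Cauchy_theorem_disc_simple[of _ 0 2]) (auto simp: path_image_circlepath_nonneg)
  then have "((\<lambda>x. vector_derivative (circlepath 0 1) (at x within {0..1})) has_integral 0) {0..1}"
    by (simp add: has_contour_integral_def)
  then have "((\<lambda>x. (2 * of_real pi * \<i>) * unit_circle x) has_integral 0) {0..1}"
    by (rule has_integral_eq[rotated]) (simp add: vector_derivative_circlepath01 unit_circle_def)
  from has_integral_mult_right[OF this, of "1 / (2 * of_real pi * \<i>)"]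
  have "((\<lambda>\<theta>. unit_circle \<theta>) has_integral 0) {0..1}" by simp
  from has_integral_mult_right[OF this, of "2 * of_real \<rho> * cnj x"]
  have "((\<lambda>\<theta>. 2 * of_real \<rho> * cnj x * unit_circle \<theta>) has_integral 0) {0..1}" by simp
  from has_integral_linear[OF this bounded_linear_Re]
  have re: "((\<lambda>\<theta>. Re (2 * of_real \<rho> * cnj x * unit_circle \<theta>)) has_integral 0) {0..1}" by (simp add: o_def)
  have const: "((\<lambda>\<theta>::real. (cmod x)\<^sup>2 + \<rho>\<^sup>2) has_integral ((cmod x)\<^sup>2 + \<rho>\<^sup>2)) {0..1}"
    using has_integral_const_real[of "(cmod x)\<^sup>2 + \<rho>\<^sup>2" 0 1] by simp
  note has_integral_add[OF const re]
  moreover have "((cmod x)\<^sup>2 + \<rho>\<^sup>2) + Re (2 * of_real \<rho> * cnj x * unit_circle \<theta>) = (cmod (x + of_real \<rho> * unit_circle \<theta>))\<^sup>2" for \<theta>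
  proof -
    have "(Re (unit_circle \<theta>))\<^sup>2 + (Im (unit_circle \<theta>))\<^sup>2 = 1"
      using norm_unit_circle[of \<theta>] by (simp add: cmod_def)
    then have "\<rho>\<^sup>2 * ((Re (unit_circle \<theta>))\<^sup>2 + (Im (unit_circle \<theta>))\<^sup>2) = \<rho>\<^sup>2" by simp
    then show ?thesis
      unfolding cmod_power2 by (simp add: power2_eq_square algebra_simps)
  qed
  ultimately have "((\<lambda>\<theta>. (cmod (x + of_real \<rho> * unit_circle \<theta>))\<^sup>2) has_integral ((cmod x)\<^sup>2 + \<rho>\<^sup>2)) {0..1}"
    by simp
  then show ?thesis
    by (rule nn_integral_continuous_unit)
       (intro continuous_on_power continuous_on_norm continuous_on_add continuous_on_const continuous_on_mult continuous_unit_circle, simp)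
qed

section \<open>Spreading a measure away from the support increases its energy\<close>

definition annulus_point :: "real \<times> real \<Rightarrow> complex" where
  "annulus_point q = of_real (fst q) * unit_circle (snd q)"

text \<open>Radius and angle are independent and uniform. Using a whole interval of radii avoids the single radius for which
  the circle passes through the singularity of the logarithm.\<close>
definition annulus_measure :: "(real \<times> real) measure" where
  "annulus_measure = uniform_measure lborel {1..2} \<Otimes>\<^sub>M uniform_measure lborel {0..1}"

lemma unif_prob: "prob_space (uniform_measure lborel {1..2::real})" "prob_space (uniform_measure lborel {0..1::real})"
  by (auto intro!: prob_space_uniform_measure)

lemma annulus_pair: "pair_prob_space (uniform_measure lborel {1..2::real}) (uniform_measure lborel {0..1::real})"
  using unif_prob by (simp add: pair_prob_space_def pair_sigma_finite_def prob_space_imp_sigma_finite)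

lemma sets_annulus: "sets annulus_measure = sets borel"
proof -
  have "sets annulus_measure = sets (borel \<Otimes>\<^sub>M borel)"
    unfolding annulus_measure_def by (intro sets_pair_measure_cong) auto
  then show ?thesis unfolding borel_prod .
qed

lemma prob_annulus: "prob_space annulus_measure"
proof -
  interpret pair_prob_space "uniform_measure lborel {1..2::real}" "uniform_measure lborel {0..1::real}"
    by (rule annulus_pair)
  show ?thesis unfolding annulus_measure_def by (rule P.prob_space_axioms)
qed

lemma borel_measurable_annulus_point [measurable]: "annulus_point \<in> borel_measurable borel"
  unfolding annulus_point_def[abs_def]
  by (intro borel_measurable_continuous_onI continuous_intros continuous_on_compose2[OF continuous_unit_circle[of UNIV]]) auto

lemma nn_integral_annulus:
  assumes "f \<in> borel_measurable borel"
  shows "(\<integral>\<^sup>+q. f (annulus_point q) \<partial>annulus_measure)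
    = (\<integral>\<^sup>+s. (\<integral>\<^sup>+\<theta>. f (of_real s * unit_circle \<theta>) * indicator {0..1} \<theta> \<partial>lborel) * indicator {1..2} s \<partial>lborel)"
proof -
  interpret pair_prob_space "uniform_measure lborel {1..2::real}" "uniform_measure lborel {0..1::real}"
    by (rule annulus_pair)
  have m: "(\<lambda>q. f (annulus_point q)) \<in> borel_measurable (borel \<Otimes>\<^sub>M borel)"
    using measurable_compose[OF borel_measurable_annulus_point assms] by (simp add: borel_prod)
  have sets: "sets (uniform_measure lborel {1..2::real} \<Otimes>\<^sub>M uniform_measure lborel {0..1::real}) = sets (borel \<Otimes>\<^sub>M borel)"
    by (intro sets_pair_measure_cong) auto
  have m': "(\<lambda>q. f (annulus_point q)) \<in> borel_measurable (uniform_measure lborel {1..2::real} \<Otimes>\<^sub>M uniform_measure lborel {0..1::real})"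
    using m by (subst measurable_cong_sets[OF sets refl])
  have inner: "(\<lambda>\<theta>. f (of_real s * unit_circle \<theta>)) \<in> borel_measurable lborel" for s
    using measurable_compose[OF _ assms, of "\<lambda>\<theta>. of_real s * unit_circle \<theta>" borel]
      borel_measurable_continuous_onI[of "\<lambda>\<theta>. of_real s * unit_circle \<theta>"] continuous_unit_circle
    by (simp add: continuous_on_mult)
  have inner_int: "(\<integral>\<^sup>+\<theta>. f (of_real s * unit_circle \<theta>) \<partial>uniform_measure lborel {0..1::real})
    = (\<integral>\<^sup>+\<theta>. f (of_real s * unit_circle \<theta>) * indicator {0..1} \<theta> \<partial>lborel)" for s
    using inner by (subst nn_integral_uniform_measure) (auto simp: divide_ennreal_def)
  have "(\<integral>\<^sup>+q. f (annulus_point q) \<partial>annulus_measure)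
    = (\<integral>\<^sup>+s. \<integral>\<^sup>+\<theta>. f (of_real s * unit_circle \<theta>) \<partial>uniform_measure lborel {0..1::real} \<partial>uniform_measure lborel {1..2::real})"
    unfolding annulus_measure_def by (subst M2.nn_integral_fst[OF m', symmetric]) (simp add: annulus_point_def)
  also have "\<dots> = (\<integral>\<^sup>+s. (\<integral>\<^sup>+\<theta>. f (of_real s * unit_circle \<theta>) \<partial>uniform_measure lborel {0..1::real}) * indicator {1..2} s \<partial>lborel)"
  proof (subst nn_integral_uniform_measure)
    have "(\<lambda>s. \<integral>\<^sup>+\<theta>. f (annulus_point (s, \<theta>)) \<partial>uniform_measure lborel {0..1::real}) \<in> borel_measurable (uniform_measure lborel {1..2::real})"
      using M2.borel_measurable_nn_integral_fst[OF m'] by simp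
    then show "(\<lambda>s. \<integral>\<^sup>+\<theta>. f (of_real s * unit_circle \<theta>) \<partial>uniform_measure lborel {0..1::real}) \<in> borel_measurable lborel"
      by (simp add: annulus_point_def)
  qed (auto simp: divide_ennreal_def)
  finally show ?thesis unfolding inner_int .
qed

lemma annulus_mean_kernel:
  assumes "x \<noteq> 0" "c \<ge> 0" "D > 0" "\<And>\<xi>. cmod \<xi> \<le> 2 \<Longrightarrow> cmod (x + of_real c * \<xi>) \<le> D"
  shows "(\<integral>\<^sup>+q. log_kernel D (x + of_real c * annulus_point q) 0 \<partial>annulus_measure) \<le> log_kernel D x 0"
proof (cases "c = 0")
  case True
  interpret prob_space annulus_measure by (rule prob_annulus)
  show ?thesis using True by (simp add: emeasure_space_1)
next
  case False
  have "(\<lambda>\<xi>. log_kernel D (x + of_real c * \<xi>) 0) \<in> borel_measurable borel" by measurable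
  from nn_integral_annulus[OF this]
  have "(\<integral>\<^sup>+q. log_kernel D (x + of_real c * annulus_point q) 0 \<partial>annulus_measure)
    = (\<integral>\<^sup>+s. (\<integral>\<^sup>+\<theta>. log_kernel D (x + of_real c * (of_real s * unit_circle \<theta>)) 0 * indicator {0..1} \<theta> \<partial>lborel) * indicator {1..2} s \<partial>lborel)" .
  also have "\<dots> \<le> (\<integral>\<^sup>+s. log_kernel D x 0 * indicator {1..2::real} s \<partial>lborel)"
  proof (rule nn_integral_mono_AE)
    show "AE s in lborel. (\<integral>\<^sup>+\<theta>. log_kernel D (x + of_real c * (of_real s * unit_circle \<theta>)) 0 * indicator {0..1} \<theta> \<partial>lborel) * indicator {1..2} s
      \<le> log_kernel D x 0 * indicator {1..2::real} s"
      using AE_lborel_singleton[of "cmod x / c"]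
    proof eventually_elim
      case (elim s)
      show ?case
      proof (cases "s \<in> {1..2}")
        case True
        have "(\<integral>\<^sup>+\<theta>. log_kernel D (x + of_real (c * s) * unit_circle \<theta>) 0 * indicator {0..1} \<theta> \<partial>lborel) \<le> log_kernel D x 0"
        proof (rule circle_mean_kernel[OF assms(1) _ _ assms(3)])
          show "c * s \<ge> 0" using assms(2) True by simp
          show "c * s \<noteq> cmod x" using elim False by (auto simp: field_simps)
          show "cmod (x + of_real (c * s) * unit_circle \<theta>) \<le> D" for \<theta>
            using assms(4)[of "of_real s * unit_circle \<theta>"] True by (simp add: norm_mult norm_unit_circle mult.assoc)
        qed
        then show ?thesis using True by (simp add: mult.assoc)
      qed simp
    qed
  qed
  also have "\<dots> = log_kernel D x 0"
    by (subst nn_integral_cmult_indicator) auto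
  finally show ?thesis .
qed

lemma annulus_mean_square:
  "ennreal ((cmod x)\<^sup>2 + c\<^sup>2) \<le> (\<integral>\<^sup>+q. ennreal ((cmod (x + of_real c * annulus_point q))\<^sup>2) \<partial>annulus_measure)"
proof -
  have "(\<lambda>\<xi>. ennreal ((cmod (x + of_real c * \<xi>))\<^sup>2)) \<in> borel_measurable borel" by measurable
  from nn_integral_annulus[OF this]
  have "(\<integral>\<^sup>+q. ennreal ((cmod (x + of_real c * annulus_point q))\<^sup>2) \<partial>annulus_measure)
    = (\<integral>\<^sup>+s. (\<integral>\<^sup>+\<theta>. ennreal ((cmod (x + of_real (c * s) * unit_circle \<theta>))\<^sup>2) * indicator {0..1} \<theta> \<partial>lborel) * indicator {1..2} s \<partial>lborel)"
    by (simp add: mult.assoc)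
  also have "\<dots> = (\<integral>\<^sup>+s. ennreal ((cmod x)\<^sup>2 + (c * s)\<^sup>2) * indicator {1..2} s \<partial>lborel)"
    by (simp only: circle_mean_square)
  also have "\<dots> \<ge> (\<integral>\<^sup>+s. ennreal ((cmod x)\<^sup>2 + c\<^sup>2) * indicator {1..2::real} s \<partial>lborel)"
  proof (rule nn_integral_mono)
    fix s :: real
    have "c\<^sup>2 \<le> (c * s)\<^sup>2" if "s \<in> {1..2}"
    proof -
      have "c\<^sup>2 * 1 \<le> c\<^sup>2 * s\<^sup>2" using that by (intro mult_left_mono) auto
      then show ?thesis by (simp add: power_mult_distrib)
    qed
    then show "ennreal ((cmod x)\<^sup>2 + c\<^sup>2) * indicator {1..2} s \<le> ennreal ((cmod x)\<^sup>2 + (c * s)\<^sup>2) * indicator {1..2} s"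
      by (auto simp: indicator_def intro!: ennreal_leI)
  qed
  finally show ?thesis by (subst (asm) nn_integral_cmult_indicator) auto
qed

text \<open>Each point \<open>z\<close> is smeared over the annulus of radii \<open>c(z)\<close> and \<open>2 c(z)\<close> around it.\<close>
definition spread :: "(complex \<Rightarrow> real) \<Rightarrow> complex measure \<Rightarrow> complex measure" where
  "spread c \<sigma> = distr (\<sigma> \<Otimes>\<^sub>M annulus_measure) borel (\<lambda>p. fst p + of_real (c (fst p)) * annulus_point (snd p))"

lemma spread_measurable:
  assumes "borel_prob \<sigma>" "c \<in> borel_measurable borel"
  shows "(\<lambda>p. fst p + of_real (c (fst p)) * annulus_point (snd p)) \<in> borel_measurable (\<sigma> \<Otimes>\<^sub>M annulus_measure)"
proof -
  have "(\<lambda>p. c (fst p)) \<in> borel_measurable (borel \<Otimes>\<^sub>M borel)"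
    using measurable_compose[OF measurable_fst assms(2)] .
  moreover have "(\<lambda>p. annulus_point (snd p)) \<in> borel_measurable (borel \<Otimes>\<^sub>M borel)"
    using measurable_compose[OF measurable_snd borel_measurable_annulus_point] .
  ultimately have "(\<lambda>p. fst p + of_real (c (fst p)) * annulus_point (snd p)) \<in> borel_measurable (borel \<Otimes>\<^sub>M borel)"
    by measurable
  then show ?thesis
    using borel_prob_simps[OF assms(1)] sets_annulus
    by (subst measurable_cong_sets[OF sets_pair_measure_cong refl]) auto
qed

lemma nn_integral_spread:
  assumes "borel_prob \<sigma>" "c \<in> borel_measurable borel" "f \<in> borel_measurable borel"
  shows "(\<integral>\<^sup>+z. f z \<partial>spread c \<sigma>) = (\<integral>\<^sup>+z. \<integral>\<^sup>+q. f (z + of_real (c z) * annulus_point q) \<partial>annulus_measure \<partial>\<sigma>)"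
proof -
  interpret A: prob_space annulus_measure by (rule prob_annulus)
  have "(\<integral>\<^sup>+z. f z \<partial>spread c \<sigma>) = (\<integral>\<^sup>+p. f (fst p + of_real (c (fst p)) * annulus_point (snd p)) \<partial>(\<sigma> \<Otimes>\<^sub>M annulus_measure))"
    unfolding spread_def using spread_measurable[OF assms(1,2)] assms(3) by (intro nn_integral_distr) auto
  then show ?thesis
    using A.nn_integral_fst[OF measurable_compose[OF spread_measurable[OF assms(1,2)] assms(3)]] by simp
qed

lemma norm_annulus_point: "AE q in annulus_measure. cmod (annulus_point q) \<le> 2"
proof -
  have m: "(\<lambda>q. indicator (- cball 0 2) (annulus_point q) :: ennreal) \<in> borel_measurable annulus_measure"
    using measurable_compose[OF borel_measurable_annulus_point, of "\<lambda>z. indicator (- cball 0 2) z :: ennreal" borel] sets_annulus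
    by (subst measurable_cong_sets[OF sets_annulus refl]) simp
  have im: "(\<lambda>z. indicator (- cball 0 2) z :: ennreal) \<in> borel_measurable (borel :: complex measure)" by simp
  have "(\<integral>\<^sup>+q. indicator (- cball 0 2) (annulus_point q) \<partial>annulus_measure) = 0"
    unfolding nn_integral_annulus[OF im]
  proof -
    have z: "(\<integral>\<^sup>+\<theta>. indicator (- cball 0 2) (of_real s * unit_circle \<theta>) * indicator {0..1} \<theta> \<partial>lborel) * indicator {1..2} s = (0::ennreal)" for s :: real
      by (auto simp: indicator_def norm_mult norm_unit_circle)
    show "(\<integral>\<^sup>+s. (\<integral>\<^sup>+\<theta>. indicator (- cball 0 2) (of_real s * unit_circle \<theta>) * indicator {0..1} \<theta> \<partial>lborel) * indicator {1..2} s \<partial>lborel) = (0::ennreal)"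
      unfolding z by simp
  qed
  then have "AE q in annulus_measure. indicator (- cball 0 2) (annulus_point q) = (0::ennreal)"
    using nn_integral_0_iff_AE[OF m] by simp
  then show ?thesis by eventually_elim (auto simp: indicator_def split: if_splits)
qed

lemma prob_on_spread:
  assumes "prob_on K \<sigma>" "c \<in> borel_measurable borel" "closed K"
    "\<And>z \<xi>. z \<in> K \<Longrightarrow> cmod \<xi> \<le> 2 \<Longrightarrow> z + of_real (c z) * \<xi> \<in> K"
  shows "prob_on K (spread c \<sigma>)"
proof -
  note \<sigma> = prob_onD[OF assms(1)]
  interpret P: pair_prob_space \<sigma> annulus_measure
    using \<sigma>(2) prob_annulus by (simp add: pair_prob_space_def pair_sigma_finite_def prob_space_imp_sigma_finite)
  have K: "K \<in> sets borel" using assms(3) by simp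
  have bp: "borel_prob (spread c \<sigma>)"
    unfolding borel_prob_def spread_def
    using P.prob_space_distr[OF spread_measurable[OF \<sigma>(1) assms(2)]] by simp
  have "(\<integral>\<^sup>+z. indicator (- K) z \<partial>spread c \<sigma>) = (\<integral>\<^sup>+z. \<integral>\<^sup>+q. indicator (- K) (z + of_real (c z) * annulus_point q) \<partial>annulus_measure \<partial>\<sigma>)"
    using K by (intro nn_integral_spread \<sigma>(1) assms(2)) auto
  also have "\<dots> = (\<integral>\<^sup>+z. 0 \<partial>\<sigma>)"
  proof (rule nn_integral_cong_AE)
    show "AE z in \<sigma>. (\<integral>\<^sup>+q. indicator (- K) (z + of_real (c z) * annulus_point q) \<partial>annulus_measure) = 0"
      using \<sigma>(5)
    proof eventually_elim
      case (elim z)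
      have "(\<integral>\<^sup>+q. indicator (- K) (z + of_real (c z) * annulus_point q) \<partial>annulus_measure) = (\<integral>\<^sup>+q. 0 \<partial>annulus_measure)"
        using norm_annulus_point assms(4)[OF elim] by (intro nn_integral_cong_AE) (auto elim!: eventually_mono)
      then show ?case by simp
    qed
  qed
  finally show ?thesis
    using bp AE_iff_nn_integral[OF borel_prob_simps(2)[OF bp] K] by (simp add: prob_on_def)
qed

lemma log_kernel_translate: "log_kernel D (z - w) 0 = log_kernel D z w"
  by (simp add: log_kernel_def)

text \<open>For fixed \<open>w\<close> the kernel is superharmonic in \<open>z\<close>, so averaging over annuli around \<open>z\<close> does not increase
  it.\<close>
lemma neg_energy_spread_le:
  assumes "prob_on K \<sigma>" "prob_on K \<tau>" "c \<in> borel_measurable borel" "closed K" "D > 0" "K \<subseteq> cball 0 (D/2)"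
    "\<And>z \<xi>. z \<in> K \<Longrightarrow> cmod \<xi> \<le> 2 \<Longrightarrow> z + of_real (c z) * \<xi> \<in> K" "\<And>z. c z \<ge> 0"
  shows "neg_energy D (spread c \<sigma>) \<tau> \<le> neg_energy D \<sigma> \<tau>"
proof -
  note \<sigma> = prob_onD[OF assms(1)] and \<tau> = prob_onD[OF assms(2)]
  have sp: "borel_prob (spread c \<sigma>)"
    by (rule prob_onD(1)[OF prob_on_spread[OF assms(1,3,4,7)]])
  have "neg_energy D (spread c \<sigma>) \<tau> = (\<integral>\<^sup>+w. \<integral>\<^sup>+z. log_kernel D z w \<partial>spread c \<sigma> \<partial>\<tau>)"
    by (rule neg_energy_iterated(2)[OF sp \<tau>(1)])
  also have "\<dots> = (\<integral>\<^sup>+w. \<integral>\<^sup>+z. \<integral>\<^sup>+q. log_kernel D (z + of_real (c z) * annulus_point q) w \<partial>annulus_measure \<partial>\<sigma> \<partial>\<tau>)"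
  proof (rule nn_integral_cong)
    fix w
    have "(\<lambda>z. log_kernel D z w) \<in> borel_measurable borel" by measurable
    then show "(\<integral>\<^sup>+z. log_kernel D z w \<partial>spread c \<sigma>) = (\<integral>\<^sup>+z. \<integral>\<^sup>+q. log_kernel D (z + of_real (c z) * annulus_point q) w \<partial>annulus_measure \<partial>\<sigma>)"
      by (rule nn_integral_spread[OF \<sigma>(1) assms(3)])
  qed
  also have "\<dots> \<le> (\<integral>\<^sup>+w. \<integral>\<^sup>+z. log_kernel D z w \<partial>\<sigma> \<partial>\<tau>)"
  proof (rule nn_integral_mono_AE)
    show "AE w in \<tau>. (\<integral>\<^sup>+z. \<integral>\<^sup>+q. log_kernel D (z + of_real (c z) * annulus_point q) w \<partial>annulus_measure \<partial>\<sigma>) \<le> (\<integral>\<^sup>+z. log_kernel D z w \<partial>\<sigma>)"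
      using \<tau>(5)
    proof eventually_elim
      case (elim w)
      show ?case
      proof (rule nn_integral_mono_AE)
        show "AE z in \<sigma>. (\<integral>\<^sup>+q. log_kernel D (z + of_real (c z) * annulus_point q) w \<partial>annulus_measure) \<le> log_kernel D z w"
          using \<sigma>(5)
        proof eventually_elim
          case (elim z)
          show ?case
          proof (cases "z = w")
            case False
            have le: "cmod ((z - w) + of_real (c z) * \<xi>) \<le> D" if "cmod \<xi> \<le> 2" for \<xi>
            proof -
              have "z + of_real (c z) * \<xi> \<in> cball 0 (D/2)" "w \<in> cball 0 (D/2)"
                using assms(6) assms(7)[OF elim that] \<open>w \<in> K\<close> by auto
              then show ?thesis
                using norm_triangle_ineq4[of "z + of_real (c z) * \<xi>" w] by (simp add: algebra_simps)
            qed
            have "(\<integral>\<^sup>+q. log_kernel D ((z - w) + of_real (c z) * annulus_point q) 0 \<partial>annulus_measure) \<le> log_kernel D (z - w) 0"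
              using False by (intro annulus_mean_kernel le assms(5,8)) auto
            moreover have "log_kernel D ((z - w) + of_real (c z) * annulus_point q) 0 = log_kernel D (z + of_real (c z) * annulus_point q) w" for q
              using log_kernel_translate[of D "z + of_real (c z) * annulus_point q" w] by (simp add: algebra_simps)
            ultimately show ?thesis by (simp only: log_kernel_translate)
          qed (simp add: log_kernel_def)
        qed
      qed
    qed
  qed
  also have "\<dots> = neg_energy D \<sigma> \<tau>" by (rule neg_energy_iterated(2)[OF \<sigma>(1) \<tau>(1), symmetric])
  finally show ?thesis .
qed

text \<open>Spreading adds at least \<open>\<integral> c\<^sup>2\<close> to the second moment, which is finite.\<close>
lemma spread_fixed_imp_zero:
  assumes "prob_on K \<sigma>" "c \<in> borel_measurable borel" "K \<subseteq> cball 0 B" "spread c \<sigma> = \<sigma>"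
  shows "AE z in \<sigma>. c z = 0"
proof -
  note \<sigma> = prob_onD[OF assms(1)]
  interpret prob_space \<sigma> by fact
  have cm: "c \<in> borel_measurable \<sigma>" using assms(2) \<sigma>(3) by (auto cong: measurable_cong_sets)
  have m: "(\<lambda>z. ennreal ((cmod z)\<^sup>2)) \<in> borel_measurable \<sigma>"
    using \<sigma>(3) by (subst measurable_cong_sets[of \<sigma> borel]) auto
  let ?I = "\<integral>\<^sup>+z. ennreal ((cmod z)\<^sup>2) \<partial>\<sigma>"
  have "?I \<le> (\<integral>\<^sup>+z. ennreal (B\<^sup>2) \<partial>\<sigma>)"
  proof (rule nn_integral_mono_AE)
    show "AE z in \<sigma>. ennreal ((cmod z)\<^sup>2) \<le> ennreal (B\<^sup>2)"
      using \<sigma>(5) by eventually_elim (use assms(3) in \<open>auto intro!: ennreal_leI power_mono\<close>)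
  qed
  then have fin: "?I \<noteq> \<infinity>" by (auto simp: emeasure_space_1 top_unique)
  have "?I + (\<integral>\<^sup>+z. ennreal ((c z)\<^sup>2) \<partial>\<sigma>) = (\<integral>\<^sup>+z. ennreal ((cmod z)\<^sup>2 + (c z)\<^sup>2) \<partial>\<sigma>)"
    using m cm by (simp add: nn_integral_add)
  also have "\<dots> \<le> (\<integral>\<^sup>+z. \<integral>\<^sup>+q. ennreal ((cmod (z + of_real (c z) * annulus_point q))\<^sup>2) \<partial>annulus_measure \<partial>\<sigma>)"
    by (intro nn_integral_mono annulus_mean_square)
  also have "\<dots> = (\<integral>\<^sup>+z. ennreal ((cmod z)\<^sup>2) \<partial>spread c \<sigma>)"
    by (rule nn_integral_spread[OF \<sigma>(1) assms(2), symmetric]) measurable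
  also have "\<dots> = ?I + 0" by (simp add: assms(4))
  finally have "(\<integral>\<^sup>+z. ennreal ((c z)\<^sup>2) \<partial>\<sigma>) = 0"
    using fin by (simp only: ennreal_add_left_cancel_le) simp
  then have "AE z in \<sigma>. ennreal ((c z)\<^sup>2) = 0"
    using cm by (subst (asm) nn_integral_0_iff_AE) auto
  then show ?thesis by eventually_elim (simp add: ennreal_eq_0_iff)
qed

context nonpolar_measure
begin

abbreviation "K \<equiv> filled_support \<mu>"

lemma compact_K: "compact K"
proof -
  have "closed K"
    unfolding filled_support_def using open_outside[OF closed_msupport] by (simp add: closed_Compl)
  moreover have "bounded K"
    unfolding filled_support_def by (rule cobounded_outside[OF compact_imp_bounded[OF \<mu>_props(2)]])
  ultimately show ?thesis by (simp add: compact_eq_bounded_closed)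
qed

lemma S_subset_K: "S \<subseteq> K"
  unfolding filled_support_def using outside_no_overlap[of S] by blast

text \<open>A segment that avoids the support does not leave its component of the complement, so it cannot lead from a hole to the
  unbounded component. The annuli of radii \<open>infdist z S / 4\<close> and \<open>infdist z S / 2\<close> thus stay in the filling.\<close>
lemma K_ball:
  assumes "z \<in> K" "cmod \<xi> \<le> 2"
  shows "z + of_real (infdist z S / 4) * \<xi> \<in> K"
proof (cases "infdist z S = 0")
  case True
  then show ?thesis using assms by simp
next
  case False
  then have pos: "infdist z S > 0" using infdist_nonneg[of z S] by simp
  let ?y = "z + of_real (infdist z S / 4) * \<xi>"
  have y: "cmod (?y - z) < infdist z S"
  proof -
    have "cmod (?y - z) = infdist z S / 4 * cmod \<xi>" using pos by (simp add: norm_mult)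
    also have "\<dots> \<le> infdist z S / 4 * 2" using pos assms(2) by (intro mult_left_mono) auto
    finally show ?thesis using pos by linarith
  qed
  have seg: "closed_segment ?y z \<subseteq> - S"
  proof
    fix u assume u: "u \<in> closed_segment ?y z"
    have "dist u z \<le> dist ?y z" using dist_in_closed_segment[OF u] by (simp add: dist_commute)
    then have "dist z u < infdist z S" using y by (simp add: dist_norm norm_minus_commute)
    then show "u \<in> - S" using infdist_le[of u S z] by force
  qed
  show ?thesis
  proof (rule ccontr)
    assume "?y \<notin> K"
    then have o: "?y \<in> outside S" by (simp add: filled_support_def)
    have "connected_component (- S) ?y z"
      unfolding connected_component_def using seg by (intro exI[of _ "closed_segment ?y z"]) auto
    then have "z \<in> outside S" using outside_same_component o by blast
    then show False using assms(1) by (simp add: filled_support_def)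
  qed
qed

text \<open>Spreading the equilibrium measure of the filling within the holes keeps it in the filling and does not decrease the energy. By
  uniqueness it is unchanged, so no mass lies off \<open>S\<close>, and the maximal energies of \<open>S\<close> and of its filling agree.\<close>
theorem filled_equilibrium:
  assumes "prob_on K \<sigma>" "set_energy S \<le> energy \<sigma>"
  shows "\<sigma> = equilibrium_measure S"
proof -
  have K_np: "\<not> polar K"
    using \<mu>_props(3) set_energy_mono[OF S_subset_K] by (auto simp: polar_iff)
  note eqK = equilibrium_measure_props[OF compact_K K_np] and eqS = equilibrium_measure_props[OF \<mu>_props(2,3)]
  define \<omega> where "\<omega> = equilibrium_measure K"
  have \<omega>: "prob_on K \<omega>" "energy \<omega> = set_energy K" using eqK(1,2) by (simp_all add: \<omega>_def)
  define c where "c z = infdist z S / 4" for z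
  have c: "c \<in> borel_measurable borel"
    unfolding c_def[abs_def] by (intro borel_measurable_continuous_onI continuous_intros) simp
  obtain D where D: "D > 0" "K \<subseteq> cball 0 (D/2)" using compact_in_half_ball[OF compact_K] .
  have move: "z + of_real (c z) * \<xi> \<in> K" if "z \<in> K" "cmod \<xi> \<le> 2" for z \<xi>
    unfolding c_def by (rule K_ball[OF that])
  have c0: "c z \<ge> 0" for z by (simp add: c_def infdist_nonneg)
  have sp: "prob_on K (spread c \<omega>)"
    by (rule prob_on_spread[OF \<omega>(1) c compact_imp_closed[OF compact_K] move])
  note le = neg_energy_spread_le[OF \<omega>(1) _ c compact_imp_closed[OF compact_K] D move c0]
  have "neg_energy D (spread c \<omega>) (spread c \<omega>) \<le> neg_energy D \<omega> (spread c \<omega>)"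
    by (rule le[OF sp])
  also have "\<dots> = neg_energy D (spread c \<omega>) \<omega>"
    by (rule neg_energy_commute[OF prob_onD(1)[OF \<omega>(1)] prob_onD(1)[OF sp]])
  also have "\<dots> \<le> neg_energy D \<omega> \<omega>" by (rule le[OF \<omega>(1)])
  finally have "energy \<omega> \<le> energy (spread c \<omega>)"
    unfolding energy_eq_neg_energy[OF D(1) prob_on_mono[OF \<omega>(1) D(2)]] energy_eq_neg_energy[OF D(1) prob_on_mono[OF sp D(2)]]
    by (intro ereal_minus_mono) (auto simp: less_eq_ennreal.rep_eq)
  then have "set_energy K \<le> energy (spread c \<omega>)" by (simp only: \<omega>(2))
  then have "spread c \<omega> = \<omega>"
    by (rule eqK(3)[OF sp, folded \<omega>_def])
  then have "AE z in \<omega>. c z = 0"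
    by (rule spread_fixed_imp_zero[OF \<omega>(1) c D(2)])
  then have "AE z in \<omega>. z \<in> S"
  proof eventually_elim
    case (elim z)
    then show ?case
      using in_closed_iff_infdist_zero[OF closed_msupport S_nonempty, of z] by (simp add: c_def)
  qed
  then have \<omega>S: "prob_on S \<omega>" using prob_onD(1)[OF \<omega>(1)] by (simp add: prob_on_def)
  have "set_energy K \<le> set_energy S"
    using energy_le_set_energy[OF \<mu>_props(2) \<omega>S] \<omega>(2) by simp
  then have KS: "set_energy K = set_energy S" using set_energy_mono[OF S_subset_K] by (rule antisym)
  have "\<sigma> = \<omega>"
    unfolding \<omega>_def by (rule eqK(3)[OF assms(1)]) (use assms(2) KS in simp)
  also have "\<omega> = equilibrium_measure S"
    by (rule eqS(3)[OF \<omega>S]) (use \<omega>(2) KS in simp)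
  finally show ?thesis .
qed

end

section \<open>Julia sets of the orthonormal polynomials\<close>

lemma neg_energy_translate:
  assumes "borel_prob \<tau>"
  shows "neg_energy D (distr \<tau> borel (\<lambda>z. z + c)) (distr \<tau> borel (\<lambda>z. z + c)) = neg_energy D \<tau> \<tau>"
proof -
  note \<tau> = borel_prob_simps[OF assms]
  have m: "(\<lambda>z. z + c) \<in> borel_measurable \<tau>"
    using \<tau>(2) by (subst measurable_cong_sets[of \<tau> borel]) auto
  have bp: "borel_prob (distr \<tau> borel (\<lambda>z. z + c))"
    unfolding borel_prob_def using prob_space.prob_space_distr[OF \<tau>(1) m] by simp
  have "neg_energy D (distr \<tau> borel (\<lambda>z. z + c)) (distr \<tau> borel (\<lambda>z. z + c))
    = (\<integral>\<^sup>+z. \<integral>\<^sup>+w. log_kernel D z w \<partial>distr \<tau> borel (\<lambda>z. z + c) \<partial>distr \<tau> borel (\<lambda>z. z + c))"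
    by (rule neg_energy_iterated(1)[OF bp bp])
  also have "\<dots> = (\<integral>\<^sup>+z. \<integral>\<^sup>+w. log_kernel D (z + c) w \<partial>distr \<tau> borel (\<lambda>z. z + c) \<partial>\<tau>)"
    using log_potential_measurable[OF bp] by (intro nn_integral_distr m) auto
  also have "\<dots> = (\<integral>\<^sup>+z. \<integral>\<^sup>+w. log_kernel D (z + c) (w + c) \<partial>\<tau> \<partial>\<tau>)"
  proof (rule nn_integral_cong)
    fix z
    have "(\<lambda>w. log_kernel D (z + c) w) \<in> borel_measurable borel" by measurable
    then show "(\<integral>\<^sup>+w. log_kernel D (z + c) w \<partial>distr \<tau> borel (\<lambda>z. z + c)) = (\<integral>\<^sup>+w. log_kernel D (z + c) (w + c) \<partial>\<tau>)"
      by (intro nn_integral_distr m) auto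
  qed
  also have "\<dots> = neg_energy D \<tau> \<tau>"
  proof -
    have "log_kernel D (z + c) (w + c) = log_kernel D z w" for z w
      by (simp add: log_kernel_def)
    then show ?thesis unfolding neg_energy_iterated(1)[OF assms assms] by (simp only:)
  qed
  finally show ?thesis .
qed

context nonpolar_measure
begin

definition support_radius :: real where
  "support_radius = (SOME B. B \<ge> 1 \<and> (\<forall>z\<in>S. cmod z \<le> B))"

lemma support_radius: "support_radius \<ge> 1" "z \<in> S \<Longrightarrow> cmod z \<le> support_radius"
proof -
  obtain B where "B > 0" "\<forall>z\<in>S. cmod z \<le> B"
    using compact_imp_bounded[OF \<mu>_props(2)] by (auto simp: bounded_pos)
  then have "max B 1 \<ge> 1 \<and> (\<forall>z\<in>S. cmod z \<le> max B 1)" by auto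
  then have "support_radius \<ge> 1 \<and> (\<forall>z\<in>S. cmod z \<le> support_radius)"
    unfolding support_radius_def by (rule someI)
  then show "support_radius \<ge> 1" "z \<in> S \<Longrightarrow> cmod z \<le> support_radius" by auto
qed

abbreviation "B \<equiv> support_radius"

definition escape_radius :: real where
  "escape_radius = 4 * B + 8 * B\<^sup>2"

definition outer_radius :: real where
  "outer_radius = escape_radius + 1 + 2 * B"

lemma radii: "escape_radius > 0" "escape_radius + 1 \<le> outer_radius" "B \<le> outer_radius" "outer_radius > 0"
proof -
  have "0 \<le> B\<^sup>2" by simp
  then show "escape_radius > 0" "escape_radius + 1 \<le> outer_radius" "B \<le> outer_radius" "outer_radius > 0"
    using support_radius(1) unfolding escape_radius_def outer_radius_def by linarith+
qed

lemma OP_escape_radius: "n \<ge> 2 \<Longrightarrow> escape_radius \<le> cmod z \<Longrightarrow> 2 * cmod z \<le> cmod (poly (OP n) z)"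
  unfolding escape_radius_def by (rule OP_escape[OF support_radius(2,1)])

text \<open>A measure of finite energy beyond the escape radius. Such measures exist because translation preserves the energy.\<close>
definition far_measure :: "complex measure" where
  "far_measure = distr (equilibrium_measure S) borel (\<lambda>z. z + of_real (escape_radius + 1 + B))"

lemma far_measure:
  "prob_on {z. escape_radius + 1 \<le> cmod z \<and> cmod z \<le> outer_radius} far_measure"
  "neg_energy (2 * outer_radius) far_measure far_measure < \<infinity>"
proof -
  let ?\<tau> = "equilibrium_measure S"
  have \<tau>: "prob_on S ?\<tau>" "energy ?\<tau> = set_energy S"
    using equilibrium_measure_props(1,2)[OF \<mu>_props(2,3)] by auto
  note p = prob_onD[OF \<tau>(1)]
  let ?c = "complex_of_real (escape_radius + 1 + B)"
  have c: "cmod ?c = escape_radius + 1 + B"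
    using radii(1) support_radius(1) by (simp only: norm_of_real)
  show "prob_on {z. escape_radius + 1 \<le> cmod z \<and> cmod z \<le> outer_radius} far_measure"
    unfolding far_measure_def
  proof (rule prob_on_distr[OF p(2)])
    show "(\<lambda>z. z + ?c) \<in> borel_measurable ?\<tau>"
      using p(3) by (subst measurable_cong_sets[of ?\<tau> borel]) auto
    show "AE z in ?\<tau>. z + ?c \<in> {z. escape_radius + 1 \<le> cmod z \<and> cmod z \<le> outer_radius}"
      using p(5)
    proof eventually_elim
      case (elim z)
      have "cmod z \<le> B" by (rule support_radius(2)[OF elim])
      moreover have "cmod (z + ?c) \<le> cmod z + cmod ?c" by (rule norm_triangle_ineq)
      moreover have "cmod ?c - cmod z \<le> cmod (z + ?c)"
        using norm_diff_ineq[of ?c z] by (simp only: add.commute)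
      ultimately have "escape_radius + 1 \<le> cmod (z + ?c)" "cmod (z + ?c) \<le> outer_radius"
        unfolding c outer_radius_def by linarith+
      then show ?case by simp
    qed
    have "closed {z. escape_radius + 1 \<le> cmod z \<and> cmod z \<le> outer_radius}"
      by (intro closed_Collect_conj closed_Collect_le continuous_intros)
    then show "{z. escape_radius + 1 \<le> cmod z \<and> cmod z \<le> outer_radius} \<in> sets borel" by simp
  qed
  have on: "prob_on (cball 0 (2 * outer_radius / 2)) ?\<tau>"
    by (rule prob_on_mono[OF \<tau>(1)]) (use support_radius(2) radii(3) in force)
  have D: "2 * outer_radius > 0" using radii by simp
  have "energy ?\<tau> \<noteq> -\<infinity>" using \<tau>(2) \<mu>_props(3) by (simp add: polar_iff)
  then have "neg_energy (2 * outer_radius) ?\<tau> ?\<tau> \<noteq> \<infinity>"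
    unfolding energy_eq_neg_energy[OF D on] by auto
  then show "neg_energy (2 * outer_radius) far_measure far_measure < \<infinity>"
    unfolding far_measure_def neg_energy_translate[OF p(1)] by (simp add: less_top)
qed

abbreviation "\<omega> n \<equiv> julia_measure \<mu> n"

text \<open>The radii and the starting measure are the same for all \<open>n\<close>, so the support and mass bounds are uniform.\<close>
lemma julia_measure_props:
  assumes "n \<ge> 2"
  shows "prob_on (cball 0 escape_radius) (\<omega> n)"
    and "energy (\<omega> n) = ereal (- ln (\<gamma> n) / real (n - 1))"
    and "\<And>f V N. test_fun f \<Longrightarrow> (\<And>z. 0 \<le> f z) \<Longrightarrow> (\<And>z. f z \<le> indicator V z) \<Longrightarrow>
      (\<And>w r. cmod w \<le> outer_radius \<Longrightarrow>
         OP n - [:w:] = smult (complex_of_real (\<gamma> n)) (\<Prod>i<n. [:- r i, 1:]) \<Longrightarrow>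
         card {i. i < n \<and> r i \<in> V} \<le> N) \<Longrightarrow>
      (LINT z|\<omega> n. f z) \<le> real N / real n"
proof -
  have grow: "outer_radius < cmod (poly (OP n) z)" if "outer_radius < cmod z" for z
    using OP_escape_radius[OF assms, of z] that radii by simp
  obtain r :: "nat \<Rightarrow> complex \<Rightarrow> complex" where r: "\<And>i. r i \<in> borel_measurable borel" "\<And>i w. r i w \<in> cball 0 outer_radius"
    "\<And>w. w \<in> cball 0 outer_radius \<Longrightarrow> OP n - [:w:] = smult (lead_coeff (OP n)) (\<Prod>i<n. [:- r i w, 1:])"
    using measurable_preimages[OF degree_OP[of n] _ radii(4) grow] assms by auto
  have loc: "escaping_pullback (OP n) n (\<gamma> n) outer_radius r escape_radius far_measure"
  proof
    show "degree (OP n) = n" by (rule degree_OP)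
    show "2 \<le> n" by (rule assms)
    show "lead_coeff (OP n) = complex_of_real (\<gamma> n)" by (rule lead_OP)
    show "0 < \<gamma> n" by (rule \<gamma>_pos)
    show "0 < outer_radius" by (rule radii)
    show "r i \<in> borel_measurable borel" for i by (rule r)
    show "r i w \<in> cball 0 outer_radius" for i w by (rule r)
    show "OP n - [:w:] = smult (complex_of_real (\<gamma> n)) (\<Prod>i<n. [:- r i w, 1:])" if "w \<in> cball 0 outer_radius" for w
      using r(3)[OF that] unfolding lead_OP .
    show "0 < escape_radius" "escape_radius + 1 \<le> outer_radius" by (rule radii)+
    show "2 * cmod z \<le> cmod (poly (OP n) z)" if "escape_radius \<le> cmod z" for z
      by (rule OP_escape_radius[OF assms that])
    show "prob_on {z. escape_radius + 1 \<le> cmod z \<and> cmod z \<le> outer_radius} far_measure"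
      "neg_energy (2 * outer_radius) far_measure far_measure < \<infinity>" by (rule far_measure)+
  qed
  note eq = escaping_pullback.julia_equilibrium[OF loc, folded julia_measure_def]
  show "prob_on (cball 0 escape_radius) (\<omega> n)"
    by (rule prob_on_mono[OF eq(1)])
       (use escaping_pullback.julia_subset[OF loc] escaping_pullback.filled_julia_subset[OF loc] in blast)
  show "energy (\<omega> n) = ereal (- ln (\<gamma> n) / real (n - 1))" by (rule eq(2))
  fix f V N
  assume f: "test_fun f" "\<And>z. 0 \<le> f z" "\<And>z. f z \<le> indicator V z"
    and count: "\<And>w r. cmod w \<le> outer_radius \<Longrightarrow>
         OP n - [:w:] = smult (complex_of_real (\<gamma> n)) (\<Prod>i<n. [:- r i, 1:]) \<Longrightarrow>
         card {i. i < n \<and> r i \<in> V} \<le> N"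
  show "(LINT z|\<omega> n. f z) \<le> real N / real n"
  proof (rule eq(3)[OF f])
    fix w :: complex assume w: "w \<in> cball 0 outer_radius"
    show "card {i. i < n \<and> r i w \<in> V} \<le> N"
    proof (rule count)
      show "cmod w \<le> outer_radius" using w by simp
      show "OP n - [:w:] = smult (complex_of_real (\<gamma> n)) (\<Prod>i<n. [:- r i w, 1:])"
        using r(3)[OF w] unfolding lead_OP .
    qed
  qed
qed

text \<open>Near a point of the unbounded component the number of preimages is bounded by some \<open>N\<close>, so the mass there is at
  most \<open>N / n\<close>.\<close>
lemma limit_in_filled_support:
  assumes "strict_mono (s :: nat \<Rightarrow> nat)" "\<And>k. 2 \<le> s k" "borel_prob \<nu>" "weak_star_conv (\<lambda>k. \<omega> (s k)) \<nu>"
  shows "msupport \<nu> \<subseteq> K"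
proof
  fix \<zeta> assume \<zeta>: "\<zeta> \<in> msupport \<nu>"
  show "\<zeta> \<in> K"
  proof (rule ccontr)
    assume "\<zeta> \<notin> K"
    then have o: "\<zeta> \<in> outside S" by (simp add: filled_support_def)
    obtain \<rho> N where \<rho>: "\<rho> > 0"
      and count: "\<And>n w r. n \<ge> 1 \<Longrightarrow> cmod w \<le> outer_radius \<Longrightarrow> OP n - [:w:] = smult (complex_of_real (\<gamma> n)) (\<Prod>i<n. [:- r i, 1:]) \<Longrightarrow>
         card {i. i < n \<and> r i \<in> ball \<zeta> \<rho>} \<le> N"
      by (rule few_preimages[OF o less_imp_le[OF radii(4)]]) (rule that; assumption)
    have le: "(LINT z|\<omega> (s k). bump \<zeta> \<rho> z) \<le> real N / real (s k)" for k
    proof (rule julia_measure_props(3)[OF assms(2)])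
      show "test_fun (bump \<zeta> \<rho>)" by (rule test_fun_bump[OF \<rho>])
      show "0 \<le> bump \<zeta> \<rho> z" "bump \<zeta> \<rho> z \<le> indicator (ball \<zeta> \<rho>) z" for z
        by (rule bump_bounds[OF \<rho>])+
      show "card {i. i < s k \<and> r i \<in> ball \<zeta> \<rho>} \<le> N"
        if "cmod w \<le> outer_radius" "OP (s k) - [:w:] = smult (complex_of_real (\<gamma> (s k))) (\<Prod>i<s k. [:- r i, 1:])" for w r
        using assms(2)[of k] by (intro count[OF _ that]) simp
    qed
    have "(\<lambda>n. real N / real n) \<longlonglongrightarrow> 0" by (rule lim_const_over_n)
    from LIMSEQ_subseq_LIMSEQ[OF this assms(1)]
    have "(\<lambda>k. real N / real (s k)) \<longlonglongrightarrow> 0" by (simp only: comp_def)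
    moreover have "(\<lambda>k. LINT z|\<omega> (s k). bump \<zeta> \<rho> z) \<longlonglongrightarrow> (LINT z|\<nu>. bump \<zeta> \<rho> z)"
      by (rule weak_star_convD[OF assms(4) test_fun_bump[OF \<rho>]])
    ultimately have "(LINT z|\<nu>. bump \<zeta> \<rho> z) \<le> 0"
      using le by (intro LIMSEQ_le[of _ _ "\<lambda>k. real N / real (s k)"]) auto
    moreover have "0 \<le> (LINT z|\<nu>. bump \<zeta> \<rho> z)"
      using bump_bounds(1)[OF \<rho>] by (intro integral_nonneg_AE) auto
    ultimately have "(LINT z|\<nu>. bump \<zeta> \<rho> z) = 0" by simp
    then show False using not_in_msupport_bump[OF assms(3) \<rho>] \<zeta> by blast
  qed
qed

text \<open>The exponents \<open>1 / n\<close> in the regularity condition and \<open>1 / (n - 1)\<close> in the energy have ratio tending to 1.\<close>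
lemma julia_energy_limit:
  assumes "nth_root_regular \<mu>"
  shows "\<exists>c. set_energy S = ereal c \<and> (\<lambda>n. - ln (\<gamma> n) / real (n - 1)) \<longlonglongrightarrow> c"
proof -
  obtain c where c: "set_energy S = ereal c"
    using \<mu>_props(3) set_energy_bounded[OF \<mu>_props(2)] by (cases "set_energy S") (auto simp: polar_iff)
  have "1 / log_capacity S = ereal (exp (- c))"
    unfolding log_capacity_def c by (simp add: one_ereal_def exp_minus divide_inverse)
  then have root: "(\<lambda>n. root n (\<gamma> n)) \<longlonglongrightarrow> exp (- c)"
    using assms unfolding nth_root_regular_def by simp
  have "(\<lambda>n. ln (root n (\<gamma> n))) \<longlonglongrightarrow> ln (exp (- c))"
    by (rule tendsto_ln[OF root]) simp
  then have log_root: "(\<lambda>n. ln (root n (\<gamma> n))) \<longlonglongrightarrow> - c" by simp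
  have ratio: "(\<lambda>n. real n / real (n - 1)) \<longlonglongrightarrow> 1"
  proof -
    have "(\<lambda>n. 1 + 1 / real n) \<longlonglongrightarrow> 1"
      using tendsto_add[OF tendsto_const lim_const_over_n[of 1], of "1::real"] by simp
    then have "(\<lambda>n. real (Suc n) / real (Suc n - 1)) \<longlonglongrightarrow> 1"
    proof (rule Lim_transform_eventually)
      show "eventually (\<lambda>n. 1 + 1 / real n = real (Suc n) / real (Suc n - 1)) sequentially"
        using eventually_gt_at_top[of 0] by eventually_elim (simp add: field_simps)
    qed
    then show ?thesis by (rule LIMSEQ_imp_Suc)
  qed
  have "(\<lambda>n. - (ln (root n (\<gamma> n)) * (real n / real (n - 1)))) \<longlonglongrightarrow> - (- c * 1)"
    by (intro tendsto_minus tendsto_mult log_root ratio)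
  then have "(\<lambda>n. - (ln (root n (\<gamma> n)) * (real n / real (n - 1)))) \<longlonglongrightarrow> c" by simp
  then have "(\<lambda>n. - ln (\<gamma> n) / real (n - 1)) \<longlonglongrightarrow> c"
  proof (rule Lim_transform_eventually)
    show "eventually (\<lambda>n. - (ln (root n (\<gamma> n)) * (real n / real (n - 1))) = - ln (\<gamma> n) / real (n - 1)) sequentially"
      using eventually_gt_at_top[of 0]
    proof eventually_elim
      case (elim n)
      have "ln (root n (\<gamma> n)) = ln (\<gamma> n) / real n" by (rule ln_root[OF elim])
      then show ?case using elim by simp
    qed
  qed
  then show ?thesis using c by blast
qed

lemma regular_limit:
  assumes "nth_root_regular \<mu>"
    "strict_mono (s :: nat \<Rightarrow> nat)" "\<And>k. 2 \<le> s k" "borel_prob \<nu>" "weak_star_conv (\<lambda>k. \<omega> (s k)) \<nu>"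
  shows "\<nu> = equilibrium_measure S"
proof (rule filled_equilibrium)
  show "prob_on K \<nu>"
    using limit_in_filled_support[OF assms(2-5)] assms(4)
    by (simp add: prob_on_iff_msupport[OF compact_imp_closed[OF compact_K]])
  obtain c where c: "set_energy S = ereal c" "(\<lambda>n. - ln (\<gamma> n) / real (n - 1)) \<longlonglongrightarrow> c"
    using julia_energy_limit[OF assms(1)] by blast
  have lim: "(\<lambda>k. - ln (\<gamma> (s k)) / real (s k - 1)) \<longlonglongrightarrow> c"
    using LIMSEQ_subseq_LIMSEQ[OF c(2) assms(2)] by (simp add: comp_def)
  show "set_energy S \<le> energy \<nu>"
    unfolding c(1)
  proof (rule dense_le)
    fix y assume y: "y < ereal c"
    show "y \<le> energy \<nu>"
    proof (cases y)
      case (real c')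
      have "eventually (\<lambda>k. c' < - ln (\<gamma> (s k)) / real (s k - 1)) sequentially"
        using y real by (intro order_tendstoD(1)[OF lim]) simp
      then have "eventually (\<lambda>k. ereal c' \<le> energy (\<omega> (s k))) sequentially"
        by eventually_elim (simp add: julia_measure_props(2)[OF assms(3)])
      then show ?thesis
        unfolding real by (rule energy_usc[OF assms(5) julia_measure_props(1)[OF assms(3)] assms(4)])
    qed (use y in auto)
  qed
qed

lemma julia_measures_compact:
  fixes s :: "nat \<Rightarrow> nat"
  assumes "\<And>k. 2 \<le> s k"
  obtains t \<nu> where "strict_mono (t :: nat \<Rightarrow> nat)" "borel_prob \<nu>" "weak_star_conv (\<lambda>k. \<omega> (s (t k))) \<nu>"
  using weak_star_compact[OF julia_measure_props(1)[OF assms]] .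

text \<open>A subsequence staying away from the claimed limit would by compactness have a convergent subsequence, whose limit is
  identified by \<open>regular_limit\<close>.\<close>
lemma regular_convergence:
  assumes "nth_root_regular \<mu>"
  shows "weak_star_conv (\<lambda>n. \<omega> (n + 2)) (equilibrium_measure S)"
  unfolding weak_star_conv_test_fun
proof (intro allI impI)
  fix f assume f: "test_fun f"
  let ?a = "\<lambda>n. LINT z|\<omega> (n + 2). f z"
  let ?L = "LINT z|equilibrium_measure S. f z"
  show "?a \<longlonglongrightarrow> ?L"
  proof (rule ccontr)
    assume "\<not> ?a \<longlonglongrightarrow> ?L"
    then obtain e where e: "e > 0" "\<And>N. \<exists>n\<ge>N. e \<le> dist (?a n) ?L"
      unfolding LIMSEQ_def by (meson not_less)
    then have inf: "infinite {n. e \<le> dist (?a n) ?L}"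
      unfolding infinite_nat_iff_unbounded_le by blast
    define s where "s = enumerate {n. e \<le> dist (?a n) ?L}"
    have s: "strict_mono s" unfolding s_def by (rule strict_mono_enumerate[OF inf])
    have far: "e \<le> dist (?a (s k)) ?L" for k
      using enumerate_in_set[OF inf, of k] by (simp add: s_def)
    obtain t \<nu> where t: "strict_mono (t :: nat \<Rightarrow> nat)" "borel_prob \<nu>" "weak_star_conv (\<lambda>k. \<omega> (s (t k) + 2)) \<nu>"
      using julia_measures_compact[of "\<lambda>k. s k + 2"] by auto
    have mono: "strict_mono (\<lambda>k. s (t k) + 2)"
      using strict_mono_compose[OF s t(1)] by (simp add: strict_mono_def)
    have "\<nu> = equilibrium_measure S"
      by (rule regular_limit[OF assms mono _ t(2,3)]) simp
    then have "(\<lambda>k. ?a (s (t k))) \<longlonglongrightarrow> ?L"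
      using weak_star_convD[OF t(3) f] by simp
    then have "eventually (\<lambda>k. dist (?a (s (t k))) ?L < e) sequentially"
      using e(1) by (rule tendstoD)
    then obtain k where "dist (?a (s (t k))) ?L < e" by (auto simp: eventually_sequentially)
    then show False using far[of "t k"] by simp
  qed
qed

end

theorem theoremA:
  fixes \<mu> :: "complex measure"
  assumes "\<mu> \<in> nonpolar_measures"
  shows "weak_star_precompact (\<lambda>n. julia_measure \<mu> (n + 2))
    \<and> (\<forall>(r :: nat \<Rightarrow> nat) \<nu>. strict_mono r \<longrightarrow> (\<forall>k. 2 \<le> r k) \<longrightarrow> borel_prob \<nu> \<longrightarrow>
          weak_star_conv (\<lambda>k. julia_measure \<mu> (r k)) \<nu> \<longrightarrow> msupport \<nu> \<subseteq> filled_support \<mu>)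
    \<and> (nth_root_regular \<mu> \<longrightarrow>
          weak_star_conv (\<lambda>n. julia_measure \<mu> (n + 2)) (equilibrium_measure (msupport \<mu>)))"
proof -
  interpret nonpolar_measure \<mu> by unfold_locales (rule assms)
  have "weak_star_precompact (\<lambda>n. julia_measure \<mu> (n + 2))"
    unfolding weak_star_precompact_def
  proof (intro allI impI)
    fix r :: "nat \<Rightarrow> nat"
    obtain t \<nu> where "strict_mono (t :: nat \<Rightarrow> nat)" "borel_prob \<nu>" "weak_star_conv (\<lambda>k. julia_measure \<mu> (r (t k) + 2)) \<nu>"
      using julia_measures_compact[of "\<lambda>k. r k + 2"] by auto
    then show "\<exists>s \<nu>. strict_mono s \<and> borel_prob \<nu> \<and> weak_star_conv (\<lambda>k. julia_measure \<mu> (r (s k) + 2)) \<nu>"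
      by blast
  qed
  then show ?thesis
    using limit_in_filled_support regular_convergence by blast
qed

end
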